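(* Let $d=2$ and $r_1,r_2\ge2$. Let $\{\mathbf X_1,\dots,\mathbf X_n\}$ be a sample drawn from a distribution $P$ on $\mathcal X_1\times\mathcal X_2$ whose probability array $\mathbf p\in\mathcal P$ has support $\mathcal S_{\mathbf p}$ such that $\Gamma(\mathcal S_{\mathbf p})\ne\emptyset$. Let $\boldsymbol\gamma_{\mathbf p}=\mathcal I_\Gamma(\mathbf p)$, let $\Upsilon=\Upsilon(\boldsymbol\gamma_{\mathbf p})$ be Yule's coefficient, and let $\widehat\Upsilon_n=\Upsilon(\widehat{\boldsymbol\gamma}_n)$ be the empirical Yule's coefficient, where $\widehat{\boldsymbol\gamma}_n=\mathcal I_\Gamma(\widehat{\mathbf p}_n)$. Write $\underline{\boldsymbol p}=\mathrm{vec}(\mathbf p)$, $\widehat{\underline{\boldsymbol p}}_n=\mathrm{vec}(\widehat{\mathbf p}_n)$, $\underline{\boldsymbol\gamma}_{\mathbf p}=\mathrm{vec}(\boldsymbol\gamma_{\mathbf p})$. (a) If $\widehat{\mathbf p}_n\to\mathbf p$ in probability (resp. almost surely) as $n\to\infty$, then $\widehat\Upsilon_n\to\Upsilon$ in probability (resp. almost surely). Assume moreover that $d_\circ=\dim(\boldsymbol\Delta^\circ(\mathcal S_{\mathbf p}))\ge1$, let $\Delta_1,\dots,\Delta_{d_\circ}$ be a basis of $\boldsymbol\Delta^\circ(\mathcal S_{\mathbf p})$, let $A$ be the $r_1r_2\times d_\circ$ matrix with columns $\mathrm{vec}(\Delta_1),\dots,\mathrm{vec}(\Delta_{d_\circ})$,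 let $R=R_{\mathcal S_{\mathbf p}}$ be the entry selection matrix of $\mathcal S_{\mathbf p}$, and $\widetilde A=RA$. Let $\kappa=12/\sqrt{(r_1-1)(r_1+1)(r_2-1)(r_2+1)}$ and $\boldsymbol w=(1,2,\dots,r_2)^{\top}\otimes(1,2,\dots,r_1)^{\top}\in\mathbb R^{r_1r_2}$ (Kronecker product). (b) If $\rho_n(\widehat{\underline{\boldsymbol p}}_n-\underline{\boldsymbol p})\to\boldsymbol Z$ in distribution as $n\to\infty$ for some sequence $\rho_n\to\infty$ and some $r_1r_2$-dimensional random vector $\boldsymbol Z$, then $$\rho_n(\widehat\Upsilon_n-\Upsilon)\to\kappa\,\boldsymbol w^{\top}J\boldsymbol Z\ \text{ in distribution},\quad J=A\left[\widetilde A^{\top}\mathrm{diag}^{-1}(R\,\underline{\boldsymbol\gamma}_{\mathbf p})\widetilde A\right]^{-1}\widetilde A^{\top}\mathrm{diag}^{-1}(R\,\underline{\boldsymbol p})R.$$ (c) In particular, if $\{\mathbf X_1,\dots,\mathbf X_n\}$ is an i.i.d. sample drawn from $P$, so that $\sqrt n(\widehat{\underline{\boldsymbol p}}_n-\underline{\boldsymbol p})\to\mathcal N_{r_1r_2}(\mathbf 0,\mathrm{diag}(\underline{\boldsymbol p})-\underline{\boldsymbol p}\,\underline{\boldsymbol p}^{\top})$ in distribution, then $$\sqrt n(\widehat\Upsilon_n-\Upsilon)\to\mathcal N(0,\sigma_\Upsilon^2)\ \text{ in distribution as }n\to\infty,\qquad\sigma^2_\Upsilon=\kappa^2\,\boldsymbol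 w^{\top}\boldsymbol\Sigma_\gamma\boldsymbol w,$$ where $$\boldsymbol\Sigma_\gamma=A\left[\widetilde A^{\top}\mathrm{diag}^{-1}(R\,\underline{\boldsymbol\gamma}_{\mathbf p})\widetilde A\right]^{-1}\left[\widetilde A^{\top}\mathrm{diag}^{-1}(R\,\underline{\boldsymbol p})\widetilde A\right]\left[\widetilde A^{\top}\mathrm{diag}^{-1}(R\,\underline{\boldsymbol\gamma}_{\mathbf p})\widetilde A\right]^{-1}A^{\top}.$$
   Context: Arrays (bivariate case). $[s]=\{1,\dots,s\}$; $\mathcal R=[r_1]\times[r_2]$; arrays are real $r_1\times r_2$ matrices $\mathbf a=(a_{i_1i_2})$; $\mathrm{Supp}(\mathbf a)=\{(i_1,i_2):a_{i_1i_2}\neq0\}$; margins are the vectors of row sums and of column sums. $\mathcal P$ is the set of arrays with entries in $[0,1]$ summing to $1$ and with all row sums and column sums positive. $\Gamma$ is the set of $\boldsymbol\gamma\in\mathcal P$ with all row sums equal to $1/r_1$ and all column sums equal to $1/r_2$. For nonempty $\mathcal S\subseteq\mathcal R$, $\Gamma(\mathcal S)=\{\boldsymbol\gamma\in\Gamma:\mathrm{Supp}(\boldsymbol\gamma)=\mathcal S\}$ and $\boldsymbol\Delta^\circ(\mathcal S)$ is the linear space of real $r_1\times r_2$ arrays with support included in $\mathcal S$ and all row sums and column sums equal to $0$. $\mathcal I$-projection. For $\mathbf p,\mathbf q\in\mathcal P$, $\mathcal I(\mathbf q\|\mathbf p)=\sum_{\boldsymbol i\in\mathrm{Supp}(\mathbf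 p)}q_{\boldsymbol i}\log(q_{\boldsymbol i}/p_{\boldsymbol i})$ if $\mathrm{Supp}(\mathbf q)\subseteq\mathrm{Supp}(\mathbf p)$ (with $0\log0=0$) and $\infty$ otherwise. $\mathcal I_\Gamma(\mathbf p)$ denotes the minimiser of $\boldsymbol\gamma\mapsto\mathcal I(\boldsymbol\gamma\|\mathbf p)$ over $\Gamma$; when $\Gamma(\mathrm{Supp}(\mathbf p))\neq\emptyset$ it exists, is unique and has support $\mathrm{Supp}(\mathbf p)$. Vectorisation. $\mathrm{vec}$ is column-major vectorisation, $\mathrm{vec}(\mathbf a)_{\phi(i_1,i_2)}=a_{i_1i_2}$ with $\phi(i_1,i_2)=i_1+(i_2-1)r_1$. $R_{\mathcal S}$ is the $|\mathcal S|\times r_1r_2$ matrix obtained from the identity matrix of size $r_1r_2$ by deleting the rows with index $\phi(\boldsymbol i)$, $\boldsymbol i\in\mathcal R\setminus\mathcal S$. $\mathrm{diag}^{-1}(\boldsymbol v)$ is the inverse of the diagonal matrix $\mathrm{diag}(\boldsymbol v)$. Sampling. $\mathcal X_\ell=\{x^{(\ell)}_1<\dots<x^{(\ell)}_{r_\ell}\}\subset\mathbb R$, $\ell=1,2$. The probability array of $P$ is $p_{i_1i_2}=P(\{(x^{(1)}_{i_1},x^{(2)}_{i_2})\})$, assumed in $\mathcal P$. $\mathbf X_1,\dots,\mathbf X_n$ are random vectors each with distribution $P$ (not assumed independent unless stated). $\mathbf p_n$ has entries $\frac1n\sum_{k=1}^n\mathbf 1\{\mathbf X_k=(x^{(1)}_{i_1},x^{(2)}_{i_2})\}$,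 and $\widehat{\mathbf p}_n=\frac n{n+1}\mathbf p_n+\frac1{n+1}\mathbf q$ with $q_{\boldsymbol i}=|\mathcal S_{\mathbf p}|^{-1}\mathbf 1\{\boldsymbol i\in\mathcal S_{\mathbf p}\}$ (the support $\mathcal S_{\mathbf p}$ is known). Yule's coefficient. For $\boldsymbol\gamma=(\gamma_{i_1i_2})\in\Gamma$, $$\Upsilon(\boldsymbol\gamma)=\frac{12}{\sqrt{(r_1+1)(r_1-1)(r_2+1)(r_2-1)}}\sum_{i_1\in[r_1]}\sum_{i_2\in[r_2]}i_1i_2\gamma_{i_1i_2}-3\frac{\sqrt{(r_1+1)(r_2+1)}}{\sqrt{(r_1-1)(r_2-1)}}.$$ *)

theory Defs
  imports
    "HOL-Probability.Probability"
    "Jordan_Normal_Form.VS_Connect"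
    "Jordan_Normal_Form.DL_Submatrix"
    "Jordan_Normal_Form.Gauss_Jordan_Elimination"
begin

unbundle no vec_syntax
hide_const (open) Finite_Cartesian_Product.vec Finite_Cartesian_Product.mat
hide_type (open) Finite_Cartesian_Product.vec

text \<open>An \<open>r1 \<times> r2\<close> array is a matrix in \<open>carrier_mat r1 r2\<close>.  Indices start at \<open>0\<close>, so the
  mathematical index \<open>(i, j) \<in> [r1] \<times> [r2]\<close> is \<open>(i - 1, j - 1)\<close> here.\<close>

definition supp :: "real mat \<Rightarrow> (nat \<times> nat) set" where
  "supp a = {(i, j). i < dim_row a \<and> j < dim_col a \<and> a $$ (i, j) \<noteq> 0}"

definition row_margin :: "real mat \<Rightarrow> nat \<Rightarrow> real" where
  "row_margin a i = (\<Sum>j<dim_col a. a $$ (i, j))"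

definition col_margin :: "real mat \<Rightarrow> nat \<Rightarrow> real" where
  "col_margin a j = (\<Sum>i<dim_row a. a $$ (i, j))"

definition prob_arrays :: "nat \<Rightarrow> nat \<Rightarrow> real mat set" where
  "prob_arrays r1 r2 = {a \<in> carrier_mat r1 r2.
     (\<forall>i<r1. \<forall>j<r2. 0 \<le> a $$ (i, j) \<and> a $$ (i, j) \<le> 1) \<and>
     (\<Sum>i<r1. \<Sum>j<r2. a $$ (i, j)) = 1 \<and>
     (\<forall>i<r1. row_margin a i > 0) \<and> (\<forall>j<r2. col_margin a j > 0)}"

definition Gamma_unif :: "nat \<Rightarrow> nat \<Rightarrow> real mat set" where
  "Gamma_unif r1 r2 = {\<gamma> \<in> prob_arrays r1 r2.
     (\<forall>i<r1. row_margin \<gamma> i = 1 / real r1) \<and> (\<forall>j<r2. col_margin \<gamma> j = 1 / real r2)}"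

definition Gamma_supp :: "nat \<Rightarrow> nat \<Rightarrow> (nat \<times> nat) set \<Rightarrow> real mat set" where
  "Gamma_supp r1 r2 S = {\<gamma> \<in> Gamma_unif r1 r2. supp \<gamma> = S}"

definition Delta0 :: "nat \<Rightarrow> nat \<Rightarrow> (nat \<times> nat) set \<Rightarrow> real mat set" where
  "Delta0 r1 r2 S = {a \<in> carrier_mat r1 r2. supp a \<subseteq> S \<and>
     (\<forall>i<r1. row_margin a i = 0) \<and> (\<forall>j<r2. col_margin a j = 0)}"

abbreviation Delta0_space :: "nat \<Rightarrow> nat \<Rightarrow> (nat \<times> nat) set \<Rightarrow> (real, real mat) module" where
  "Delta0_space r1 r2 S \<equiv> (module_mat TYPE(real) r1 r2)\<lparr>carrier := Delta0 r1 r2 S\<rparr>"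

text \<open>The convention \<open>0 log 0 = 0\<close> is automatic, since \<open>0 * ln x = 0\<close> for every \<open>x\<close>.\<close>

definition I_div :: "real mat \<Rightarrow> real mat \<Rightarrow> ereal" where
  "I_div q p = (if supp q \<subseteq> supp p
     then ereal (\<Sum>i\<in>supp p. q $$ i * ln (q $$ i / p $$ i)) else \<infinity>)"

definition I_proj :: "real mat \<Rightarrow> real mat" where
  "I_proj p = arg_min_on (\<lambda>\<gamma>. I_div \<gamma> p) (Gamma_unif (dim_row p) (dim_col p))"

definition Yule :: "nat \<Rightarrow> nat \<Rightarrow> real mat \<Rightarrow> real" where
  "Yule r1 r2 \<gamma> =
     12 / sqrt ((real r1 + 1) * (real r1 - 1) * (real r2 + 1) * (real r2 - 1))
       * (\<Sum>i<r1. \<Sum>j<r2. real (i + 1) * real (j + 1) * \<gamma> $$ (i, j))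
     - 3 * sqrt ((real r1 + 1) * (real r2 + 1)) / sqrt ((real r1 - 1) * (real r2 - 1))"

definition Yule_kappa :: "nat \<Rightarrow> nat \<Rightarrow> real" where
  "Yule_kappa r1 r2 =
     12 / sqrt ((real r1 - 1) * (real r1 + 1) * (real r2 - 1) * (real r2 + 1))"

definition phi :: "nat \<Rightarrow> nat \<times> nat \<Rightarrow> nat" where
  "phi r1 = (\<lambda>(i, j). i + j * r1)"

text \<open>Column-major vectorisation: the entry at position \<open>phi r1 (i, j)\<close> is \<open>a $$ (i, j)\<close>.\<close>

definition vectorise :: "real mat \<Rightarrow> real vec" where
  "vectorise a = vec (dim_row a * dim_col a) (\<lambda>k. a $$ (k mod dim_row a, k div dim_row a))"

definition sel_mat :: "nat \<Rightarrow> nat \<Rightarrow> (nat \<times> nat) set \<Rightarrow> real mat" where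
  "sel_mat r1 r2 S = submatrix (1\<^sub>m (r1 * r2))
     ({..<r1 * r2} - phi r1 ` (({..<r1} \<times> {..<r2}) - S)) UNIV"

definition diag :: "real vec \<Rightarrow> real mat" where
  "diag v = mat_diag (dim_vec v) (\<lambda>i. v $ i)"

definition minv :: "real mat \<Rightarrow> real mat" where
  "minv B = the (mat_inverse B)"

definition kron_vec :: "real vec \<Rightarrow> real vec \<Rightarrow> real vec" where
  "kron_vec u v = vec (dim_vec u * dim_vec v) (\<lambda>k. u $ (k div dim_vec v) * v $ (k mod dim_vec v))"

definition Yule_weights :: "nat \<Rightarrow> nat \<Rightarrow> real vec" where
  "Yule_weights r1 r2 = kron_vec (vec r2 (\<lambda>j. real (j + 1))) (vec r1 (\<lambda>i. real (i + 1)))"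

definition prob_array ::
  "nat \<Rightarrow> nat \<Rightarrow> (nat \<Rightarrow> real) \<Rightarrow> (nat \<Rightarrow> real) \<Rightarrow> (real \<times> real) measure \<Rightarrow> real mat" where
  "prob_array r1 r2 x1 x2 P = mat r1 r2 (\<lambda>(i, j). measure P {(x1 i, x2 j)})"

definition emp_array ::
  "nat \<Rightarrow> nat \<Rightarrow> (nat \<Rightarrow> real) \<Rightarrow> (nat \<Rightarrow> real) \<Rightarrow> (nat \<Rightarrow> 'w \<Rightarrow> real \<times> real) \<Rightarrow> nat \<Rightarrow> 'w \<Rightarrow> real mat"
where
  "emp_array r1 r2 x1 x2 X n \<omega> =
     mat r1 r2 (\<lambda>(i, j). 1 / real n * (\<Sum>k=1..n. indicator {(x1 i, x2 j)} (X k \<omega>)))"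

definition unif_array :: "nat \<Rightarrow> nat \<Rightarrow> (nat \<times> nat) set \<Rightarrow> real mat" where
  "unif_array r1 r2 S = mat r1 r2 (\<lambda>i. indicator S i / real (card S))"

definition smooth_emp_array ::
  "nat \<Rightarrow> nat \<Rightarrow> (nat \<Rightarrow> real) \<Rightarrow> (nat \<Rightarrow> real) \<Rightarrow> (nat \<times> nat) set
     \<Rightarrow> (nat \<Rightarrow> 'w \<Rightarrow> real \<times> real) \<Rightarrow> nat \<Rightarrow> 'w \<Rightarrow> real mat"
where
  "smooth_emp_array r1 r2 x1 x2 S X n \<omega> =
     (real n / (real n + 1)) \<cdot>\<^sub>m emp_array r1 r2 x1 x2 X n \<omega>
       + (1 / (real n + 1)) \<cdot>\<^sub>m unif_array r1 r2 S"

definition mat_dist :: "real mat \<Rightarrow> real mat \<Rightarrow> real" where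
  "mat_dist a b = sqrt (\<Sum>i<dim_row b. \<Sum>j<dim_col b. (a $$ (i, j) - b $$ (i, j))\<^sup>2)"

definition conv_in_prob ::
  "'w measure \<Rightarrow> ('a \<Rightarrow> 'a \<Rightarrow> real) \<Rightarrow> (nat \<Rightarrow> 'w \<Rightarrow> 'a) \<Rightarrow> 'a \<Rightarrow> bool" where
  "conv_in_prob M d Y y \<longleftrightarrow>
     (\<forall>\<epsilon>>0. (\<lambda>n. measure M {\<omega> \<in> space M. d (Y n \<omega>) y > \<epsilon>}) \<longlonglongrightarrow> 0)"

definition conv_as ::
  "'w measure \<Rightarrow> ('a \<Rightarrow> 'a \<Rightarrow> real) \<Rightarrow> (nat \<Rightarrow> 'w \<Rightarrow> 'a) \<Rightarrow> 'a \<Rightarrow> bool" where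
  "conv_as M d Y y \<longleftrightarrow> (AE \<omega> in M. (\<lambda>n. d (Y n \<omega>) y) \<longlonglongrightarrow> 0)"

text \<open>The Borel sigma-algebra of \<open>R^N\<close>, transported to \<open>carrier_vec N\<close> by the coordinates.\<close>

definition borel_vec :: "nat \<Rightarrow> real vec measure" where
  "borel_vec N = vimage_algebra (carrier_vec N) (\<lambda>v. \<lambda>i\<in>{..<N}. v $ i) (\<Pi>\<^sub>M i\<in>{..<N}. borel)"

text \<open>Weak convergence of laws on \<open>carrier_vec N\<close>, tested on bounded continuous functions.
  The map \<open>x \<mapsto> vec N x\<close> from the product space \<open>nat \<Rightarrow> real\<close> keeps the first \<open>N\<close> coordinates and
  is an open surjection onto \<open>R^N\<close>, so \<open>f\<close> is continuous on \<open>R^N\<close> iff \<open>f \<circ> vec N\<close> is continuous.\<close>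

definition weak_conv_vec :: "nat \<Rightarrow> (nat \<Rightarrow> real vec measure) \<Rightarrow> real vec measure \<Rightarrow> bool" where
  "weak_conv_vec N \<mu>s \<mu> \<longleftrightarrow>
     (\<forall>f :: real vec \<Rightarrow> real.
        bounded (f ` carrier_vec N) \<and> continuous_on UNIV (\<lambda>x :: nat \<Rightarrow> real. f (vec N x)) \<longrightarrow>
        (\<lambda>n. \<integral>z. f z \<partial>\<mu>s n) \<longlonglongrightarrow> (\<integral>z. f z \<partial>\<mu>))"

text \<open>The law \<open>N(m, v)\<close> with variance \<open>v \<ge> 0\<close>; for \<open>v = 0\<close> it is the point mass at \<open>m\<close>.\<close>

definition normal_law :: "real \<Rightarrow> real \<Rightarrow> real measure" where
  "normal_law m v = distr std_normal_distribution borel (\<lambda>x. m + sqrt v * x)"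

text \<open>A possibly degenerate Gaussian law on \<open>R^N\<close>: all linear functionals are normal with the
  mean and variance prescribed by \<open>m\<close> and \<open>C\<close>.\<close>

definition is_normal_vec :: "nat \<Rightarrow> real vec \<Rightarrow> real mat \<Rightarrow> real vec measure \<Rightarrow> bool" where
  "is_normal_vec N m C \<nu> \<longleftrightarrow> prob_space \<nu> \<and> sets \<nu> = sets (borel_vec N) \<and>
     (\<forall>t\<in>carrier_vec N. distr \<nu> borel (\<lambda>z. t \<bullet> z) = normal_law (t \<bullet> m) (t \<bullet> (C *\<^sub>v t)))"

end

theory Submission
  imports Defs
begin

text \<open>
  On arrays with the support of \<open>p\<close>, the projection \<open>\<gamma> = I_proj p\<close> is characterised by
  \<open>\<Sum> d ln (\<gamma> / p) = 0\<close> for all zero-margin arrays \<open>d\<close>.  Subtracting this condition for \<open>p\<close> and \<open>q\<close> and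
  testing with \<open>d = \<gamma>\<^sub>q - \<gamma>\<^sub>p\<close> bounds \<open>\<gamma>\<^sub>q - \<gamma>\<^sub>p\<close> by \<open>ln q - ln p\<close> in \<open>\<ell>\<^sup>2\<close>, because \<open>(a - b) (ln a - ln b) \<ge> (a - b)\<^sup>2\<close>
  on \<open>(0, 1]\<close>.  This gives consistency.  Testing instead with the array \<open>u\<close> that represents Yule's weights for
  the inner product \<open>\<Sum> x y / \<gamma>\<close>, and expanding the logarithms, gives the derivative
  \<open>q - p \<mapsto> \<Sum> u (q - p) / p\<close> of Yule's coefficient; this is the functional \<open>w\<^sup>T J\<close>.  For i.i.d. samples the
  vector central limit theorem follows from the real one, as trigonometric polynomials are dense on boxes.
\<close>

section \<open>The I-projection onto arrays with uniform margins\<close>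

text \<open>The logarithms force every array in play to be positive exactly on
  \<open>supp p\<close>. The empirical array alone may miss a cell; the uniform term in
  \<open>smooth_emp_array\<close> fills all cells of \<open>supp p\<close>, and almost surely no
  observation falls elsewhere. Hence, for almost every outcome and every n, the true and the sample
  array have the same support, share one space \<open>Delta0\<close>, and one competitor from
  \<open>Gamma_supp\<close> serves both. \<open>I_proj\<close> is a Hilbert choice of a minimiser,
  so its properties are drawn from minimality, and the measurability of the estimator from its
  dependence on finitely many events. Yule's coefficient is scalar, so one test array
  \<open>u\<close> replaces the full derivative of the projection. Its coefficients in the given
  basis solve the normal equations of the Gram matrix inverted in J; this is the origin of the
  matrix formulas. In the i.i.d. case the rank-one part of the multinomial covariance contributes
  the square of the sum of the entries of \<open>u\<close>, which is 0; this leaves the stated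
  variance.\<close>

lemma compact_PiE_UNIV:
  fixes A :: "'i \<Rightarrow> 'b::topological_space set"
  assumes "\<And>i. compact (A i)"
  shows "compact (PiE UNIV A)"
proof -
  have "compactin (product_topology (\<lambda>i. euclidean) UNIV) (PiE UNIV A)"
    unfolding compactin_PiE using assms by (simp add: compactin_euclidean_iff)
  then show ?thesis
    by (simp add: euclidean_product_topology compactin_euclidean_iff)
qed

text \<open>Convexity is obtained from supporting lines and not from a second derivative, so that
  entries equal to 0 are covered.\<close>

lemma mult_ln_convex:
  fixes x y t c :: real
  assumes "0 \<le> x" "0 \<le> y" "0 < c" "0 \<le> t" "t \<le> 1"
  defines "z \<equiv> (1 - t) * x + t * y"
  shows "z * ln (z / c) \<le> (1 - t) * (x * ln (x / c)) + t * (y * ln (y / c))"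
proof (cases "z = 0")
  case True
  then have "(1 - t) * x = 0" "t * y = 0"
    using assms by (auto simp: z_def add_nonneg_eq_0_iff)
  then have "(1 - t) * (x * ln (x / c)) = 0" "t * (y * ln (y / c)) = 0"
    by auto
  then show ?thesis unfolding True by (simp only: mult_zero_left add_0_left order_refl)
next
  case False
  then have z: "z > 0"
    using assms by (simp add: z_def add_nonneg_nonneg order_less_le)
  \<comment> \<open>The line on the right is the tangent at \<open>z\<close>, with slope
    \<open>ln (z / c) + 1\<close>. It lies below the graph by \<open>ln x \<le> x - 1\<close> at
    \<open>x = z / a\<close>. In the average of the tangents at \<open>x\<close> and
    \<open>y\<close> the linear parts cancel.\<close>
  have tangent: "a * ln (a / c) \<ge> a * ln (z / c) + (a - z)" if "0 \<le> a" for a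
  proof (cases "a = 0")
    case False
    then have a: "a > 0" using that by simp
    have "ln (z / a) \<le> z / a - 1"
      using a z by (intro ln_le_minus_one) simp
    then have "a * ln (z / a) \<le> z - a"
      using a by (simp add: field_simps)
    moreover have "ln (z / c) = ln (z / a) + ln (a / c)"
      using a z assms by (simp add: ln_div)
    ultimately show ?thesis by (simp add: algebra_simps)
  qed (use z in simp)
  have "z * ln (z / c) = (1 - t) * (x * ln (z / c) + (x - z)) + t * (y * ln (z / c) + (y - z))"
    by (simp add: z_def algebra_simps)
  also have "\<dots> \<le> (1 - t) * (x * ln (x / c)) + t * (y * ln (y / c))"
    using assms tangent[of x] tangent[of y] by (intro add_mono mult_left_mono) auto
  finally show ?thesis .
qed

lemma continuous_on_mult_ln:
  fixes c :: real
  assumes "0 < c"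
  shows "continuous_on {0..} (\<lambda>x. x * ln (x / c))"
proof -
  have "continuous (at x within {0..}) (\<lambda>x. x * ln (x / c))" if "x \<ge> 0" for x
  proof (cases "x = 0")
    case True
    \<comment> \<open>The default value \<open>0 * ln 0 = 0\<close> agrees with the limit from the
      right.\<close>
    have "((\<lambda>x. x * ln (x / c)) \<longlongrightarrow> 0) (at_right 0)"
      using assms by real_asymp
    then show ?thesis
      using True by (simp add: continuous_within at_within_Ici_at_right)
  next
    case False
    then show ?thesis using that assms by (intro continuous_intros) auto
  qed
  then show ?thesis by (simp add: continuous_on_eq_continuous_within)
qed

section \<open>Supports, margins and zero-margin perturbations\<close>

lemma sum_array_eq_sum:
  fixes f :: "nat \<times> nat \<Rightarrow> real"
  assumes "S \<subseteq> {..<r1} \<times> {..<r2}" "\<And>i j. i < r1 \<Longrightarrow> j < r2 \<Longrightarrow> (i, j) \<notin> S \<Longrightarrow> f (i, j) = 0"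
  shows "(\<Sum>i<r1. \<Sum>j<r2. f (i, j)) = sum f S"
proof -
  have "(\<Sum>i<r1. \<Sum>j<r2. f (i, j)) = (\<Sum>s\<in>{..<r1} \<times> {..<r2}. f s)"
    by (simp add: sum.cartesian_product)
  also have "\<dots> = sum f S"
    using assms by (intro sum.mono_neutral_right) auto
  finally show ?thesis .
qed

lemma supp_subset: "a \<in> carrier_mat r1 r2 \<Longrightarrow> supp a \<subseteq> {..<r1} \<times> {..<r2}"
  by (auto simp: supp_def)

lemma finite_supp [simp]: "finite (supp a)"
  by (rule finite_subset[of _ "{..<dim_row a} \<times> {..<dim_col a}"]) (auto simp: supp_def)

lemma supp_subsetD:
  "a \<in> carrier_mat r1 r2 \<Longrightarrow> supp a \<subseteq> S \<Longrightarrow> s \<in> {..<r1} \<times> {..<r2} \<Longrightarrow> s \<notin> S \<Longrightarrow> a $$ s = 0"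
  by (cases s) (auto simp: supp_def)

lemma prob_arrays_pos: "p \<in> prob_arrays r1 r2 \<Longrightarrow> s \<in> supp p \<Longrightarrow> 0 < p $$ s"
  by (auto simp: supp_def prob_arrays_def order_less_le)

text \<open>The row sums give total mass 1, and a nonnegative entry cannot exceed the total
  mass.\<close>

lemma Gamma_unifI:
  assumes "0 < r1" "0 < r2" "a \<in> carrier_mat r1 r2"
    and nonneg: "\<And>i j. i < r1 \<Longrightarrow> j < r2 \<Longrightarrow> 0 \<le> a $$ (i, j)"
    and rows: "\<And>i. i < r1 \<Longrightarrow> row_margin a i = 1 / real r1"
    and cols: "\<And>j. j < r2 \<Longrightarrow> col_margin a j = 1 / real r2"
  shows "a \<in> Gamma_unif r1 r2"
proof -
  have total: "(\<Sum>i<r1. \<Sum>j<r2. a $$ (i, j)) = 1"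
  proof -
    have "(\<Sum>i<r1. \<Sum>j<r2. a $$ (i, j)) = (\<Sum>i<r1. row_margin a i)"
      using assms(3) by (simp add: row_margin_def)
    then show ?thesis using rows assms(1) by simp
  qed
  have "a $$ (i, j) \<le> 1" if "i < r1" "j < r2" for i j
  proof -
    have "a $$ (i, j) \<le> (\<Sum>j<r2. a $$ (i, j))"
      using that nonneg by (intro member_le_sum) auto
    also have "\<dots> \<le> (\<Sum>i<r1. \<Sum>j<r2. a $$ (i, j))"
      using that nonneg by (intro member_le_sum[of i _ "\<lambda>i. \<Sum>j<r2. a $$ (i, j)"]) (auto intro: sum_nonneg)
    finally show ?thesis using total by simp
  qed
  then show ?thesis
    using assms total by (auto simp: Gamma_unif_def prob_arrays_def)
qed

lemma Gamma_unifD: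
  assumes "a \<in> Gamma_unif r1 r2"
  shows "a \<in> carrier_mat r1 r2" "dim_row a = r1" "dim_col a = r2"
    "i < r1 \<Longrightarrow> j < r2 \<Longrightarrow> 0 \<le> a $$ (i, j)" "i < r1 \<Longrightarrow> j < r2 \<Longrightarrow> a $$ (i, j) \<le> 1"
    "i < r1 \<Longrightarrow> row_margin a i = 1 / real r1" "j < r2 \<Longrightarrow> col_margin a j = 1 / real r2"
  using assms by (auto simp: Gamma_unif_def prob_arrays_def)

lemma Gamma_unif_pos:
  assumes "a \<in> Gamma_unif r1 r2" "s \<in> supp a"
  shows "0 < a $$ s" "a $$ s \<le> 1"
  using assms Gamma_unifD[OF assms(1)] by (auto simp: supp_def order_less_le)

lemma Delta0D:
  assumes "d \<in> Delta0 r1 r2 S"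
  shows "d \<in> carrier_mat r1 r2" "dim_row d = r1" "dim_col d = r2" "supp d \<subseteq> S"
    "i < r1 \<Longrightarrow> row_margin d i = 0" "j < r2 \<Longrightarrow> col_margin d j = 0"
    "i < r1 \<Longrightarrow> j < r2 \<Longrightarrow> (i, j) \<notin> S \<Longrightarrow> d $$ (i, j) = 0"
  using assms by (auto simp: Delta0_def supp_subsetD)

lemma sum_Delta0:
  assumes "d \<in> Delta0 r1 r2 S" "S \<subseteq> {..<r1} \<times> {..<r2}"
  shows "(\<Sum>s\<in>S. d $$ s) = 0"
proof -
  have "(\<Sum>s\<in>S. d $$ s) = (\<Sum>i<r1. \<Sum>j<r2. d $$ (i, j))"
    using assms Delta0D[OF assms(1)] by (intro sum_array_eq_sum[symmetric]) auto
  also have "\<dots> = (\<Sum>i<r1. row_margin d i)"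
    using Delta0D[OF assms(1)] by (simp add: row_margin_def)
  finally show ?thesis using Delta0D[OF assms(1)] by simp
qed

lemma Gamma_unif_diff:
  assumes "a \<in> Gamma_unif r1 r2" "b \<in> Gamma_unif r1 r2" "supp a \<subseteq> S" "supp b \<subseteq> S"
  shows "b - a \<in> Delta0 r1 r2 S"
proof -
  note a = Gamma_unifD[OF assms(1)] and b = Gamma_unifD[OF assms(2)]
  have "row_margin (b - a) i = 0" if "i < r1" for i
    using a b that a(6)[OF that] b(6)[OF that] by (simp add: row_margin_def sum_subtractf)
  moreover have "col_margin (b - a) j = 0" if "j < r2" for j
    using a b that a(7)[OF that] b(7)[OF that] by (simp add: col_margin_def sum_subtractf)
  moreover have "supp (b - a) \<subseteq> S"
    using a(2,3) b(2,3) assms(3,4) by (force simp: supp_def subset_iff)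
  ultimately show ?thesis using a b by (auto simp: Delta0_def)
qed

lemma Gamma_unif_add_smult:
  assumes "0 < r1" "0 < r2" "a \<in> Gamma_unif r1 r2" "d \<in> Delta0 r1 r2 S"
    and "\<And>i j. i < r1 \<Longrightarrow> j < r2 \<Longrightarrow> 0 \<le> a $$ (i, j) + t * d $$ (i, j)"
  shows "a + t \<cdot>\<^sub>m d \<in> Gamma_unif r1 r2"
proof (rule Gamma_unifI)
  note a = Gamma_unifD[OF assms(3)] and d = Delta0D[OF assms(4)]
  show "row_margin (a + t \<cdot>\<^sub>m d) i = 1 / real r1" if "i < r1" for i
    using a d that a(6)[OF that] d(5)[OF that]
    by (simp add: row_margin_def sum.distrib flip: sum_distrib_left)
  show "col_margin (a + t \<cdot>\<^sub>m d) j = 1 / real r2" if "j < r2" for j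
    using a d that a(7)[OF that] d(6)[OF that]
    by (simp add: col_margin_def sum.distrib flip: sum_distrib_left)
qed (use assms Gamma_unifD[OF assms(3)] Delta0D[OF assms(4)] in auto)

section \<open>Existence, support and stationarity of the projection\<close>

lemma I_div_minimiser_exists:
  assumes "0 < r1" "0 < r2" "p \<in> prob_arrays r1 r2"
    and ne: "\<gamma>1 \<in> Gamma_unif r1 r2" "supp \<gamma>1 \<subseteq> supp p"
  obtains \<gamma> where "\<gamma> \<in> Gamma_unif r1 r2" "\<And>\<gamma>'. \<gamma>' \<in> Gamma_unif r1 r2 \<Longrightarrow> I_div \<gamma> p \<le> I_div \<gamma>' p"
proof -
  define S where "S = supp p"
  have pc: "p \<in> carrier_mat r1 r2" using assms(3) by (simp add: prob_arrays_def)
  have S: "S \<subseteq> {..<r1} \<times> {..<r2}" using supp_subset[OF pc] by (simp add: S_def)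
  have p_pos: "p $$ s > 0" if "s \<in> S" for s
    using that prob_arrays_pos[OF assms(3)] by (simp add: S_def)
  \<comment> \<open>The minimisation is carried out over functions with the product topology:
    Tychonoff makes the box compact, and the margin conditions cut out a closed subset. Cells
    outside \<open>S\<close> are pinned to 0, since only competitors supported in \<open>S\<close>
    have finite divergence.\<close>
  define K :: "(nat \<times> nat \<Rightarrow> real) set" where
    "K = PiE UNIV (\<lambda>s. if s \<in> S then {0..1} else {0})
      \<inter> ((\<Inter>i\<in>{..<r1}. {x. (\<Sum>j<r2. x (i, j)) = 1 / real r1})
      \<inter> (\<Inter>j\<in>{..<r2}. {x. (\<Sum>i<r1. x (i, j)) = 1 / real r2}))"
  define F :: "(nat \<times> nat \<Rightarrow> real) \<Rightarrow> real" where
    "F = (\<lambda>x. \<Sum>s\<in>S. x s * ln (x s / p $$ s))"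
  have "compact K"
    unfolding K_def
    by (intro compact_Int_closed compact_PiE_UNIV closed_Int closed_INT ballI closed_Collect_eq
        continuous_intros continuous_on_product_then_coordinatewise[OF continuous_on_id]) auto
  have to_K: "(\<lambda>s. if s \<in> S then a $$ s else 0) \<in> K" (is "?x \<in> K")
    and F_K: "ereal (F (\<lambda>s. if s \<in> S then a $$ s else 0)) = I_div a p"
    if "a \<in> Gamma_unif r1 r2" "supp a \<subseteq> S" for a
  proof -
    note a = Gamma_unifD[OF that(1)]
    have eq: "?x (i, j) = a $$ (i, j)" if "i < r1" "j < r2" for i j
      using that \<open>supp a \<subseteq> S\<close> a(2,3) by (auto simp: supp_def)
    have "(\<Sum>j<r2. ?x (i, j)) = 1 / real r1" if "i < r1" for i
      using eq[OF that] a(6)[OF that] a(3) by (simp add: row_margin_def)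
    moreover have "(\<Sum>i<r1. ?x (i, j)) = 1 / real r2" if "j < r2" for j
      using eq[OF _ that] a(7)[OF that] a(2) by (simp add: col_margin_def)
    moreover have "?x \<in> PiE UNIV (\<lambda>s. if s \<in> S then {0..1} else {0})"
      using a S by auto
    ultimately show "?x \<in> K" by (simp add: K_def)
    show "ereal (F ?x) = I_div a p"
      using that(2) by (simp add: F_def I_div_def S_def)
  qed
  have "K \<noteq> {}" using to_K[OF ne(1)] ne(2) by (auto simp: S_def)
  moreover have "continuous_on K F"
    unfolding F_def
  proof (intro continuous_on_sum)
    fix s assume s: "s \<in> S"
    have "continuous_on K (\<lambda>x. x s)"
      by (rule continuous_on_product_then_coordinatewise[OF continuous_on_id])
    moreover have "(\<lambda>x. x s) ` K \<subseteq> {0..}"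
      using s by (cases s) (auto simp: K_def PiE_def Pi_def split: if_splits)
    ultimately show "continuous_on K (\<lambda>x. x s * ln (x s / p $$ s))"
      using continuous_on_compose2[OF continuous_on_mult_ln[OF p_pos[OF s]]] by blast
  qed
  ultimately obtain x where x: "x \<in> K" "\<And>y. y \<in> K \<Longrightarrow> F x \<le> F y"
    using continuous_attains_inf[OF \<open>compact K\<close>] by metis
  define \<gamma> where "\<gamma> = mat r1 r2 x"
  have xS: "x s = 0" if "s \<notin> S" for s
    using x(1) that by (cases s) (auto simp: K_def PiE_def Pi_def split: if_splits)
  have x_nonneg: "0 \<le> x s" for s
    using x(1) xS by (cases s; cases "s \<in> S") (auto simp: K_def PiE_def Pi_def split: if_splits)
  have \<gamma>: "\<gamma> \<in> Gamma_unif r1 r2"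
    by (rule Gamma_unifI)
      (use assms x_nonneg x(1) in \<open>auto simp: \<gamma>_def K_def row_margin_def col_margin_def\<close>)
  have \<gamma>S: "supp \<gamma> \<subseteq> S"
  proof
    fix s assume "s \<in> supp \<gamma>"
    then have "x s \<noteq> 0" by (auto simp: supp_def \<gamma>_def)
    then show "s \<in> S" using xS by blast
  qed
  have "(\<lambda>s. if s \<in> S then \<gamma> $$ s else 0) = x"
    using xS S by (auto simp: \<gamma>_def fun_eq_iff)
  then have "I_div \<gamma> p = ereal (F x)" using F_K[OF \<gamma> \<gamma>S] by simp
  then have "I_div \<gamma> p \<le> I_div \<gamma>' p" if "\<gamma>' \<in> Gamma_unif r1 r2" for \<gamma>'
    using F_K[OF that] x(2)[OF to_K[OF that]] by (cases "supp \<gamma>' \<subseteq> S") (auto simp: I_div_def S_def simp flip: F_K)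
  then show thesis using \<gamma> that by blast
qed

text \<open>Existence is what turns the Hilbert choice inside \<open>arg_min_on\<close> into a
  genuine minimiser. The competitor \<gamma>1 has finite divergence, hence so has the minimiser,
  which bounds its support.\<close>

lemma I_proj_minimises:
  assumes "0 < r1" "0 < r2" "p \<in> prob_arrays r1 r2"
    and ne: "\<gamma>1 \<in> Gamma_unif r1 r2" "supp \<gamma>1 \<subseteq> supp p"
  shows "I_proj p \<in> Gamma_unif r1 r2"
    and "\<gamma>' \<in> Gamma_unif r1 r2 \<Longrightarrow> I_div (I_proj p) p \<le> I_div \<gamma>' p"
    and "supp (I_proj p) \<subseteq> supp p"
proof -
  have dims: "dim_row p = r1" "dim_col p = r2" using assms(3) by (auto simp: prob_arrays_def)
  obtain \<gamma> where "\<gamma> \<in> Gamma_unif r1 r2" "\<And>\<gamma>'. \<gamma>' \<in> Gamma_unif r1 r2 \<Longrightarrow> I_div \<gamma> p \<le> I_div \<gamma>' p"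
    using I_div_minimiser_exists[OF assms] by blast
  then have "is_arg_min (\<lambda>\<gamma>. I_div \<gamma> p) (\<lambda>x. x \<in> Gamma_unif r1 r2) \<gamma>"
    by (auto simp: is_arg_min_linorder)
  then have *: "is_arg_min (\<lambda>\<gamma>. I_div \<gamma> p) (\<lambda>x. x \<in> Gamma_unif r1 r2) (I_proj p)"
    unfolding I_proj_def arg_min_on_def arg_min_def dims by (rule someI)
  then show "I_proj p \<in> Gamma_unif r1 r2"
    and min: "\<And>\<gamma>'. \<gamma>' \<in> Gamma_unif r1 r2 \<Longrightarrow> I_div (I_proj p) p \<le> I_div \<gamma>' p"
    by (auto simp: is_arg_min_linorder)
  show "supp (I_proj p) \<subseteq> supp p"
    using min[OF ne(1)] ne(2) by (auto simp: I_div_def split: if_splits)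
qed

text \<open>Moving from a boundary point towards an array of full support decreases the divergence,
  because \<open>x ln x\<close> has slope \<open>-\<infinity>\<close> at \<open>0\<close>.\<close>

lemma supp_I_proj:
  assumes "0 < r1" "0 < r2" "p \<in> prob_arrays r1 r2" "\<gamma>1 \<in> Gamma_supp r1 r2 (supp p)"
  shows "supp (I_proj p) = supp p"
proof (rule ccontr)
  assume "supp (I_proj p) \<noteq> supp p"
  have \<gamma>1: "\<gamma>1 \<in> Gamma_unif r1 r2" "supp \<gamma>1 = supp p"
    using assms(4) by (auto simp: Gamma_supp_def)
  define \<gamma> S where "\<gamma> = I_proj p" and "S = supp p"
  note proj = I_proj_minimises[OF assms(1-3) \<gamma>1(1), folded \<gamma>_def]
  have \<gamma>: "\<gamma> \<in> Gamma_unif r1 r2" and \<gamma>S: "supp \<gamma> \<subseteq> S"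
    using proj \<gamma>1 by (auto simp: S_def)
  note g = Gamma_unifD[OF \<gamma>] and g1 = Gamma_unifD[OF \<gamma>1(1)]
  have pc: "p \<in> carrier_mat r1 r2" using assms(3) by (simp add: prob_arrays_def)
  have S: "S \<subseteq> {..<r1} \<times> {..<r2}" using supp_subset[OF pc] by (simp add: S_def)
  have p_pos: "p $$ s > 0" if "s \<in> S" for s
    using that prob_arrays_pos[OF assms(3)] by (simp add: S_def)
  define Z where "Z = S - supp \<gamma>"
  have Z: "finite Z" "Z \<noteq> {}" "Z \<subseteq> S"
    using \<open>supp (I_proj p) \<noteq> supp p\<close> \<gamma>S by (auto simp: Z_def S_def \<gamma>_def)
  define f where "f = (\<lambda>s x. x * ln (x / p $$ s))"
  define c where "c = (\<Sum>s\<in>Z. \<gamma>1 $$ s)"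
  have c: "c > 0"
    unfolding c_def using Z Gamma_unif_pos[OF \<gamma>1(1)] \<gamma>1(2)
    by (intro sum_pos) (auto simp: S_def)
  define D where "D = (\<Sum>s\<in>S. f s (\<gamma>1 $$ s)) - (\<Sum>s\<in>S. f s (\<gamma> $$ s))"
  \<comment> \<open>Chosen so that \<open>ln t * c = - (\<bar>D\<bar> + 1)\<close>, which makes
    \<open>D + ln t * c\<close> negative; minimality will require it to be nonnegative.\<close>
  define t where "t = exp (- (\<bar>D\<bar> + 1) / c)"
  have t: "0 < t" "t < 1" using c by (auto simp: t_def divide_less_0_iff)
  define \<gamma>t where "\<gamma>t = \<gamma> + t \<cdot>\<^sub>m (\<gamma>1 - \<gamma>)"
  have \<gamma>t_eq: "\<gamma>t $$ (i, j) = (1 - t) * \<gamma> $$ (i, j) + t * \<gamma>1 $$ (i, j)" if "i < r1" "j < r2" for i j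
    using that g g1 by (simp add: \<gamma>t_def algebra_simps)
  have \<gamma>t: "\<gamma>t \<in> Gamma_unif r1 r2"
    unfolding \<gamma>t_def
  proof (rule Gamma_unif_add_smult[OF assms(1,2) \<gamma> Gamma_unif_diff[OF \<gamma> \<gamma>1(1)]])
    fix i j assume ij: "i < r1" "j < r2"
    then have "0 \<le> (1 - t) * \<gamma> $$ (i, j) + t * \<gamma>1 $$ (i, j)" using g g1 t by simp
    then show "0 \<le> \<gamma> $$ (i, j) + t * (\<gamma>1 - \<gamma>) $$ (i, j)"
      using ij g g1 by (simp add: algebra_simps)
  qed (use \<gamma>S \<gamma>1 in \<open>auto simp: S_def\<close>)
  have \<gamma>tS: "supp \<gamma>t \<subseteq> S"
  proof -
    have "\<gamma>t $$ (i, j) = 0" if "i < r1" "j < r2" "(i, j) \<notin> S" for i j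
      using that \<gamma>t_eq[OF that(1,2)] supp_subsetD[OF g(1) \<gamma>S] supp_subsetD[OF g1(1), of S] \<gamma>1(2)
      by (simp add: S_def)
    then show ?thesis using Gamma_unifD(2,3)[OF \<gamma>t] by (auto simp: supp_def)
  qed
  have "(\<Sum>s\<in>S. f s (\<gamma> $$ s)) \<le> (\<Sum>s\<in>S. f s (\<gamma>t $$ s))"
    using proj(2)[OF _ \<gamma>t] \<gamma>1 \<gamma>S \<gamma>tS by (simp add: I_div_def f_def S_def)
  \<comment> \<open>On \<open>Z\<close> the entry of \<gamma> is 0, so the divergence term at
    \<open>t * \<gamma>1\<close> splits exactly and yields the extra
    \<open>t * ln t * \<gamma>1\<close>. Off \<open>Z\<close> plain convexity is enough.\<close>
  also have "\<dots> \<le> (\<Sum>s\<in>S. (1 - t) * f s (\<gamma> $$ s) + t * f s (\<gamma>1 $$ s)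
      + (if s \<in> Z then t * ln t * \<gamma>1 $$ s else 0))"
  proof (rule sum_mono)
    fix s assume s: "s \<in> S"
    then have s': "fst s < r1" "snd s < r2" using S by auto
    have gt: "\<gamma>t $$ s = (1 - t) * \<gamma> $$ s + t * \<gamma>1 $$ s"
      using \<gamma>t_eq[OF s'] by simp
    have pos: "0 \<le> \<gamma> $$ s" "0 < \<gamma>1 $$ s"
      using g(4)[OF s'] Gamma_unif_pos[OF \<gamma>1(1)] s \<gamma>1(2) by (auto simp: S_def)
    show "f s (\<gamma>t $$ s) \<le> (1 - t) * f s (\<gamma> $$ s) + t * f s (\<gamma>1 $$ s)
      + (if s \<in> Z then t * ln t * \<gamma>1 $$ s else 0)"
    proof (cases "s \<in> Z")
      case True
      then have "\<gamma> $$ s = 0" using s' supp_subsetD[OF g(1), of "supp \<gamma>"] by (auto simp: Z_def mem_Times_iff)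
      then show ?thesis
        using True gt pos t p_pos[OF s] by (simp add: f_def ln_mult ln_div algebra_simps)
    next
      case False
      then show ?thesis
        using mult_ln_convex[of "\<gamma> $$ s" "\<gamma>1 $$ s" "p $$ s" t] pos t p_pos[OF s] by (simp add: f_def gt)
    qed
  qed
  also have "\<dots> = (\<Sum>s\<in>S. f s (\<gamma> $$ s)) + t * D + t * ln t * c"
  proof -
    have "(\<Sum>s\<in>S. if s \<in> Z then t * ln t * \<gamma>1 $$ s else 0) = (\<Sum>s\<in>Z. t * ln t * \<gamma>1 $$ s)"
      using Z by (intro sum.mono_neutral_cong_right) (auto simp: S_def)
    then show ?thesis
      by (simp add: sum.distrib D_def c_def sum_distrib_left algebra_simps sum_subtractf)
  qed
  finally have "0 \<le> t * (D + ln t * c)" by (simp add: algebra_simps)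
  then have "0 \<le> D + ln t * c" using t by (simp add: zero_le_mult_iff)
  moreover have "ln t * c = - (\<bar>D\<bar> + 1)" using c by (simp add: t_def)
  ultimately show False by linarith
qed

text \<open>The projection is positive on the whole support, so it can be moved along
  \<open>d\<close> in both directions without leaving the feasible set, and 0 is an interior minimum
  of the divergence along this line. The derivative of \<open>x * ln (x / p)\<close> also
  contributes the term \<open>d\<close>, which sums to 0 because the margins of \<open>d\<close>
  vanish.\<close>

lemma I_proj_stationary:
  assumes "0 < r1" "0 < r2" "p \<in> prob_arrays r1 r2" "\<gamma>1 \<in> Gamma_supp r1 r2 (supp p)"
    and d: "d \<in> Delta0 r1 r2 (supp p)"
  shows "(\<Sum>s\<in>supp p. d $$ s * ln (I_proj p $$ s / p $$ s)) = 0"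
proof -
  have \<gamma>1: "\<gamma>1 \<in> Gamma_unif r1 r2" "supp \<gamma>1 = supp p"
    using assms(4) by (auto simp: Gamma_supp_def)
  define \<gamma> S where "\<gamma> = I_proj p" and "S = supp p"
  note proj = I_proj_minimises[OF assms(1-3) \<gamma>1(1), folded \<gamma>_def]
  have \<gamma>: "\<gamma> \<in> Gamma_unif r1 r2" and \<gamma>S: "supp \<gamma> = S"
    using proj \<gamma>1 supp_I_proj[OF assms(1-4)] by (auto simp: S_def \<gamma>_def)
  note g = Gamma_unifD[OF \<gamma>] and d' = Delta0D[OF d, folded S_def]
  have pc: "p \<in> carrier_mat r1 r2" using assms(3) by (simp add: prob_arrays_def)
  have S: "finite S" "S \<subseteq> {..<r1} \<times> {..<r2}" using supp_subset[OF pc] by (auto simp: S_def)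
  have p_pos: "p $$ s > 0" if "s \<in> S" for s
    using that prob_arrays_pos[OF assms(3)] by (simp add: S_def)
  have g_pos: "\<gamma> $$ s > 0" if "s \<in> S" for s
    using Gamma_unif_pos[OF \<gamma>] that \<gamma>S by auto
  define F where "F = (\<lambda>t. \<Sum>s\<in>S. (\<gamma> $$ s + t * d $$ s) * ln ((\<gamma> $$ s + t * d $$ s) / p $$ s))"
  have "\<forall>\<^sub>F t in nhds 0. \<forall>s\<in>S. \<gamma> $$ s + t * d $$ s > 0"
  proof (rule eventually_ball_finite[OF \<open>finite S\<close>], intro ballI)
    fix s assume "s \<in> S"
    have "((\<lambda>t. \<gamma> $$ s + t * d $$ s) \<longlongrightarrow> \<gamma> $$ s + 0 * d $$ s) (nhds 0)"
      by (intro tendsto_intros filterlim_ident)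
    then have "((\<lambda>t. \<gamma> $$ s + t * d $$ s) \<longlongrightarrow> \<gamma> $$ s) (nhds 0)" by simp
    then show "\<forall>\<^sub>F t in nhds 0. \<gamma> $$ s + t * d $$ s > 0"
      using g_pos[OF \<open>s \<in> S\<close>] by (intro order_tendstoD) auto
  qed
  then obtain e where e: "e > 0" "\<And>t. \<bar>t\<bar> < e \<Longrightarrow> \<forall>s\<in>S. \<gamma> $$ s + t * d $$ s > 0"
    unfolding eventually_nhds_metric by (auto simp: dist_real_def)
  have min: "F 0 \<le> F t" if "\<bar>t\<bar> < e" for t
  proof -
    define \<gamma>t where "\<gamma>t = \<gamma> + t \<cdot>\<^sub>m d"
    have eq: "\<gamma>t $$ s = \<gamma> $$ s + t * d $$ s" if "s \<in> {..<r1} \<times> {..<r2}" for s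
      using that g(2,3) d' by (cases s) (simp add: \<gamma>t_def)
    have nz: "0 \<le> \<gamma> $$ s + t * d $$ s" "s \<notin> S \<Longrightarrow> \<gamma> $$ s + t * d $$ s = 0"
      if "s \<in> {..<r1} \<times> {..<r2}" for s
    proof -
      have *: "s \<notin> S \<Longrightarrow> \<gamma> $$ s = 0 \<and> d $$ s = 0"
        using that \<gamma>S supp_subsetD[OF g(1)] supp_subsetD[OF d'(1) d'(4)] by auto
      show "s \<notin> S \<Longrightarrow> \<gamma> $$ s + t * d $$ s = 0" using * by simp
      show "0 \<le> \<gamma> $$ s + t * d $$ s"
        using * e(2)[OF \<open>\<bar>t\<bar> < e\<close>] by (cases "s \<in> S") auto
    qed
    have \<gamma>t: "\<gamma>t \<in> Gamma_unif r1 r2"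
      unfolding \<gamma>t_def by (rule Gamma_unif_add_smult[OF assms(1,2) \<gamma> d]) (use nz in auto)
    have "supp \<gamma>t \<subseteq> S"
      using nz(2) eq Gamma_unifD(2,3)[OF \<gamma>t] by (fastforce simp: supp_def)
    then have "I_div \<gamma>t p = ereal (F t)"
      using S eq by (auto simp: I_div_def S_def F_def intro!: sum.cong)
    moreover have "I_div \<gamma> p = ereal (F 0)"
      using \<gamma>S by (simp add: I_div_def S_def F_def)
    ultimately show ?thesis using proj(2)[OF _ \<gamma>t] \<gamma>1 by simp
  qed
  have "(F has_real_derivative (\<Sum>s\<in>S. d $$ s * ln (\<gamma> $$ s / p $$ s) + d $$ s)) (at 0)"
    unfolding F_def
  proof (rule DERIV_sum)
    fix s assume "s \<in> S"
    then show "((\<lambda>t. (\<gamma> $$ s + t * d $$ s) * ln ((\<gamma> $$ s + t * d $$ s) / p $$ s)) has_real_derivative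
        d $$ s * ln (\<gamma> $$ s / p $$ s) + d $$ s) (at 0)"
      using g_pos[of s] p_pos[of s]
      by (auto intro!: derivative_eq_intros simp: field_simps)
  qed
  moreover have "\<forall>y. \<bar>0 - y\<bar> < e \<longrightarrow> F 0 \<le> F y" using min by auto
  ultimately have "(\<Sum>s\<in>S. d $$ s * ln (\<gamma> $$ s / p $$ s) + d $$ s) = 0"
    using DERIV_local_min e(1) by blast
  then show ?thesis
    using sum_Delta0[OF d] S by (simp add: sum.distrib S_def \<gamma>_def)
qed


section \<open>Stability of the projection\<close>

text \<open>On (0, 1] the logarithm has slope at least 1, so its increments dominate those of the
  identity. This is where entries of probability arrays being at most 1 gives a constant that does
  not depend on the array.\<close>

lemma diff_mult_ln_diff_ge:
  fixes a b :: real
  assumes "0 < a" "a \<le> 1" "0 < b" "b \<le> 1"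
  shows "(a - b)\<^sup>2 \<le> (a - b) * (ln a - ln b)"
proof -
  have *: "y - x \<le> ln y - ln x" if "0 < x" "x \<le> y" "y \<le> 1" for x y :: real
  proof -
    have "ln (x / y) \<le> x / y - 1" using that by (intro ln_le_minus_one) simp
    then have "1 - x / y \<le> ln y - ln x" using that by (simp add: ln_div)
    moreover have "1 - x / y = (y - x) / y" using that by (simp add: field_simps)
    moreover have "(y - x) * 1 \<le> (y - x) * (1 / y)" using that by (intro mult_left_mono) auto
    ultimately show ?thesis by simp
  qed
  show ?thesis
  proof (cases "a \<le> b")
    case True
    then have "(b - a) * (b - a) \<le> (b - a) * (ln b - ln a)"
      using assms *[of a b] by (intro mult_left_mono) auto
    then show ?thesis by (simp add: power2_eq_square algebra_simps)
  next
    case False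
    then show ?thesis
      using assms *[of b a] by (simp add: power2_eq_square mult_left_mono)
  qed
qed

text \<open>The first-order conditions at \<open>p\<close> and \<open>q\<close>, tested with the difference \<open>d\<close> of the two projections,
  give \<open>\<Sum> d (ln \<gamma>' - ln \<gamma>) = \<Sum> d (ln q - ln p)\<close>, so no implicit function theorem is needed.\<close>

lemma I_proj_lipschitz:
  assumes "0 < r1" "0 < r2" "p \<in> prob_arrays r1 r2" "q \<in> prob_arrays r1 r2" "supp q = supp p"
    and "\<gamma>1 \<in> Gamma_supp r1 r2 (supp p)"
  shows "I_proj q - I_proj p \<in> Delta0 r1 r2 (supp p)"
    and "d \<in> Delta0 r1 r2 (supp p) \<Longrightarrow> (\<Sum>s\<in>supp p. d $$ s * (ln (I_proj q $$ s) - ln (I_proj p $$ s)))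
      = (\<Sum>s\<in>supp p. d $$ s * (ln (q $$ s) - ln (p $$ s)))"
    and "(\<Sum>s\<in>supp p. (I_proj q $$ s - I_proj p $$ s)\<^sup>2) \<le> (\<Sum>s\<in>supp p. (ln (q $$ s) - ln (p $$ s))\<^sup>2)"
proof -
  define S a b where "S = supp p" and "a = I_proj p" and "b = I_proj q"
  have \<gamma>1: "\<gamma>1 \<in> Gamma_unif r1 r2" "supp \<gamma>1 = S"
    using assms(6) by (auto simp: Gamma_supp_def S_def)
  have a: "a \<in> Gamma_unif r1 r2" "supp a = S" and b: "b \<in> Gamma_unif r1 r2" "supp b = S"
    using I_proj_minimises(1)[OF assms(1-3) \<gamma>1(1)] I_proj_minimises(1)[OF assms(1,2,4) \<gamma>1(1)] \<gamma>1(2)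
      supp_I_proj[OF assms(1-3)] supp_I_proj[OF assms(1,2,4)] assms(5,6)
    by (auto simp: a_def b_def S_def)
  have pos: "p $$ s > 0" "q $$ s > 0" "0 < a $$ s" "0 < b $$ s" "a $$ s \<le> 1" "b $$ s \<le> 1"
    if "s \<in> S" for s
    using that prob_arrays_pos[OF assms(3)] prob_arrays_pos[OF assms(4)] assms(5)
      Gamma_unif_pos[OF a(1)] Gamma_unif_pos[OF b(1)] a(2) b(2) by (auto simp: S_def)
  have S: "S \<subseteq> {..<r1} \<times> {..<r2}"
    using supp_subset[of a r1 r2] Gamma_unifD(1)[OF a(1)] a(2) by simp
  show diff: "b - a \<in> Delta0 r1 r2 S"
    using Gamma_unif_diff[OF a(1) b(1)] a(2) b(2) by simp
  show eq: "(\<Sum>s\<in>S. d $$ s * (ln (b $$ s) - ln (a $$ s))) = (\<Sum>s\<in>S. d $$ s * (ln (q $$ s) - ln (p $$ s)))"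
    if "d \<in> Delta0 r1 r2 S" for d
  proof -
    have "(\<Sum>s\<in>S. d $$ s * ln (b $$ s / q $$ s)) = (\<Sum>s\<in>S. d $$ s * ln (a $$ s / p $$ s))"
      using that I_proj_stationary[OF assms(1-3,6), of d] I_proj_stationary[OF assms(1,2,4), of \<gamma>1 d]
        assms(5,6) by (simp add: S_def a_def b_def)
    then have "(\<Sum>s\<in>S. d $$ s * (ln (b $$ s) - ln (q $$ s))) = (\<Sum>s\<in>S. d $$ s * (ln (a $$ s) - ln (p $$ s)))"
      using pos by (simp add: ln_divide_pos cong: sum.cong)
    then show ?thesis by (simp add: algebra_simps sum_subtractf)
  qed
  have d: "(b - a) $$ s = b $$ s - a $$ s" if "s \<in> S" for s
    using that S Gamma_unifD(1-3)[OF a(1)] Gamma_unifD(1-3)[OF b(1)] by (cases s) auto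
  have "(\<Sum>s\<in>S. (b $$ s - a $$ s)\<^sup>2) \<le> (\<Sum>s\<in>S. (b - a) $$ s * (ln (b $$ s) - ln (a $$ s)))"
    using diff_mult_ln_diff_ge pos by (intro sum_mono) (simp add: d)
  also have "\<dots> = (\<Sum>s\<in>S. (b $$ s - a $$ s) * (ln (q $$ s) - ln (p $$ s)))"
    unfolding eq[OF diff] using d by simp
  \<comment> \<open>Arithmetic-geometric mean: half of the left-hand side reappears on the right and
    is absorbed at the end.\<close>
  also have "\<dots> \<le> (\<Sum>s\<in>S. ((b $$ s - a $$ s)\<^sup>2 + (ln (q $$ s) - ln (p $$ s))\<^sup>2) / 2)"
  proof (rule sum_mono)
    fix s
    show "(b $$ s - a $$ s) * (ln (q $$ s) - ln (p $$ s))
        \<le> ((b $$ s - a $$ s)\<^sup>2 + (ln (q $$ s) - ln (p $$ s))\<^sup>2) / 2"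
      using sum_squares_bound[of "b $$ s - a $$ s" "ln (q $$ s) - ln (p $$ s)"]
      by (simp add: algebra_simps)
  qed
  finally show "(\<Sum>s\<in>S. (b $$ s - a $$ s)\<^sup>2) \<le> (\<Sum>s\<in>S. (ln (q $$ s) - ln (p $$ s))\<^sup>2)"
    by (simp add: sum_divide_distrib[symmetric] sum.distrib)
qed

text \<open>Finiteness of \<open>S\<close> allows one radius for all entries. It is applied both
  around the entries of \<open>p\<close> and around those of its projection.\<close>

lemma ln_linearise:
  fixes a :: "'i \<Rightarrow> real"
  assumes "finite S" "\<And>s. s \<in> S \<Longrightarrow> 0 < a s" "0 < e"
  obtains \<eta> where "0 < \<eta>"
    "\<And>s x. s \<in> S \<Longrightarrow> \<bar>x - a s\<bar> < \<eta> \<Longrightarrow> \<bar>ln x - ln (a s) - (x - a s) / a s\<bar> \<le> e * \<bar>x - a s\<bar>"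
proof -
  have "\<forall>\<^sub>F h in nhds 0. \<forall>s\<in>S. \<bar>ln (a s + h) - ln (a s) - h / a s\<bar> \<le> e * \<bar>h\<bar>"
  proof (rule eventually_ball_finite[OF assms(1)], intro ballI)
    fix s assume s: "s \<in> S"
    have "(ln has_derivative (\<lambda>h. h / a s)) (at (a s))"
    proof -
      have "(*) (1 / a s) = (\<lambda>h. h / a s)" by (simp add: fun_eq_iff)
      then show ?thesis
        using DERIV_ln_divide[of "a s"] assms(2)[OF s] unfolding has_field_derivative_def by simp
    qed
    then obtain d where "d > 0"
      and d: "\<And>y. \<bar>y - a s\<bar> < d \<Longrightarrow> \<bar>ln y - ln (a s) - (y - a s) / a s\<bar> \<le> e * \<bar>y - a s\<bar>"
      unfolding has_derivative_at_alt using \<open>0 < e\<close> by (auto simp: real_norm_def)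
    then show "\<forall>\<^sub>F h in nhds 0. \<bar>ln (a s + h) - ln (a s) - h / a s\<bar> \<le> e * \<bar>h\<bar>"
      unfolding eventually_nhds_metric using d[of "a s + _"]
      by (intro exI[of _ d]) (auto simp: dist_real_def)
  qed
  then obtain \<eta> where "\<eta> > 0"
    and \<eta>: "\<And>h s. \<bar>h\<bar> < \<eta> \<Longrightarrow> s \<in> S \<Longrightarrow> \<bar>ln (a s + h) - ln (a s) - h / a s\<bar> \<le> e * \<bar>h\<bar>"
    unfolding eventually_nhds_metric by (auto simp: dist_real_def)
  have "\<bar>ln x - ln (a s) - (x - a s) / a s\<bar> \<le> e * \<bar>x - a s\<bar>" if "s \<in> S" "\<bar>x - a s\<bar> < \<eta>" for s x
    using \<eta>[of "x - a s" s] that by simp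
  then show thesis using that[OF \<open>\<eta> > 0\<close>] by blast
qed

text \<open>The sum form matches the bound on the scaled error in
  \<open>weak_conv_linearised\<close>: multiplied by the rate, this distance is at most the sum of
  the absolute values of its coordinates.\<close>

definition l1_dist :: "(nat \<times> nat) set \<Rightarrow> real mat \<Rightarrow> real mat \<Rightarrow> real" where
  "l1_dist S q p = (\<Sum>s\<in>S. \<bar>q $$ s - p $$ s\<bar>)"

lemma l1_dist_nonneg: "0 \<le> l1_dist S q p"
  by (simp add: l1_dist_def sum_nonneg)

lemma abs_diff_le_l1_dist: "finite S \<Longrightarrow> s \<in> S \<Longrightarrow> \<bar>q $$ s - p $$ s\<bar> \<le> l1_dist S q p"
  unfolding l1_dist_def by (rule member_le_sum) auto

text \<open>The projection is Lipschitz in the logarithms of the array, and \<open>ln\<close> is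
  Lipschitz near the positive entries of \<open>p\<close>.\<close>

lemma I_proj_locally_lipschitz:
  assumes "0 < r1" "0 < r2" "p \<in> prob_arrays r1 r2" "\<gamma>1 \<in> Gamma_supp r1 r2 (supp p)"
  obtains C \<eta> where "0 \<le> C" "0 < \<eta>"
    "\<And>q s. q \<in> prob_arrays r1 r2 \<Longrightarrow> supp q = supp p \<Longrightarrow> l1_dist (supp p) q p < \<eta> \<Longrightarrow> s \<in> supp p
      \<Longrightarrow> \<bar>I_proj q $$ s - I_proj p $$ s\<bar> \<le> C * l1_dist (supp p) q p"
proof -
  define S where "S = supp p"
  have S: "finite S" by (simp add: S_def)
  have pos: "0 < p $$ s" if "s \<in> S" for s using that prob_arrays_pos[OF assms(3)] by (simp add: S_def)
  obtain \<eta> where "0 < \<eta>"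
    and \<eta>: "\<And>s x. s \<in> S \<Longrightarrow> \<bar>x - p $$ s\<bar> < \<eta> \<Longrightarrow> \<bar>ln x - ln (p $$ s) - (x - p $$ s) / p $$ s\<bar> \<le> 1 * \<bar>x - p $$ s\<bar>"
    using ln_linearise[of S "\<lambda>s. p $$ s" 1, OF S pos] by auto
  \<comment> \<open>Sum of the local Lipschitz constants of \<open>ln\<close>: the slope
    \<open>1 / p $$ s\<close> plus the tolerance 1 with which \<open>ln_linearise\<close> was
    called.\<close>
  define C where "C = (\<Sum>s\<in>S. 1 / p $$ s + 1)"
  have "0 \<le> C" unfolding C_def using less_imp_le[OF pos] by (intro sum_nonneg) simp
  have "\<bar>I_proj q $$ s - I_proj p $$ s\<bar> \<le> C * l1_dist S q p"
    if q: "q \<in> prob_arrays r1 r2" "supp q = supp p" "l1_dist S q p < \<eta>" "s \<in> S" for q s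
  proof -
    define D where "D = l1_dist S q p"
    have ln_bd: "\<bar>ln (q $$ s) - ln (p $$ s)\<bar> \<le> (1 / p $$ s + 1) * D" if "s \<in> S" for s
    proof -
      have le: "\<bar>q $$ s - p $$ s\<bar> \<le> D" unfolding D_def by (rule abs_diff_le_l1_dist[OF S that])
      have "\<bar>ln (q $$ s) - ln (p $$ s)\<bar> \<le> \<bar>q $$ s - p $$ s\<bar> / p $$ s + 1 * \<bar>q $$ s - p $$ s\<bar>"
      proof -
        have "\<bar>(q $$ s - p $$ s) / p $$ s\<bar> = \<bar>q $$ s - p $$ s\<bar> / p $$ s"
          using pos[OF that] by simp
        then show ?thesis
          using \<eta>[OF that, of "q $$ s"] le q(3) unfolding D_def by linarith
      qed
      also have "\<dots> = (1 / p $$ s + 1) * \<bar>q $$ s - p $$ s\<bar>" by (simp add: field_simps)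
      also have "\<dots> \<le> (1 / p $$ s + 1) * D" using le pos[OF that] by (intro mult_left_mono) auto
      finally show ?thesis .
    qed
    have "\<bar>I_proj q $$ s - I_proj p $$ s\<bar> = sqrt ((I_proj q $$ s - I_proj p $$ s)\<^sup>2)" by simp
    also have "\<dots> \<le> sqrt (\<Sum>s\<in>S. (I_proj q $$ s - I_proj p $$ s)\<^sup>2)"
      using S q(4) by (intro real_sqrt_le_mono member_le_sum) auto
    also have "\<dots> \<le> sqrt (\<Sum>s\<in>S. (ln (q $$ s) - ln (p $$ s))\<^sup>2)"
      using I_proj_lipschitz(3)[OF assms(1-3) q(1,2) assms(4)]
      by (intro real_sqrt_le_mono) (simp add: S_def)
    also have "\<dots> \<le> (\<Sum>s\<in>S. \<bar>ln (q $$ s) - ln (p $$ s)\<bar>)"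
      using L2_set_le_sum_abs[of "\<lambda>s. ln (q $$ s) - ln (p $$ s)" S] by (simp add: L2_set_def)
    also have "\<dots> \<le> (\<Sum>s\<in>S. (1 / p $$ s + 1) * D)" by (rule sum_mono) (rule ln_bd)
    finally show ?thesis unfolding C_def D_def sum_distrib_right .
  qed
  then show thesis using that[OF \<open>0 \<le> C\<close> \<open>0 < \<eta>\<close>] by (simp add: S_def)
qed

text \<open>The array \<open>u\<close> represents the functional \<open>W\<close> on \<open>Delta0\<close> for the inner product with weights \<open>1 / \<gamma>\<close>.\<close>

lemma I_proj_functional_derivative:
  assumes "0 < r1" "0 < r2" "p \<in> prob_arrays r1 r2" "\<gamma>1 \<in> Gamma_supp r1 r2 (supp p)"
    and u: "u \<in> Delta0 r1 r2 (supp p)"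
    and rep: "\<And>d. d \<in> Delta0 r1 r2 (supp p) \<Longrightarrow>
      (\<Sum>s\<in>supp p. W s * d $$ s) = (\<Sum>s\<in>supp p. u $$ s * d $$ s / I_proj p $$ s)"
    and "0 < e"
  obtains \<eta> where "0 < \<eta>"
    "\<And>q. q \<in> prob_arrays r1 r2 \<Longrightarrow> supp q = supp p \<Longrightarrow> l1_dist (supp p) q p < \<eta> \<Longrightarrow>
      \<bar>(\<Sum>s\<in>supp p. W s * (I_proj q $$ s - I_proj p $$ s)) - (\<Sum>s\<in>supp p. u $$ s * (q $$ s - p $$ s) / p $$ s)\<bar>
        \<le> e * l1_dist (supp p) q p"
proof -
  define S where "S = supp p"
  have S: "finite S" by (simp add: S_def)
  have pos: "0 < p $$ s" if "s \<in> S" for s using that prob_arrays_pos[OF assms(3)] by (simp add: S_def)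
  have \<gamma>1: "\<gamma>1 \<in> Gamma_unif r1 r2" "supp \<gamma>1 = S"
    using assms(4) by (auto simp: Gamma_supp_def S_def)
  define a where "a = I_proj p"
  have a: "a \<in> Gamma_unif r1 r2" "supp a = S"
    using I_proj_minimises(1)[OF assms(1-3) \<gamma>1(1)] \<gamma>1(2) supp_I_proj[OF assms(1-4)]
    by (auto simp: a_def S_def)
  have apos: "0 < a $$ s" if "s \<in> S" for s using Gamma_unif_pos[OF a(1)] that a(2) by auto
  have Sr: "S \<subseteq> {..<r1} \<times> {..<r2}"
    using supp_subset[of a r1 r2] Gamma_unifD(1)[OF a(1)] a(2) by simp
  obtain C \<eta>1 where C: "0 \<le> C" "0 < \<eta>1"
    "\<And>q s. q \<in> prob_arrays r1 r2 \<Longrightarrow> supp q = S \<Longrightarrow> l1_dist S q p < \<eta>1 \<Longrightarrow> s \<in> S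
      \<Longrightarrow> \<bar>I_proj q $$ s - a $$ s\<bar> \<le> C * l1_dist S q p"
    using I_proj_locally_lipschitz[OF assms(1-4), folded S_def a_def] by metis
  define U where "U = (\<Sum>s\<in>S. \<bar>u $$ s\<bar>)"
  have U: "0 \<le> U" by (simp add: U_def sum_nonneg)
  \<comment> \<open>The accumulated error will be \<open>U * (e' * (C + 1)) * D\<close>. Adding 1 to
    \<open>U\<close> and to \<open>C\<close> keeps the divisor positive and still gives at most
    \<open>e * D\<close>.\<close>
  define e' where "e' = e / ((U + 1) * (C + 1))"
  have e': "0 < e'" using \<open>0 < e\<close> U C(1) by (simp add: e'_def)
  obtain \<eta>2 where \<eta>2: "0 < \<eta>2"
    "\<And>s x. s \<in> S \<Longrightarrow> \<bar>x - p $$ s\<bar> < \<eta>2 \<Longrightarrow> \<bar>ln x - ln (p $$ s) - (x - p $$ s) / p $$ s\<bar> \<le> e' * \<bar>x - p $$ s\<bar>"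
    using ln_linearise[of S "\<lambda>s. p $$ s" e', OF S pos e'] by blast
  obtain \<eta>3 where \<eta>3: "0 < \<eta>3"
    "\<And>s x. s \<in> S \<Longrightarrow> \<bar>x - a $$ s\<bar> < \<eta>3 \<Longrightarrow> \<bar>ln x - ln (a $$ s) - (x - a $$ s) / a $$ s\<bar> \<le> e' * \<bar>x - a $$ s\<bar>"
    using ln_linearise[of S "\<lambda>s. a $$ s" e', OF S apos e'] by blast
  \<comment> \<open>The last bound forces \<open>C * D < \<eta>3\<close>, so that the projection of
    \<open>q\<close>, and not only \<open>q\<close>, stays in its linearisation radius.\<close>
  define \<eta> where "\<eta> = min \<eta>1 (min \<eta>2 (\<eta>3 / (C + 1)))"
  have "0 < \<eta>" using C \<eta>2 \<eta>3 by (simp add: \<eta>_def)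
  moreover have "\<bar>(\<Sum>s\<in>S. W s * (I_proj q $$ s - a $$ s)) - (\<Sum>s\<in>S. u $$ s * (q $$ s - p $$ s) / p $$ s)\<bar>
        \<le> e * l1_dist S q p"
    if q: "q \<in> prob_arrays r1 r2" "supp q = S" "l1_dist S q p < \<eta>" for q
  proof -
    define D where "D = l1_dist S q p"
    define b where "b = I_proj q"
    note lip = I_proj_lipschitz[OF assms(1-3) q(1) q(2)[unfolded S_def] assms(4), folded S_def a_def b_def]
    have D: "0 \<le> D" "D < \<eta>1" "D < \<eta>2" "D < \<eta>3 / (C + 1)"
      using q(3) l1_dist_nonneg[of S q p] by (auto simp: D_def \<eta>_def)
    have b: "\<bar>b $$ s - a $$ s\<bar> \<le> C * D" if "s \<in> S" for s
      using C(3)[OF q(1,2) _ that] D by (simp add: D_def b_def)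
    have CD: "C * D < \<eta>3"
    proof -
      have "C * D \<le> (C + 1) * D" using D by (simp add: mult_right_mono)
      also have "\<dots> < \<eta>3" using D(4) C(1) by (simp add: field_simps)
      finally show ?thesis .
    qed
    have dS: "(b - a) $$ s = b $$ s - a $$ s" if "s \<in> S" for s
      using that Sr Gamma_unifD(2,3)[OF a(1)] by (cases s) auto
    \<comment> \<open>Errors of the first-order expansions of \<open>ln\<close> at the projection
      and at \<open>p\<close>. The representer property produces the first expansion, the identity
      between the two log-differences leads to the second, and only \<open>R2 - R1\<close> weighted
      by \<open>u\<close> remains.\<close>
    define R1 R2 where "R1 = (\<lambda>s. ln (b $$ s) - ln (a $$ s) - (b $$ s - a $$ s) / a $$ s)"
      and "R2 = (\<lambda>s. ln (q $$ s) - ln (p $$ s) - (q $$ s - p $$ s) / p $$ s)"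
    have "(\<Sum>s\<in>S. W s * (b $$ s - a $$ s)) = (\<Sum>s\<in>S. u $$ s * (b $$ s - a $$ s) / a $$ s)"
      using rep[folded S_def a_def, OF lip(1)] dS by simp
    also have "\<dots> = (\<Sum>s\<in>S. u $$ s * (ln (b $$ s) - ln (a $$ s))) - (\<Sum>s\<in>S. u $$ s * R1 s)"
      by (simp add: R1_def algebra_simps sum_subtractf)
    also have "(\<Sum>s\<in>S. u $$ s * (ln (b $$ s) - ln (a $$ s))) = (\<Sum>s\<in>S. u $$ s * (ln (q $$ s) - ln (p $$ s)))"
      by (rule lip(2)) (use u in \<open>simp add: S_def\<close>)
    also have "\<dots> = (\<Sum>s\<in>S. u $$ s * (q $$ s - p $$ s) / p $$ s) + (\<Sum>s\<in>S. u $$ s * R2 s)"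
      by (simp add: R2_def algebra_simps sum_subtractf sum.distrib)
    finally have "\<bar>(\<Sum>s\<in>S. W s * (b $$ s - a $$ s)) - (\<Sum>s\<in>S. u $$ s * (q $$ s - p $$ s) / p $$ s)\<bar>
        = \<bar>\<Sum>s\<in>S. u $$ s * (R2 s - R1 s)\<bar>"
      by (simp add: algebra_simps sum_subtractf)
    also have "\<dots> \<le> (\<Sum>s\<in>S. \<bar>u $$ s * (R2 s - R1 s)\<bar>)" by (rule sum_abs)
    also have "\<dots> \<le> (\<Sum>s\<in>S. \<bar>u $$ s\<bar> * (e' * ((C + 1) * D)))"
    proof (rule sum_mono)
      fix s assume s: "s \<in> S"
      have qp: "\<bar>q $$ s - p $$ s\<bar> \<le> D" unfolding D_def by (rule abs_diff_le_l1_dist[OF S s])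
      have "\<bar>R1 s\<bar> \<le> e' * \<bar>b $$ s - a $$ s\<bar>"
        unfolding R1_def using \<eta>3(2)[OF s] b[OF s] CD by simp
      also have "\<dots> \<le> e' * (C * D)" using b[OF s] e' by (intro mult_left_mono) auto
      finally have 1: "\<bar>R1 s\<bar> \<le> e' * (C * D)" .
      have "\<bar>R2 s\<bar> \<le> e' * \<bar>q $$ s - p $$ s\<bar>"
        unfolding R2_def using \<eta>2(2)[OF s] qp D(3) by simp
      also have "\<dots> \<le> e' * D" using qp e' by (intro mult_left_mono) auto
      finally have "\<bar>R2 s - R1 s\<bar> \<le> e' * ((C + 1) * D)" using 1 by (simp add: algebra_simps)
      then show "\<bar>u $$ s * (R2 s - R1 s)\<bar> \<le> \<bar>u $$ s\<bar> * (e' * ((C + 1) * D))"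
        unfolding abs_mult by (intro mult_left_mono) auto
    qed
    finally have le: "\<bar>(\<Sum>s\<in>S. W s * (b $$ s - a $$ s)) - (\<Sum>s\<in>S. u $$ s * (q $$ s - p $$ s) / p $$ s)\<bar>
        \<le> U * (e' * (C + 1)) * D" by (simp add: U_def sum_distrib_right mult.assoc)
    have "U * (e' * (C + 1)) = e * (U / (U + 1))"
    proof -
      have "e' * (C + 1) = e / (U + 1)"
        using C(1) by (simp add: e'_def add_nonneg_eq_0_iff)
      then show ?thesis by simp
    qed
    also have "\<dots> \<le> e * 1" using U \<open>0 < e\<close> by (intro mult_left_mono) auto
    finally have "U * (e' * (C + 1)) * D \<le> e * D"
      using D(1) by (intro mult_right_mono) auto
    with le show ?thesis by (simp add: D_def b_def)
  qed
  ultimately show thesis using that[of \<eta>] by (simp add: S_def a_def)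
qed

section \<open>The representer of the weights on zero-margin arrays\<close>

lemma Delta0_iff:
  "d \<in> Delta0 r1 r2 S \<longleftrightarrow> d \<in> carrier_mat r1 r2
    \<and> (\<forall>s\<in>{..<r1} \<times> {..<r2} - S. d $$ s = 0)
    \<and> (\<forall>i<r1. (\<Sum>j<r2. d $$ (i, j)) = 0) \<and> (\<forall>j<r2. (\<Sum>i<r1. d $$ (i, j)) = 0)"
proof -
  have "supp d \<subseteq> S \<longleftrightarrow> (\<forall>s\<in>{..<r1} \<times> {..<r2} - S. d $$ s = 0)" if "d \<in> carrier_mat r1 r2"
    using that by (fastforce simp: supp_def)
  then show ?thesis
    by (auto simp: Delta0_def row_margin_def col_margin_def)
qed

lemma Delta0_closed:
  assumes "a \<in> Delta0 r1 r2 S" "b \<in> Delta0 r1 r2 S"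
  shows "a + b \<in> Delta0 r1 r2 S" "c \<cdot>\<^sub>m a \<in> Delta0 r1 r2 S"
  using assms by (auto simp: Delta0_iff sum.distrib simp flip: sum_distrib_left)

lemma zero_in_Delta0: "0\<^sub>m r1 r2 \<in> Delta0 r1 r2 S"
  by (auto simp: Delta0_iff)

lemma vectorspace_Delta0: "vectorspace class_ring (Delta0_space r1 r2 S)"
proof -
  interpret vectorspace "class_ring :: real ring" "module_mat TYPE(real) r1 r2"
    by (rule matrix_vs)
  have "submodule class_ring (Delta0 r1 r2 S) (module_mat TYPE(real) r1 r2)"
    using Delta0_closed[of _ r1 r2 S] zero_in_Delta0[of r1 r2 S]
    by unfold_locales (auto simp: module_mat_simps Delta0_def)
  then show ?thesis
    by (intro subspace_is_vs) (simp add: subspace_def vectorspace_axioms)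
qed

lemma lincomb_Delta0_index:
  assumes "finite B" "B \<subseteq> Delta0 r1 r2 S" "s \<in> {..<r1} \<times> {..<r2}"
  shows "module.lincomb (Delta0_space r1 r2 S) a B $$ s = (\<Sum>v\<in>B. a v * v $$ s)"
proof -
  interpret V: vectorspace "class_ring :: real ring" "Delta0_space r1 r2 S"
    by (rule vectorspace_Delta0)
  show ?thesis
    using assms(1,2)
  proof (induction B rule: finite_induct)
    case empty
    then show ?case
      using assms(3) by (auto simp: V.lincomb_def module_mat_simps)
  next
    case (insert v B)
    have l: "V.lincomb a B \<in> Delta0 r1 r2 S"
      using V.lincomb_closed[of B a] insert.prems by simp
    have "V.lincomb a (insert v B) = a v \<cdot>\<^sub>m v + V.lincomb a B"
      using V.lincomb_insert2[of B a v] insert by (simp add: module_mat_simps)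
    then show ?case
      using insert assms(3) Delta0D(1-3)[OF l] Delta0D(1-3)[of v r1 r2 S] by (cases s) auto
  qed
qed

text \<open>Turns the algebraic notion of a basis into entrywise sums, the form in which spanning
  and independence meet the matrix \<open>A\<close>.\<close>

lemma Delta0_basisD:
  assumes "vectorspace.basis class_ring (Delta0_space r1 r2 S) B" "finite B"
  shows "B \<subseteq> Delta0 r1 r2 S"
    and "d \<in> Delta0 r1 r2 S \<Longrightarrow> \<exists>a. \<forall>s\<in>{..<r1} \<times> {..<r2}. d $$ s = (\<Sum>v\<in>B. a v * v $$ s)"
    and "(\<And>s. s \<in> {..<r1} \<times> {..<r2} \<Longrightarrow> (\<Sum>v\<in>B. a v * v $$ s) = 0) \<Longrightarrow> v \<in> B \<Longrightarrow> a v = 0"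
proof -
  interpret V: vectorspace "class_ring :: real ring" "Delta0_space r1 r2 S"
    by (rule vectorspace_Delta0)
  have B: "V.lin_indpt B" "V.span B = Delta0 r1 r2 S" "B \<subseteq> Delta0 r1 r2 S"
    using assms(1) unfolding V.basis_def by auto
  show "B \<subseteq> Delta0 r1 r2 S" by fact
  show "\<exists>a. \<forall>s\<in>{..<r1} \<times> {..<r2}. d $$ s = (\<Sum>v\<in>B. a v * v $$ s)" if "d \<in> Delta0 r1 r2 S"
  proof -
    from that have "d \<in> {V.lincomb a B |a. a \<in> B \<rightarrow> carrier class_ring}"
      using V.finite_span[OF assms(2)] B by simp
    then obtain a where "d = V.lincomb a B" by blast
    then show ?thesis using lincomb_Delta0_index[OF assms(2) B(3)] by auto
  qed
  show "a v = 0" if "\<And>s. s \<in> {..<r1} \<times> {..<r2} \<Longrightarrow> (\<Sum>v\<in>B. a v * v $$ s) = 0" "v \<in> B"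
  proof (rule ccontr)
    assume "a v \<noteq> 0"
    have "V.lincomb a B \<in> Delta0 r1 r2 S"
      using V.lincomb_closed[of B a] B by simp
    note l = Delta0D(1-3)[OF this]
    have "V.lincomb a B = 0\<^sub>m r1 r2"
      by (rule eq_matI) (use l that(1) lincomb_Delta0_index[OF assms(2) B(3), of _ a] in auto)
    then have "V.lin_dep B"
      unfolding V.lin_dep_def using assms(2) \<open>v \<in> B\<close> \<open>a v \<noteq> 0\<close>
      by (intro exI[of _ B] exI[of _ a] exI[of _ v]) (auto simp: module_mat_simps)
    then show False using B(1) by simp
  qed
qed

section \<open>Column-major indices and the selection matrix\<close>

lemma phi_less: "s \<in> {..<r1} \<times> {..<r2} \<Longrightarrow> phi r1 s < r1 * r2"
proof (cases s)
  case (Pair i j)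
  assume "s \<in> {..<r1} \<times> {..<r2}"
  then have "i < r1" "j + 1 \<le> r2" using Pair by auto
  then have "i + j * r1 < (j + 1) * r1" "(j + 1) * r1 \<le> r2 * r1" by (simp, intro mult_right_mono) auto
  then show ?thesis using Pair by (simp add: phi_def mult.commute)
qed

lemma phi_mod_div: "i < r1 \<Longrightarrow> phi r1 (i, j) mod r1 = i" "i < r1 \<Longrightarrow> phi r1 (i, j) div r1 = j"
  by (auto simp: phi_def)

lemma bij_betw_phi: "bij_betw (phi r1) ({..<r1} \<times> {..<r2}) {..<r1 * r2}"
  unfolding bij_betw_def
proof
  show "inj_on (phi r1) ({..<r1} \<times> {..<r2})"
    by (rule inj_onI) (metis (no_types, lifting) lessThan_iff mem_Sigma_iff phi_mod_div surj_pair)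
  show "phi r1 ` ({..<r1} \<times> {..<r2}) = {..<r1 * r2}"
  proof
    show "phi r1 ` ({..<r1} \<times> {..<r2}) \<subseteq> {..<r1 * r2}" using phi_less by auto
    show "{..<r1 * r2} \<subseteq> phi r1 ` ({..<r1} \<times> {..<r2})"
    proof
      fix k assume "k \<in> {..<r1 * r2}"
      then have k: "k < r1 * r2" by simp
      then have "r1 > 0" by (cases r1) auto
      then have "k mod r1 < r1" "k div r1 < r2"
        using k by (auto simp: less_mult_imp_div_less mult.commute)
      moreover have "k = phi r1 (k mod r1, k div r1)" by (simp add: phi_def)
      ultimately show "k \<in> phi r1 ` ({..<r1} \<times> {..<r2})" by blast
    qed
  qed
qed

lemma sum_phi: "(\<Sum>k<r1 * r2. f k) = (\<Sum>s\<in>{..<r1} \<times> {..<r2}. f (phi r1 s))"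
  using sum.reindex_bij_betw[OF bij_betw_phi, of f r1 r2] by simp

lemma vectorise_carrier [simp]: "a \<in> carrier_mat r1 r2 \<Longrightarrow> vectorise a \<in> carrier_vec (r1 * r2)"
  by (auto simp: vectorise_def)

lemma vectorise_phi:
  assumes "a \<in> carrier_mat r1 r2" "s \<in> {..<r1} \<times> {..<r2}"
  shows "vectorise a $ phi r1 s = a $$ s"
  using assms phi_less[OF assms(2)] by (cases s) (auto simp: vectorise_def phi_mod_div)

lemma Yule_weights_carrier [simp]: "Yule_weights r1 r2 \<in> carrier_vec (r1 * r2)"
  by (rule carrier_vecI) (simp add: Yule_weights_def kron_vec_def)

lemma Yule_weights_phi:
  assumes "i < r1" "j < r2"
  shows "Yule_weights r1 r2 $ phi r1 (i, j) = real (i + 1) * real (j + 1)"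
  using assms phi_less[of "(i, j)" r1 r2]
  by (simp add: Yule_weights_def kron_vec_def phi_mod_div mult.commute)

text \<open>\<open>e\<close> lists the cells of \<open>S\<close> by increasing column-major index.
  Only bijectivity is recorded: everything computed later is a sum over \<open>S\<close>, in which
  the order of the rows disappears.\<close>

lemma sel_mat_rows:
  assumes "S \<subseteq> {..<r1} \<times> {..<r2}"
  obtains e where "bij_betw e {..<card S} S"
    "sel_mat r1 r2 S = mat (card S) (r1 * r2) (\<lambda>(k, l). if phi r1 (e k) = l then 1 else 0)"
proof -
  define N I where "N = r1 * r2" and "I = phi r1 ` S"
  have inj: "inj_on (phi r1) ({..<r1} \<times> {..<r2})"
    and img: "phi r1 ` ({..<r1} \<times> {..<r2}) = {..<N}"
    using bij_betw_phi[of r1 r2] by (auto simp: bij_betw_def N_def)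
  have fin: "finite S" using assms finite_subset by blast
  have injS: "inj_on (phi r1) S" using inj assms by (rule inj_on_subset)
  have I: "{..<N} - phi r1 ` ({..<r1} \<times> {..<r2} - S) = I"
  proof -
    have "phi r1 ` ({..<r1} \<times> {..<r2} - S) = {..<N} - I"
      using inj_on_image_set_diff[OF inj Diff_subset assms] img by (simp add: I_def)
    moreover have "I \<subseteq> {..<N}" using img assms by (auto simp: I_def)
    ultimately show ?thesis by (simp add: double_diff)
  qed
  have IN: "I \<subseteq> {..<N}" "finite I" "card I = card S"
    using img assms fin card_image[OF injS] by (auto simp: I_def)
  \<comment> \<open>Every \<open>i\<close> in \<open>I\<close> is picked at the position given by
    the number of smaller elements. Equality of the cardinalities then makes \<open>pick I\<close> a
    bijection.\<close>
  have "I \<subseteq> pick I ` {..<card I}"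
  proof
    fix i assume i: "i \<in> I"
    have "card {a \<in> I. a < i} < card I" using i IN(2) by (intro psubset_card_mono) auto
    then show "i \<in> pick I ` {..<card I}"
      using pick_card_in_set[OF i, symmetric] by (intro image_eqI) (assumption, simp)
  qed
  then have pimg: "pick I ` {..<card I} = I"
    using card_image_le[of "{..<card I}" "pick I"] by (intro card_seteq[symmetric]) auto
  then have "inj_on (pick I) {..<card I}" by (intro eq_card_imp_inj_on) auto
  then have bij: "bij_betw (pick I) {..<card S} I" using pimg IN(3) by (simp add: bij_betw_def)
  define e where "e = inv_into S (phi r1) \<circ> pick I"
  have "bij_betw e {..<card S} S"
    unfolding e_def by (rule bij_betw_trans[OF bij])
      (simp add: I_def bij_betw_inv_into injS inj_on_imp_bij_betw)
  moreover have e: "phi r1 (e k) = pick I k" if "k < card S" for k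
  proof -
    have "pick I k \<in> phi r1 ` S" using bij that by (auto simp: bij_betw_def I_def)
    then show ?thesis by (simp add: e_def f_inv_into_f)
  qed
  have "sel_mat r1 r2 S = mat (card S) N (\<lambda>(k, l). if phi r1 (e k) = l then 1 else 0)"
  proof -
    have c: "{i. i < N \<and> i \<in> I} = I" "{j. j < N} = {..<N}" using IN(1) by auto
    have "1\<^sub>m N $$ (pick I k, l) = (if phi r1 (e k) = l then 1 else 0 :: real)" if "k < card S" "l < N" for k l
    proof -
      have "pick I k < N" using that(1) IN(1) bij by (auto simp: bij_betw_def)
      then show ?thesis using that e[OF that(1)] by simp
    qed
    then show ?thesis
      unfolding sel_mat_def submatrix_def N_def[symmetric] I using IN(3)
      by (intro eq_matI) (auto simp: c pick_UNIV)
  qed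
  ultimately show thesis using that by (simp add: N_def)
qed

section \<open>Inverses and bilinear forms of real matrices\<close>

text \<open>\<open>minv\<close> extracts the value of an option. A trivial kernel gives a nonzero
  determinant, which excludes \<open>None\<close>.\<close>

lemma minv_correct:
  assumes "G \<in> carrier_mat n n" "\<And>v. v \<in> carrier_vec n \<Longrightarrow> G *\<^sub>v v = 0\<^sub>v n \<Longrightarrow> v = 0\<^sub>v n"
  shows "minv G \<in> carrier_mat n n" "G * minv G = 1\<^sub>m n" "minv G * G = 1\<^sub>m n"
proof -
  have "det G \<noteq> 0" using det_0_iff_vec_prod_zero_field[OF assms(1)] assms(2) by auto
  then have "mat_inverse G \<noteq> None"
    using det_non_zero_imp_unit[OF assms(1), of "()"] mat_inverse(1)[OF assms(1), of "()"] by blast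
  then obtain B where "mat_inverse G = Some B" by auto
  with mat_inverse(2)[OF assms(1) this]
  show "minv G \<in> carrier_mat n n" "G * minv G = 1\<^sub>m n" "minv G * G = 1\<^sub>m n"
    by (simp_all add: minv_def)
qed

text \<open>A left inverse already forces the kernel to be trivial, so \<open>minv G\<close> is a
  two-sided inverse and must equal \<open>B\<close>.\<close>

lemma minv_unique:
  assumes "G \<in> carrier_mat n n" "B \<in> carrier_mat n n" "B * G = 1\<^sub>m n"
  shows "minv G = B"
proof -
  have "v = 0\<^sub>v n" if v: "v \<in> carrier_vec n" "G *\<^sub>v v = 0\<^sub>v n" for v
  proof -
    have "v = (B * G) *\<^sub>v v" using v assms by simp
    also have "\<dots> = B *\<^sub>v (G *\<^sub>v v)" using v assms by (intro assoc_mult_mat_vec) auto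
    also have "\<dots> = 0\<^sub>v n" unfolding v(2) using assms(2) by (intro eq_vecI) auto
    finally show ?thesis .
  qed
  note G = minv_correct[OF assms(1) this]
  have "B = B * (G * minv G)" using G assms by simp
  also have "\<dots> = (B * G) * minv G" using G assms by (intro assoc_mult_mat[symmetric]) auto
  finally show ?thesis using G assms by simp
qed

lemma minv_diag:
  assumes "\<And>k. k < dim_vec v \<Longrightarrow> v $ k \<noteq> 0"
  shows "minv (diag v) = mat_diag (dim_vec v) (\<lambda>k. 1 / v $ k)"
proof (rule minv_unique)
  have "mat_diag (dim_vec v) (\<lambda>k. 1 / v $ k * v $ k) = mat_diag (dim_vec v) (\<lambda>k. 1 :: real)"
    using assms by (intro eq_matI) (auto simp: mat_diag_def)
  then show "mat_diag (dim_vec v) (\<lambda>k. 1 / v $ k) * diag v = 1\<^sub>m (dim_vec v)"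
    by (simp add: diag_def)
qed (auto simp: diag_def)

lemma minv_symmetric:
  assumes "G \<in> carrier_mat n n" "transpose_mat G = G"
    "\<And>v. v \<in> carrier_vec n \<Longrightarrow> G *\<^sub>v v = 0\<^sub>v n \<Longrightarrow> v = 0\<^sub>v n"
  shows "transpose_mat (minv G) = minv G"
proof (rule minv_unique[OF assms(1), symmetric])
  note G = minv_correct[OF assms(1,3)]
  show "transpose_mat (minv G) * G = 1\<^sub>m n"
    using transpose_mult[of G n n "minv G" n] G assms(1,2) by simp
qed (use minv_correct[OF assms(1,3)] in auto)

lemma mat_diag_mult_vec:
  "v \<in> carrier_vec n \<Longrightarrow> mat_diag n f *\<^sub>v v = vec n (\<lambda>k. f k * v $ k :: real)"
  by (intro eq_vecI) (auto simp: mat_diag_def scalar_prod_def if_distrib[of "\<lambda>x. x * _"] cong: if_cong)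

lemma transpose_scalar_prod:
  assumes "(A :: real mat) \<in> carrier_mat nr nc" "x \<in> carrier_vec nr" "y \<in> carrier_vec nc"
  shows "x \<bullet> (A *\<^sub>v y) = (transpose_mat A *\<^sub>v x) \<bullet> y"
  using transpose_vec_mult_scalar[OF assms(1,3,2)] by simp

lemma mult_mat_vec_assoc5:
  fixes A B C D E :: "real mat"
  assumes "A \<in> carrier_mat a b" "B \<in> carrier_mat b c" "C \<in> carrier_mat c d" "D \<in> carrier_mat d e"
    "E \<in> carrier_mat e f" "v \<in> carrier_vec f"
  shows "(A * B * C * D * E) *\<^sub>v v = A *\<^sub>v (B *\<^sub>v (C *\<^sub>v (D *\<^sub>v (E *\<^sub>v v))))"
proof -
  have "(A * B * C * D * E) *\<^sub>v v = (A * B * C * D) *\<^sub>v (E *\<^sub>v v)"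
    by (rule assoc_mult_mat_vec[of _ a e _ f]) (use assms in auto)
  also have "\<dots> = (A * B * C) *\<^sub>v (D *\<^sub>v (E *\<^sub>v v))"
    by (rule assoc_mult_mat_vec[of _ a d _ e]) (use assms in auto)
  also have "\<dots> = (A * B) *\<^sub>v (C *\<^sub>v (D *\<^sub>v (E *\<^sub>v v)))"
    by (rule assoc_mult_mat_vec[of _ a c _ d]) (use assms in auto)
  also have "\<dots> = A *\<^sub>v (B *\<^sub>v (C *\<^sub>v (D *\<^sub>v (E *\<^sub>v v))))"
    by (rule assoc_mult_mat_vec[of _ a b _ c]) (use assms in auto)
  finally show ?thesis .
qed

text \<open>The matrix inverted by \<open>H\<close> is the Gram matrix of the basis for the inner
  product \<Sum> x y / g. The coefficients \<open>H *\<^sub>v (transpose_mat A *\<^sub>v w)\<close>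
  solve its normal equations, and \<open>u\<close> is the combination of the basis with these
  coefficients, that is, the Riesz representer of \<open>w\<close> on \<open>Delta0\<close>. The
  functional and the variance of the theorem are then both read off from the same
  \<open>u\<close>.\<close>

lemma Delta0_representer:
  fixes r1 r2 :: nat and w :: "real vec"
  assumes S: "S \<subseteq> {..<r1} \<times> {..<r2}"
    and p: "p \<in> carrier_mat r1 r2" "\<And>s. s \<in> S \<Longrightarrow> 0 < p $$ s"
    and g: "g \<in> carrier_mat r1 r2" "\<And>s. s \<in> S \<Longrightarrow> 0 < g $$ s"
    and w: "w \<in> carrier_vec (r1 * r2)"
    and ds: "distinct \<Delta>s" "vectorspace.basis class_ring (Delta0_space r1 r2 S) (set \<Delta>s)"
  defines "A \<equiv> mat_of_cols (r1 * r2) (map vectorise \<Delta>s)"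
    and "R \<equiv> sel_mat r1 r2 S"
  defines "At \<equiv> R * A"
  defines "H \<equiv> minv (transpose_mat At * minv (diag (R *\<^sub>v vectorise g)) * At)"
  obtains u where "u \<in> Delta0 r1 r2 S"
    "\<And>d. d \<in> Delta0 r1 r2 S \<Longrightarrow> (\<Sum>s\<in>S. w $ phi r1 s * d $$ s) = (\<Sum>s\<in>S. u $$ s * d $$ s / g $$ s)"
    "\<And>z. z \<in> carrier_vec (r1 * r2) \<Longrightarrow>
       w \<bullet> ((A * H * transpose_mat At * minv (diag (R *\<^sub>v vectorise p)) * R) *\<^sub>v z)
         = (\<Sum>s\<in>S. u $$ s * z $ phi r1 s / p $$ s)"
    "w \<bullet> ((A * H * (transpose_mat At * minv (diag (R *\<^sub>v vectorise p)) * At) * H * transpose_mat A) *\<^sub>v w)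
         = (\<Sum>s\<in>S. (u $$ s)\<^sup>2 / p $$ s)"
proof -
  define N m n where "N = r1 * r2" and "m = card S" and "n = length \<Delta>s"
  have bset: "set \<Delta>s \<subseteq> Delta0 r1 r2 S" using Delta0_basisD(1)[OF ds(2)] by simp
  have D: "\<Delta>s ! c \<in> Delta0 r1 r2 S" if "c < n" for c using that bset by (auto simp: n_def)
  have sum_list: "(\<Sum>v\<in>set \<Delta>s. f v) = (\<Sum>c<n. f (\<Delta>s ! c))" for f :: "real mat \<Rightarrow> real"
    using sum.reindex_bij_betw[OF bij_betw_nth[OF ds(1) refl refl], of f] by (simp add: n_def)
  obtain e where e: "bij_betw e {..<m} S"
    and R: "R = mat m N (\<lambda>(k, l). if phi r1 (e k) = l then 1 else 0)"
    using sel_mat_rows[OF S] unfolding R_def m_def N_def by blast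
  have eS: "e k \<in> S" "e k \<in> {..<r1} \<times> {..<r2}" "phi r1 (e k) < N" if "k < m" for k
    using e that S phi_less[of "e k" r1 r2] by (auto simp: bij_betw_def N_def)
  have sum_e: "(\<Sum>s\<in>S. f s) = (\<Sum>k<m. f (e k))" for f :: "_ \<Rightarrow> real"
    using sum.reindex_bij_betw[OF e, of f] by simp
  have Rc: "R \<in> carrier_mat m N" by (simp add: R)
  have Rv: "R *\<^sub>v v = vec m (\<lambda>k. v $ phi r1 (e k))" if "v \<in> carrier_vec N" for v
  proof (rule eq_vecI)
    fix k assume "k < dim_vec (vec m (\<lambda>k. v $ phi r1 (e k)))"
    then have k: "k < m" by simp
    have "(R *\<^sub>v v) $ k = (\<Sum>l\<in>{0..<N}. (if phi r1 (e k) = l then 1 else 0) * v $ l)"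
      using k that by (simp add: R scalar_prod_def)
    also have "\<dots> = v $ phi r1 (e k)"
      using eS(3)[OF k] by (simp add: if_distrib[of "\<lambda>x. x * _"] cong: if_cong)
    finally show "(R *\<^sub>v v) $ k = vec m (\<lambda>k. v $ phi r1 (e k)) $ k" using k by simp
  qed (simp add: R)
  have Ac: "A \<in> carrier_mat N n" 
    using mat_of_cols_carrier(1)[of "r1 * r2" "map vectorise \<Delta>s"] by (simp add: A_def N_def n_def del: mat_of_cols_carrier)
  have A_phi: "A $$ (phi r1 s, c) = \<Delta>s ! c $$ s" if "s \<in> {..<r1} \<times> {..<r2}" "c < n" for s c
    using that phi_less[OF that(1)] vectorise_phi[OF Delta0D(1)[OF D[OF that(2)]] that(1)]
    by (simp add: A_def n_def mat_of_cols_index)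
  have Atc: "At \<in> carrier_mat m n" using Rc Ac by (simp add: At_def)
  have At: "At $$ (k, c) = \<Delta>s ! c $$ e k" if "k < m" "c < n" for k c
  proof -
    have "At $$ (k, c) = (R *\<^sub>v col A c) $ k" using that Rc Ac by (simp add: At_def)
    also have "\<dots> = A $$ (phi r1 (e k), c)"
      using that Rv[of "col A c"] Ac eS(3)[OF that(1)] by (simp add: col_def)
    finally show ?thesis using A_phi[OF eS(2)] that by simp
  qed
  have At_vec: "(At *\<^sub>v y) $ k = (\<Sum>c<n. y $ c * \<Delta>s ! c $$ e k)" if "k < m" "y \<in> carrier_vec n" for k y
    using that Atc At[OF that(1)]
    by (simp add: scalar_prod_def row_def lessThan_atLeast0 mult.commute)
  have diag_eq: "minv (diag (R *\<^sub>v vectorise a)) = mat_diag m (\<lambda>k. 1 / a $$ e k)"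
    if "a \<in> carrier_mat r1 r2" "\<And>s. s \<in> S \<Longrightarrow> 0 < a $$ s" for a
  proof -
    have eq: "R *\<^sub>v vectorise a = vec m (\<lambda>k. a $$ e k)"
      using that Rv[of "vectorise a"] eS vectorise_phi[OF that(1)]
      by (intro eq_vecI) (auto simp: N_def)
    have "minv (diag (vec m (\<lambda>k. a $$ e k))) = mat_diag m (\<lambda>k. 1 / vec m (\<lambda>k. a $$ e k) $ k)"
      using minv_diag[of "vec m (\<lambda>k. a $$ e k)"] that(2)[OF eS(1)] by force
    also have "\<dots> = mat_diag m (\<lambda>k. 1 / a $$ e k)" by (intro eq_matI) (auto simp: mat_diag_def)
    finally show ?thesis using eq by simp
  qed
  define Dg Dp where "Dg = mat_diag m (\<lambda>k. 1 / g $$ e k)" and "Dp = mat_diag m (\<lambda>k. 1 / p $$ e k)"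
  have Dg: "minv (diag (R *\<^sub>v vectorise g)) = Dg" and Dp: "minv (diag (R *\<^sub>v vectorise p)) = Dp"
    using diag_eq g p by (auto simp: Dg_def Dp_def)
  have Dgc: "Dg \<in> carrier_mat m m" and Dpc: "Dp \<in> carrier_mat m m" by (auto simp: Dg_def Dp_def)
  have Dg_v: "Dg *\<^sub>v v = vec m (\<lambda>k. v $ k / g $$ e k)" and Dp_v: "Dp *\<^sub>v v = vec m (\<lambda>k. v $ k / p $$ e k)"
    if "v \<in> carrier_vec m" for v
    using mat_diag_mult_vec[OF that] by (auto simp: Dg_def Dp_def)
  define G where "G = transpose_mat At * Dg * At"
  have H: "H = minv G" by (simp add: H_def G_def Dg)
  have Gc: "G \<in> carrier_mat n n" using Atc Dgc by (simp add: G_def)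
  have G_v: "G *\<^sub>v y = transpose_mat At *\<^sub>v (Dg *\<^sub>v (At *\<^sub>v y))" if "y \<in> carrier_vec n" for y
    unfolding G_def using Atc Dgc that
    by (simp add: assoc_mult_mat_vec[of _ n m _ n] assoc_mult_mat_vec[of _ n m _ m])
  have form: "x \<bullet> (G *\<^sub>v y) = (\<Sum>k<m. (At *\<^sub>v x) $ k * (At *\<^sub>v y) $ k / g $$ e k)"
    if "x \<in> carrier_vec n" "y \<in> carrier_vec n" for x y
  proof -
    have "x \<bullet> (G *\<^sub>v y) = (At *\<^sub>v x) \<bullet> (Dg *\<^sub>v (At *\<^sub>v y))"
      using that Atc Dgc transpose_scalar_prod[of "transpose_mat At" n m x "Dg *\<^sub>v (At *\<^sub>v y)"]
      by (simp add: G_v)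
    also have "\<dots> = (\<Sum>k<m. (At *\<^sub>v x) $ k * (At *\<^sub>v y) $ k / g $$ e k)"
      using that Atc Dg_v[of "At *\<^sub>v y"] by (simp add: scalar_prod_def lessThan_atLeast0)
    finally show ?thesis .
  qed
  \<comment> \<open>The quadratic form of \<open>G\<close> is a sum of squares with positive
    weights. If it vanishes, the combination of basis arrays with coefficients \<open>y\<close> is 0
    on \<open>S\<close>; it is 0 off \<open>S\<close> by the supports, and linear independence gives
    \<open>y = 0\<close>.\<close>
  have G_inj: "y = 0\<^sub>v n" if y: "y \<in> carrier_vec n" "G *\<^sub>v y = 0\<^sub>v n" for y
  proof -
    have "(\<Sum>k<m. (At *\<^sub>v y) $ k * (At *\<^sub>v y) $ k / g $$ e k) = 0"
      using form[OF y(1) y(1)] y by simp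
    moreover have "0 \<le> (At *\<^sub>v y) $ k * (At *\<^sub>v y) $ k / g $$ e k" if "k < m" for k
      using g(2)[OF eS(1)[OF that]] by simp
    ultimately have "\<forall>k\<in>{..<m}. (At *\<^sub>v y) $ k * (At *\<^sub>v y) $ k / g $$ e k = 0"
      by (subst (asm) sum_nonneg_eq_0_iff) auto
    then have zero: "(At *\<^sub>v y) $ k = 0" if "k < m" for k
      using that g(2)[OF eS(1)[OF that]] by fastforce
    \<comment> \<open>Coordinates as a function on the basis elements themselves, as the notion of
      basis requires; the position is unique because the list is distinct.\<close>
    define a where "a = (\<lambda>v. y $ (THE c. c < n \<and> \<Delta>s ! c = v))"
    have a: "a (\<Delta>s ! c) = y $ c" if "c < n" for c
    proof -
      have "(THE c'. c' < n \<and> \<Delta>s ! c' = \<Delta>s ! c) = c"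
        using that ds(1) by (intro the_equality) (auto simp: n_def nth_eq_iff_index_eq)
      then show ?thesis by (simp add: a_def)
    qed
    have "(\<Sum>v\<in>set \<Delta>s. a v * v $$ s) = 0" if s: "s \<in> {..<r1} \<times> {..<r2}" for s
    proof (cases "s \<in> S")
      case True
      then obtain k where k: "k < m" "s = e k" using e by (auto simp: bij_betw_def)
      then show ?thesis using zero[OF k(1)] At_vec[OF k(1) y(1)] by (simp add: sum_list a)
    next
      case False
      then show ?thesis using bset s by (intro sum.neutral) (auto simp: Delta0_iff)
    qed
    then have "a v = 0" if "v \<in> set \<Delta>s" for v
      using Delta0_basisD(3)[OF ds(2)] that by blast
    then have "y $ c = 0" if "c < n" for c using a[OF that] that by (metis n_def nth_mem)
    then show ?thesis using y by (intro eq_vecI) auto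
  qed
  have Gt: "transpose_mat G = G"
  proof -
    have "transpose_mat Dg = Dg" by (intro eq_matI) (auto simp: Dg_def mat_diag_def)
    then have "transpose_mat (transpose_mat At * Dg) = Dg * At"
      using transpose_mult[of "transpose_mat At" n m Dg m] Atc Dgc by simp
    then have "transpose_mat G = transpose_mat At * (Dg * At)"
      unfolding G_def using transpose_mult[of "transpose_mat At * Dg" n m At n] Atc Dgc by simp
    then show ?thesis
      unfolding G_def using assoc_mult_mat[of "transpose_mat At" n m Dg m At n] Atc Dgc by simp
  qed
  note Hc = minv_correct(1)[OF Gc G_inj, folded H] and GH = minv_correct(2)[OF Gc G_inj, folded H]
  have Ht: "transpose_mat H = H" unfolding H by (rule minv_symmetric[OF Gc Gt G_inj])
  have wN: "w \<in> carrier_vec N" using w by (simp add: N_def)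
  define b where "b = transpose_mat A *\<^sub>v w"
  \<comment> \<open>The solution of the normal equations \<open>G *\<^sub>v y0 = b\<close>.\<close>
  define y0 where "y0 = H *\<^sub>v b"
  have bc: "b \<in> carrier_vec n" using Ac by (intro carrier_vecI) (simp add: b_def)
  have y0c: "y0 \<in> carrier_vec n" using Hc by (intro carrier_vecI) (simp add: y0_def)
  have Gy0: "G *\<^sub>v y0 = b"
    using assoc_mult_mat_vec[OF Gc Hc bc] GH bc by (simp add: y0_def)
  define u where "u = mat r1 r2 (\<lambda>s. \<Sum>c<n. y0 $ c * \<Delta>s ! c $$ s)"
  have uS: "u $$ s = (\<Sum>c<n. y0 $ c * \<Delta>s ! c $$ s)" if "s \<in> {..<r1} \<times> {..<r2}" for s
    using that by (auto simp: u_def)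
  have ue: "u $$ e k = (At *\<^sub>v y0) $ k" if "k < m" for k
    using At_vec[OF that y0c] uS[OF eS(2)[OF that]] by simp
  \<comment> \<open>Symmetry of \<open>H\<close> moves all matrices to the side of \<open>w\<close>,
    where they produce \<open>u\<close> restricted to \<open>S\<close>. The matrix J is the case
    \<open>v = Dp *\<^sub>v (R *\<^sub>v z)\<close>, and \<Sigma> is the case
    \<open>v = Dp *\<^sub>v (At *\<^sub>v y0)\<close>.\<close>
  have wx: "w \<bullet> (A *\<^sub>v (H *\<^sub>v (transpose_mat At *\<^sub>v v))) = (\<Sum>k<m. u $$ e k * v $ k)"
    if v: "v \<in> carrier_vec m" for v
  proof -
    have "w \<bullet> (A *\<^sub>v (H *\<^sub>v (transpose_mat At *\<^sub>v v))) = b \<bullet> (H *\<^sub>v (transpose_mat At *\<^sub>v v))"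
      using Ac Hc Atc v wN transpose_scalar_prod[OF Ac wN, of "H *\<^sub>v (transpose_mat At *\<^sub>v v)"]
      by (simp add: b_def)
    also have "\<dots> = y0 \<bullet> (transpose_mat At *\<^sub>v v)"
      using Hc Atc v bc transpose_scalar_prod[OF Hc bc, of "transpose_mat At *\<^sub>v v"] Ht
      by (simp add: y0_def)
    also have "\<dots> = (At *\<^sub>v y0) \<bullet> v"
      using Atc v y0c transpose_scalar_prod[of "transpose_mat At" n m y0 v] by simp
    also have "\<dots> = (\<Sum>k<m. u $$ e k * v $ k)"
      using v ue by (simp add: scalar_prod_def lessThan_atLeast0)
    finally show ?thesis .
  qed
  show thesis
  proof (rule that[of u])
    have z: "(\<Sum>k<l. \<Sum>c<n. y0 $ c * \<Delta>s ! c $$ f k) = 0"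
      if "\<And>c. c < n \<Longrightarrow> (\<Sum>k<l. \<Delta>s ! c $$ f k) = 0" for f and l :: nat
    proof -
      have "(\<Sum>k<l. \<Sum>c<n. y0 $ c * \<Delta>s ! c $$ f k) = (\<Sum>c<n. y0 $ c * (\<Sum>k<l. \<Delta>s ! c $$ f k))"
        by (subst sum.swap) (simp add: sum_distrib_left)
      also have "\<dots> = 0" using that by (intro sum.neutral) simp
      finally show ?thesis .
    qed
    have "(\<Sum>j<r2. \<Sum>c<n. y0 $ c * \<Delta>s ! c $$ (i, j)) = 0" if "i < r1" for i
      by (rule z) (use D that in \<open>simp add: Delta0_iff\<close>)
    moreover have "(\<Sum>i<r1. \<Sum>c<n. y0 $ c * \<Delta>s ! c $$ (i, j)) = 0" if "j < r2" for j
      by (rule z) (use D that in \<open>simp add: Delta0_iff\<close>)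
    moreover have "u $$ s = 0" if "s \<in> {..<r1} \<times> {..<r2} - S" for s
      using that D uS[of s] by (auto simp: Delta0_iff intro!: sum.neutral)
    ultimately show "u \<in> Delta0 r1 r2 S"
      unfolding Delta0_iff by (auto simp: u_def)
  next
    fix d assume d: "d \<in> Delta0 r1 r2 S"
    then obtain a where a: "\<And>s. s \<in> {..<r1} \<times> {..<r2} \<Longrightarrow> d $$ s = (\<Sum>v\<in>set \<Delta>s. a v * v $$ s)"
      using Delta0_basisD(2)[OF ds(2) _ d] by auto
    define y where "y = vec n (\<lambda>c. a (\<Delta>s ! c))"
    have yc: "y \<in> carrier_vec n" by (simp add: y_def)
    have ds': "d $$ s = (\<Sum>c<n. y $ c * \<Delta>s ! c $$ s)" if "s \<in> {..<r1} \<times> {..<r2}" for s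
      using a[OF that] by (simp add: sum_list y_def)
    have "(\<Sum>s\<in>S. w $ phi r1 s * d $$ s) = (\<Sum>s\<in>{..<r1} \<times> {..<r2}. w $ phi r1 s * d $$ s)"
      using S d by (intro sum.mono_neutral_left) (auto simp: Delta0_iff)
    also have "\<dots> = (\<Sum>s\<in>{..<r1} \<times> {..<r2}. w $ phi r1 s * (A *\<^sub>v y) $ phi r1 s)"
    proof (intro sum.cong refl)
      fix s assume s: "s \<in> {..<r1} \<times> {..<r2}"
      have "(A *\<^sub>v y) $ phi r1 s = (\<Sum>c<n. A $$ (phi r1 s, c) * y $ c)"
        using s phi_less[OF s] Ac yc by (simp add: scalar_prod_def row_def lessThan_atLeast0 N_def)
      also have "\<dots> = d $$ s" using A_phi[OF s] ds'[OF s] by (simp add: mult.commute)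
      finally show "w $ phi r1 s * d $$ s = w $ phi r1 s * (A *\<^sub>v y) $ phi r1 s" by simp
    qed
    also have "\<dots> = w \<bullet> (A *\<^sub>v y)"
      using Ac sum_phi[of "\<lambda>k. w $ k * (A *\<^sub>v y) $ k" r1 r2] by (simp add: scalar_prod_def lessThan_atLeast0 N_def)
    also have "\<dots> = b \<bullet> y" using transpose_scalar_prod[OF Ac wN yc] by (simp add: b_def)
    also have "\<dots> = y \<bullet> (G *\<^sub>v y0)" using comm_scalar_prod[OF bc yc] Gy0 by simp
    also have "\<dots> = (\<Sum>k<m. (At *\<^sub>v y) $ k * (At *\<^sub>v y0) $ k / g $$ e k)" by (rule form[OF yc y0c])
    also have "\<dots> = (\<Sum>k<m. u $$ e k * d $$ e k / g $$ e k)"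
      using ue At_vec[OF _ yc] ds'[OF eS(2)] by (intro sum.cong) (auto simp: mult.commute)
    finally show "(\<Sum>s\<in>S. w $ phi r1 s * d $$ s) = (\<Sum>s\<in>S. u $$ s * d $$ s / g $$ s)"
      by (simp add: sum_e)
  next
    fix z :: "real vec"
    assume "z \<in> carrier_vec (r1 * r2)"
    then have z: "z \<in> carrier_vec N" by (simp add: N_def)
    have "(A * H * transpose_mat At * Dp * R) *\<^sub>v z
        = A *\<^sub>v (H *\<^sub>v (transpose_mat At *\<^sub>v (Dp *\<^sub>v (R *\<^sub>v z))))"
      by (rule mult_mat_vec_assoc5) (use Ac Hc Atc Dpc Rc z in auto)
    moreover have "Dp *\<^sub>v (R *\<^sub>v z) \<in> carrier_vec m" using Dpc by (intro carrier_vecI) simp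
    ultimately have "w \<bullet> ((A * H * transpose_mat At * Dp * R) *\<^sub>v z) = (\<Sum>k<m. u $$ e k * (Dp *\<^sub>v (R *\<^sub>v z)) $ k)"
      using wx by (simp only:)
    also have "\<dots> = (\<Sum>k<m. u $$ e k * z $ phi r1 (e k) / p $$ e k)"
      using Rv[OF z] Dp_v[of "R *\<^sub>v z"] by simp
    finally show "w \<bullet> ((A * H * transpose_mat At * minv (diag (R *\<^sub>v vectorise p)) * R) *\<^sub>v z)
         = (\<Sum>s\<in>S. u $$ s * z $ phi r1 s / p $$ s)"
      by (simp add: sum_e Dp)
  next
    have "(A * H * (transpose_mat At * Dp * At) * H * transpose_mat A) *\<^sub>v w
        = A *\<^sub>v (H *\<^sub>v ((transpose_mat At * Dp * At) *\<^sub>v y0))"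
      unfolding y0_def b_def
      by (rule mult_mat_vec_assoc5) (use Ac Hc Atc Dpc wN in auto)
    also have "(transpose_mat At * Dp * At) *\<^sub>v y0 = (transpose_mat At * Dp) *\<^sub>v (At *\<^sub>v y0)"
      by (rule assoc_mult_mat_vec[of _ n m _ n]) (use Atc Dpc y0c in auto)
    also have "\<dots> = transpose_mat At *\<^sub>v (Dp *\<^sub>v (At *\<^sub>v y0))"
      by (rule assoc_mult_mat_vec[of _ n m _ m]) (use Atc Dpc y0c in auto)
    finally have "(A * H * (transpose_mat At * Dp * At) * H * transpose_mat A) *\<^sub>v w
        = A *\<^sub>v (H *\<^sub>v (transpose_mat At *\<^sub>v (Dp *\<^sub>v (At *\<^sub>v y0))))" .
    moreover have "Dp *\<^sub>v (At *\<^sub>v y0) \<in> carrier_vec m" using Dpc by (intro carrier_vecI) simp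
    moreover have Aty0: "At *\<^sub>v y0 \<in> carrier_vec m" using Atc by (intro carrier_vecI) simp
    ultimately have "w \<bullet> ((A * H * (transpose_mat At * Dp * At) * H * transpose_mat A) *\<^sub>v w)
        = (\<Sum>k<m. u $$ e k * (Dp *\<^sub>v (At *\<^sub>v y0)) $ k)"
      using wx by (simp only:)
    also have "\<dots> = (\<Sum>k<m. (u $$ e k)\<^sup>2 / p $$ e k)"
      using Dp_v[OF Aty0] ue by (simp add: power2_eq_square del: index_mult_mat_vec)
    finally show "w \<bullet> ((A * H * (transpose_mat At * minv (diag (R *\<^sub>v vectorise p)) * At) * H * transpose_mat A) *\<^sub>v w)
         = (\<Sum>s\<in>S. (u $$ s)\<^sup>2 / p $$ s)"
      by (simp add: sum_e Dp)
  qed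
qed

section \<open>Linearisation under weak convergence\<close>

lemma space_borel_vec [simp]: "space (borel_vec N) = carrier_vec N"
  by (simp add: borel_vec_def)

lemma measurable_borel_vec_restrict:
  "(\<lambda>v. \<lambda>i\<in>{..<N}. v $ i) \<in> borel_vec N \<rightarrow>\<^sub>M (\<Pi>\<^sub>M i\<in>{..<N}. (borel :: real measure))"
  unfolding borel_vec_def
  by (rule measurable_vimage_algebra1) (auto simp: space_PiM)

lemma measurable_vec_index [measurable (raw)]:
  assumes "i < N"
  shows "(\<lambda>v. v $ i) \<in> borel_measurable (borel_vec N)"
proof -
  have "(\<lambda>v. (\<lambda>i\<in>{..<N}. v $ i) i) \<in> borel_measurable (borel_vec N)"
    using measurable_compose[OF measurable_borel_vec_restrict measurable_component_singleton[of i "{..<N}"]] assms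
    by simp
  then show ?thesis using assms by simp
qed

lemma measurable_borel_vecI:
  assumes "f \<in> space M \<rightarrow> carrier_vec N" "\<And>i. i < N \<Longrightarrow> (\<lambda>x. f x $ i) \<in> borel_measurable M"
  shows "f \<in> M \<rightarrow>\<^sub>M borel_vec N"
  unfolding borel_vec_def
proof (rule measurable_vimage_algebra2[OF assms(1)])
  show "(\<lambda>x. \<lambda>i\<in>{..<N}. f x $ i) \<in> M \<rightarrow>\<^sub>M (\<Pi>\<^sub>M i\<in>{..<N}. borel)"
    using assms(2) by (intro measurable_restrict) auto
qed

lemma measurable_scalar_prod:
  assumes "t \<in> carrier_vec N"
  shows "(\<lambda>v. t \<bullet> v) \<in> borel_measurable (borel_vec N)"
proof -
  have "(\<lambda>v. \<Sum>i\<in>{0..<N}. t $ i * v $ i) \<in> borel_measurable (borel_vec N)"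
    by measurable
  then show ?thesis
    by (rule measurable_cong[THEN iffD1, rotated]) (auto simp: scalar_prod_def)
qed

text \<open>On \<open>carrier_vec N\<close> the function is the composition of padding a vector by
  zeros to a sequence with the given continuous map. The index set is countable, so the product
  sigma-algebra on sequences is the Borel one.\<close>

lemma borel_measurable_vecI:
  fixes f :: "real vec \<Rightarrow> real"
  assumes "continuous_on UNIV (\<lambda>x :: nat \<Rightarrow> real. f (vec N x))"
  shows "f \<in> borel_measurable (borel_vec N)"
proof -
  have 1: "(\<lambda>x :: nat \<Rightarrow> real. f (vec N x)) \<in> borel_measurable (\<Pi>\<^sub>M i\<in>UNIV. borel)"
    using borel_measurable_continuous_onI[OF assms] by (simp add: measurable_cong_sets[OF sets_PiM_equal_borel refl])
  have 2: "(\<lambda>v i. if i < N then v $ i else 0) \<in> borel_vec N \<rightarrow>\<^sub>M (\<Pi>\<^sub>M i\<in>UNIV. (borel :: real measure))"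
  proof (rule measurable_PiM_single')
    show "(\<lambda>v. if i < N then v $ i else 0) \<in> borel_measurable (borel_vec N)" for i
      by (cases "i < N") auto
  qed (auto simp: space_PiM)
  have 3: "(\<lambda>v. f (vec N (\<lambda>i. if i < N then v $ i else 0))) \<in> borel_measurable (borel_vec N)"
    using measurable_compose[OF 2 1] .
  have "vec N (\<lambda>i. if i < N then v $ i else 0) = v" if "v \<in> carrier_vec N" for v :: "real vec"
    using that by (intro eq_vecI) auto
  then show ?thesis
    by (intro measurable_cong[THEN iffD1, OF _ 3]) simp
qed

text \<open>\<open>g\<close> factors through the finite set of events that occur. This set is a
  measurable discrete variable, and from a discrete space every map is measurable, including one
  built on the Hilbert choice in \<open>I_proj\<close>.\<close>

lemma measurable_of_finitely_many_events:
  assumes "finite I" and Q: "\<And>i. i \<in> I \<Longrightarrow> {\<omega> \<in> space M. Q i \<omega>} \<in> sets M"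
    and g: "\<And>\<omega> \<omega>'. \<omega> \<in> space M \<Longrightarrow> \<omega>' \<in> space M \<Longrightarrow> (\<And>i. i \<in> I \<Longrightarrow> Q i \<omega> = Q i \<omega>') \<Longrightarrow> g \<omega> = g \<omega>'"
    and "g \<in> space M \<rightarrow> space K"
  shows "g \<in> M \<rightarrow>\<^sub>M K"
proof -
  define T where "T = (\<lambda>\<omega>. {i \<in> I. Q i \<omega>})"
  define h where "h = (\<lambda>a. g (SOME \<omega>. \<omega> \<in> space M \<and> T \<omega> = a))"
  have hT: "h (T \<omega>) = g \<omega>" if "\<omega> \<in> space M" for \<omega>
  proof -
    have "(SOME \<omega>'. \<omega>' \<in> space M \<and> T \<omega>' = T \<omega>) \<in> space M \<and> T (SOME \<omega>'. \<omega>' \<in> space M \<and> T \<omega>' = T \<omega>) = T \<omega>"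
      by (rule someI[of _ \<omega>]) (use that in simp)
    then show ?thesis
      unfolding h_def by (intro g) (use that in \<open>auto simp: T_def\<close>)
  qed
  have "T \<in> M \<rightarrow>\<^sub>M count_space (T ` space M)"
  proof (subst measurable_count_space_eq2)
    show "finite (T ` space M)"
      by (rule finite_subset[of _ "Pow I"]) (use assms(1) in \<open>auto simp: T_def\<close>)
    have "T -` {a} \<inter> space M \<in> sets M" for a
    proof (cases "a \<subseteq> I")
      case True
      have "{\<omega> \<in> space M. Q i \<omega> = (i \<in> a)} \<in> sets M" if "i \<in> I" for i
      proof (cases "i \<in> a")
        case False
        then have "{\<omega> \<in> space M. Q i \<omega> = (i \<in> a)} = space M - {\<omega> \<in> space M. Q i \<omega>}" by auto
        then show ?thesis using Q[OF that] by auto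
      qed (use Q[OF that] in simp)
      then have "{\<omega> \<in> space M. \<forall>i\<in>I. Q i \<omega> = (i \<in> a)} \<in> sets M"
        using assms(1) by (intro sets.sets_Collect_finite_All)
      moreover have "T -` {a} \<inter> space M = {\<omega> \<in> space M. \<forall>i\<in>I. Q i \<omega> = (i \<in> a)}"
        using True by (auto simp: T_def)
      ultimately show ?thesis by simp
    next
      case False
      then have "T -` {a} \<inter> space M = {}" by (auto simp: T_def)
      then show ?thesis by simp
    qed
    then show "T \<in> space M \<rightarrow> T ` space M \<and> (\<forall>a\<in>T ` space M. T -` {a} \<inter> space M \<in> sets M)" by auto
  qed
  moreover have "h \<in> count_space (T ` space M) \<rightarrow>\<^sub>M K"
    using hT assms(4) by auto
  ultimately have "(\<lambda>\<omega>. h (T \<omega>)) \<in> M \<rightarrow>\<^sub>M K" by (rule measurable_compose)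
  then show ?thesis by (rule measurable_cong[THEN iffD1, rotated]) (simp add: hT)
qed

section \<open>Tail control and the linearised limit\<close>

text \<open>A continuous stand-in for the indicator of \<bar>x\<bar> > K. Being bounded and
  Lipschitz it is an admissible test function, so a tail bound under the limit law passes to the
  approximating laws; this takes the place of a tightness argument.\<close>

definition tail_cutoff :: "real \<Rightarrow> real \<Rightarrow> real" where
  "tail_cutoff K x = min 1 (max 0 (\<bar>x\<bar> - K))"

lemma tail_cutoff_bounds: "0 \<le> tail_cutoff K x" "tail_cutoff K x \<le> 1"
  by (auto simp: tail_cutoff_def)

lemma tail_cutoff_eq_1: "K + 1 \<le> \<bar>x\<bar> \<Longrightarrow> tail_cutoff K x = 1"
  by (auto simp: tail_cutoff_def)

lemma tail_cutoff_lipschitz: "\<bar>tail_cutoff K x - tail_cutoff K y\<bar> \<le> \<bar>x - y\<bar>"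
  by (auto simp: tail_cutoff_def min_def max_def)

lemma continuous_tail_cutoff [continuous_intros]:
  "continuous_on A f \<Longrightarrow> continuous_on A (\<lambda>x. tail_cutoff K (f x))"
  unfolding tail_cutoff_def by (intro continuous_intros)

lemma measurable_tail_cutoff [measurable]: "tail_cutoff K \<in> borel_measurable borel"
  unfolding tail_cutoff_def by measurable

lemma (in prob_space) integral_tail_cutoff_tendsto_0:
  assumes [measurable]: "f \<in> borel_measurable M"
  shows "(\<lambda>K. \<integral>x. tail_cutoff (real K) (f x) \<partial>M) \<longlonglongrightarrow> 0"
proof -
  have "(\<lambda>K. \<integral>x. tail_cutoff (real K) (f x) \<partial>M) \<longlonglongrightarrow> (\<integral>x. 0 \<partial>M)"
  proof (rule integral_dominated_convergence[where w = "\<lambda>_. 1"])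
    show "AE x in M. (\<lambda>K. tail_cutoff (real K) (f x)) \<longlonglongrightarrow> 0"
    proof (rule AE_I2)
      fix x
      obtain K0 :: nat where "\<bar>f x\<bar> \<le> real K0" using real_arch_simple by blast
      then have "\<forall>\<^sub>F K in sequentially. tail_cutoff (real K) (f x) = 0"
        by (intro eventually_sequentiallyI[of K0]) (auto simp: tail_cutoff_def)
      then show "(\<lambda>K. tail_cutoff (real K) (f x)) \<longlonglongrightarrow> 0" by (rule tendsto_eventually)
    qed
  qed (auto simp: tail_cutoff_bounds)
  then show ?thesis by simp
qed

lemma continuous_on_scalar_prod_vec:
  assumes "t \<in> carrier_vec N"
  shows "continuous_on UNIV (\<lambda>x :: nat \<Rightarrow> real. t \<bullet> vec N x)"
  by (simp add: scalar_prod_def) (intro continuous_intros continuous_on_product_coordinates)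

lemma weak_conv_vecD:
  fixes f :: "real vec \<Rightarrow> real"
  assumes "weak_conv_vec N \<mu>s \<mu>" "\<And>v. v \<in> carrier_vec N \<Longrightarrow> \<bar>f v\<bar> \<le> B"
    "continuous_on UNIV (\<lambda>x :: nat \<Rightarrow> real. f (vec N x))"
  shows "(\<lambda>n. \<integral>z. f z \<partial>\<mu>s n) \<longlonglongrightarrow> (\<integral>z. f z \<partial>\<mu>)"
proof -
  have "bounded (f ` carrier_vec N)" using assms(2) by (auto simp: bounded_iff intro: exI[of _ B])
  then show ?thesis using assms(1,3) unfolding weak_conv_vec_def by blast
qed


text \<open>Continuous mapping and Slutsky in one step. The approximation of \<open>T\<close> by the
  linear form is required only where \<open>V\<close> is bounded; the remaining mass is controlled
  by \<open>tail_cutoff\<close> under \<mu>. It is enough to test with the piecewise linear steps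
  \<open>cts_step\<close>, which are uniformly continuous and take values in [0, 1].\<close>

lemma weak_conv_linearised:
  fixes T :: "nat \<Rightarrow> 'w \<Rightarrow> real" and V :: "nat \<Rightarrow> 'w \<Rightarrow> real vec" and t :: "real vec"
  assumes M: "prob_space M" and V: "\<And>n. V n \<in> M \<rightarrow>\<^sub>M borel_vec N"
    and \<mu>: "prob_space \<mu>" "sets \<mu> = sets (borel_vec N)"
    and conv: "weak_conv_vec N (\<lambda>n. distr M (borel_vec N) (V n)) \<mu>"
    and T: "\<And>n. T n \<in> borel_measurable M" and t: "t \<in> carrier_vec N"
    and close: "\<And>K e. 0 < e \<Longrightarrow> \<forall>\<^sub>F n in sequentially. AE \<omega> in M.
      (\<Sum>i<N. \<bar>V n \<omega> $ i\<bar>) \<le> K \<longrightarrow> \<bar>T n \<omega> - t \<bullet> V n \<omega>\<bar> < e"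
  shows "weak_conv_m (\<lambda>n. distr M borel (T n)) (distr \<mu> borel (\<lambda>z. t \<bullet> z))"
proof (rule integral_cts_step_conv_imp_weak_conv)
  interpret M: prob_space M by fact
  interpret \<mu>: prob_space \<mu> by fact
  note [measurable] = V T
  have [measurable]: "(\<lambda>v. t \<bullet> v) \<in> borel_measurable (borel_vec N)" by (rule measurable_scalar_prod[OF t])
  have meas_\<mu>: "f \<in> borel_measurable \<mu>" if "f \<in> borel_measurable (borel_vec N)" for f :: "real vec \<Rightarrow> real"
    using that by (simp add: measurable_cong_sets[OF \<mu>(2) refl])
  have t\<mu>: "(\<lambda>v. t \<bullet> v) \<in> borel_measurable \<mu>" by (rule meas_\<mu>) measurable
  show "real_distribution (distr M borel (T n))" for n
    by (rule M.real_distribution_distr) measurable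
  show "real_distribution (distr \<mu> borel ((\<bullet>) t))"
    by (rule \<mu>.real_distribution_distr) (rule t\<mu>)
  fix x y :: real assume "x < y"
  define g where "g = cts_step x y"
  have g01: "0 \<le> g z" "g z \<le> 1" for z using \<open>x < y\<close> by (auto simp: g_def cts_step_def)
  have ucont: "uniformly_continuous_on UNIV g"
    unfolding g_def by (rule cts_step_uniformly_continuous) fact
  then have cont: "continuous_on UNIV g" by (rule uniformly_continuous_imp_continuous)
  have [measurable]: "g \<in> borel_measurable borel" by (rule borel_measurable_continuous_onI[OF cont])
  define l where "l = (\<lambda>v :: real vec. \<Sum>i<N. \<bar>v $ i\<bar>)"
  have [measurable]: "l \<in> borel_measurable (borel_vec N)" unfolding l_def by measurable
  have main: "(\<lambda>n. \<integral>\<omega>. g (t \<bullet> V n \<omega>) \<partial>M) \<longlonglongrightarrow> (\<integral>z. g (t \<bullet> z) \<partial>\<mu>)"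
  proof -
    have "(\<lambda>n. \<integral>z. g (t \<bullet> z) \<partial>distr M (borel_vec N) (V n)) \<longlonglongrightarrow> (\<integral>z. g (t \<bullet> z) \<partial>\<mu>)"
      using g01 continuous_on_compose2[OF cont continuous_on_scalar_prod_vec[OF t]]
      by (intro weak_conv_vecD[OF conv, where B = 1]) auto
    then show ?thesis by (simp add: integral_distr)
  qed
  have diff: "(\<lambda>n. (\<integral>\<omega>. g (T n \<omega>) \<partial>M) - (\<integral>\<omega>. g (t \<bullet> V n \<omega>) \<partial>M)) \<longlonglongrightarrow> 0"
    unfolding tendsto_iff
  proof (intro allI impI)
    fix \<epsilon> :: real assume "0 < \<epsilon>"
    have "(\<lambda>K. \<integral>z. tail_cutoff (real K) (l z) \<partial>\<mu>) \<longlonglongrightarrow> 0"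
      by (rule \<mu>.integral_tail_cutoff_tendsto_0, rule meas_\<mu>) measurable
    then have "\<forall>\<^sub>F K in sequentially. (\<integral>z. tail_cutoff (real K) (l z) \<partial>\<mu>) < \<epsilon> / 2"
      using \<open>0 < \<epsilon>\<close> by (intro order_tendstoD) auto
    then obtain K where K: "(\<integral>z. tail_cutoff (real K) (l z) \<partial>\<mu>) < \<epsilon> / 2"
      by (auto simp: eventually_sequentially)
    have "(\<lambda>n. \<integral>z. tail_cutoff (real K) (l z) \<partial>distr M (borel_vec N) (V n))
        \<longlonglongrightarrow> (\<integral>z. tail_cutoff (real K) (l z) \<partial>\<mu>)"
      by (rule weak_conv_vecD[OF conv, where B = 1])
        (auto simp: tail_cutoff_bounds l_def intro!: continuous_intros)
    then have "(\<lambda>n. \<integral>\<omega>. tail_cutoff (real K) (l (V n \<omega>)) \<partial>M) \<longlonglongrightarrow> (\<integral>z. tail_cutoff (real K) (l z) \<partial>\<mu>)"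
      by (simp add: integral_distr)
    then have ev1: "\<forall>\<^sub>F n in sequentially. (\<integral>\<omega>. tail_cutoff (real K) (l (V n \<omega>)) \<partial>M) < \<epsilon> / 2"
      using K by (intro order_tendstoD)
    obtain e where "0 < e" and e: "\<And>a b. \<bar>a - b\<bar> < e \<Longrightarrow> \<bar>g a - g b\<bar> < \<epsilon> / 2"
      using ucont \<open>0 < \<epsilon>\<close> unfolding uniformly_continuous_on_def
      by (metis dist_real_def half_gt_zero UNIV_I)
    \<comment> \<open>The bound is \<open>K + 1\<close> and not \<open>K\<close>, because the cutoff
      reaches 1 only there.\<close>
    have ev2: "\<forall>\<^sub>F n in sequentially. AE \<omega> in M. l (V n \<omega>) \<le> real K + 1 \<longrightarrow> \<bar>T n \<omega> - t \<bullet> V n \<omega>\<bar> < e"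
      unfolding l_def by (rule close) fact
    show "\<forall>\<^sub>F n in sequentially. dist ((\<integral>\<omega>. g (T n \<omega>) \<partial>M) - (\<integral>\<omega>. g (t \<bullet> V n \<omega>) \<partial>M)) 0 < \<epsilon>"
      using ev1 ev2
    proof eventually_elim
      case (elim n)
      have int: "integrable M (\<lambda>\<omega>. g (T n \<omega>))" "integrable M (\<lambda>\<omega>. g (t \<bullet> V n \<omega>))"
        "integrable M (\<lambda>\<omega>. tail_cutoff (real K) (l (V n \<omega>)))"
        using g01 tail_cutoff_bounds by (auto intro!: M.integrable_const_bound[where B = 1])
      have "\<bar>(\<integral>\<omega>. g (T n \<omega>) \<partial>M) - (\<integral>\<omega>. g (t \<bullet> V n \<omega>) \<partial>M)\<bar> = \<bar>\<integral>\<omega>. g (T n \<omega>) - g (t \<bullet> V n \<omega>) \<partial>M\<bar>"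
        using int by simp
      also have "\<dots> \<le> (\<integral>\<omega>. \<bar>g (T n \<omega>) - g (t \<bullet> V n \<omega>)\<bar> \<partial>M)"
        by (rule integral_abs_bound)
      also have "\<dots> \<le> (\<integral>\<omega>. \<epsilon> / 2 + tail_cutoff (real K) (l (V n \<omega>)) \<partial>M)"
      proof (rule integral_mono_AE)
        \<comment> \<open>Inside the bound uniform continuity gives \<epsilon> / 2. Outside it the
          cutoff equals 1, which dominates the difference of two values in [0, 1].\<close>
        show "AE \<omega> in M. \<bar>g (T n \<omega>) - g (t \<bullet> V n \<omega>)\<bar> \<le> \<epsilon> / 2 + tail_cutoff (real K) (l (V n \<omega>))"
          using elim(2)
        proof eventually_elim
          case (elim \<omega>)
          show ?case
          proof (cases "l (V n \<omega>) \<le> real K + 1")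
            case True
            then show ?thesis using elim e[of "T n \<omega>" "t \<bullet> V n \<omega>"] tail_cutoff_bounds(1)[of "real K" "l (V n \<omega>)"] by auto
          next
            case False
            then have "tail_cutoff (real K) (l (V n \<omega>)) = 1" by (intro tail_cutoff_eq_1) auto
            then show ?thesis using g01[of "T n \<omega>"] g01[of "t \<bullet> V n \<omega>"] \<open>0 < \<epsilon>\<close> by auto
          qed
        qed
      qed (use int in auto)
      also have "\<dots> = \<epsilon> / 2 + (\<integral>\<omega>. tail_cutoff (real K) (l (V n \<omega>)) \<partial>M)"
        using int by (simp add: M.prob_space)
      also have "\<dots> < \<epsilon>" using elim(1) by simp
      finally show ?case by simp
    qed
  qed
  have "(\<lambda>n. \<integral>\<omega>. g (T n \<omega>) \<partial>M) \<longlonglongrightarrow> (\<integral>z. g (t \<bullet> z) \<partial>\<mu>)"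
    using tendsto_add[OF diff main] by simp
  then show "(\<lambda>n. integral\<^sup>L (distr M borel (T n)) (cts_step x y))
      \<longlonglongrightarrow> integral\<^sup>L (distr \<mu> borel ((\<bullet>) t)) (cts_step x y)"
    unfolding g_def[symmetric] using t\<mu> by (simp add: integral_distr)
qed

section \<open>Weak convergence of vectors from one-dimensional projections\<close>

text \<open>The phase \<open>b\<close> brings in sines, and a zero frequency brings in constants.
  Each summand depends on \<open>v\<close> only through \<open>t \<bullet> v\<close>, so its
  integral is governed by a one-dimensional projection.\<close>

inductive trig_fun :: "nat \<Rightarrow> (real vec \<Rightarrow> real) \<Rightarrow> bool" for N where
  cos: "t \<in> carrier_vec N \<Longrightarrow> trig_fun N (\<lambda>v. c * cos (t \<bullet> v + b))"
| add: "trig_fun N f \<Longrightarrow> trig_fun N g \<Longrightarrow> trig_fun N (\<lambda>v. f v + g v)"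

lemma trig_fun_continuous: "trig_fun N f \<Longrightarrow> continuous_on UNIV (\<lambda>x :: nat \<Rightarrow> real. f (vec N x))"
  by (induction rule: trig_fun.induct) (auto intro!: continuous_intros continuous_on_scalar_prod_vec)

lemma trig_fun_bounded: "trig_fun N f \<Longrightarrow> \<exists>B. \<forall>v. \<bar>f v\<bar> \<le> B"
proof (induction rule: trig_fun.induct)
  case (cos t c b)
  have "\<bar>c * cos (t \<bullet> v + b)\<bar> \<le> \<bar>c\<bar>" for v
    by (simp add: abs_mult mult_left_le)
  then show ?case by blast
next
  case (add f g)
  then show ?case by (meson abs_triangle_ineq add_mono order_trans)
qed

text \<open>Closure under products holds on \<open>carrier_vec N\<close> only: \<open>t \<bullet> v\<close> sums over the dimension of \<open>v\<close>, with junk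
  entries of \<open>t\<close> beyond \<open>N\<close>.\<close>

definition trig_on :: "nat \<Rightarrow> (real vec \<Rightarrow> real) \<Rightarrow> bool" where
  "trig_on N f \<longleftrightarrow> (\<exists>g. trig_fun N g \<and> (\<forall>v\<in>carrier_vec N. f v = g v))"

lemma trig_on_cos: "t \<in> carrier_vec N \<Longrightarrow> trig_on N (\<lambda>v. c * cos (t \<bullet> v + b))"
  unfolding trig_on_def using trig_fun.cos by blast

lemma trig_on_add: "trig_on N f \<Longrightarrow> trig_on N g \<Longrightarrow> trig_on N (\<lambda>v. f v + g v)"
  unfolding trig_on_def by (metis (mono_tags, lifting) trig_fun.add)

lemma trig_on_const: "trig_on N (\<lambda>_. c)"
  unfolding trig_on_def using trig_fun.cos[of "0\<^sub>v N" N c 0]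
  by (intro exI[of _ "\<lambda>v. c * cos (0\<^sub>v N \<bullet> v + 0)"]) auto

lemma trig_on_cos_mult:
  assumes "trig_fun N g" "t \<in> carrier_vec N"
  shows "trig_on N (\<lambda>v. (c * cos (t \<bullet> v + b)) * g v)"
  using assms(1)
proof (induction rule: trig_fun.induct)
  case (cos s d e)
  have "(c * cos (t \<bullet> v + b)) * (d * cos (s \<bullet> v + e))
      = c * d / 2 * cos ((t - s) \<bullet> v + (b - e)) + c * d / 2 * cos ((t + s) \<bullet> v + (b + e))"
    if "v \<in> carrier_vec N" for v
  proof -
    have "(t - s) \<bullet> v + (b - e) = (t \<bullet> v + b) - (s \<bullet> v + e)"
      using that assms(2) cos by (simp add: minus_scalar_prod_distrib)
    moreover have "(t + s) \<bullet> v + (b + e) = (t \<bullet> v + b) + (s \<bullet> v + e)"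
      using that assms(2) cos by (simp add: add_scalar_prod_distrib)
    moreover have "(c * cos x) * (d * cos y) = c * d / 2 * cos (x - y) + c * d / 2 * cos (x + y)" for x y
      by (simp add: cos_add cos_diff algebra_simps)
    ultimately show ?thesis by (simp only:)
  qed
  then show ?case
    unfolding trig_on_def using assms(2) cos
    by (intro exI[of _ "\<lambda>v. c * d / 2 * cos ((t - s) \<bullet> v + (b - e)) + c * d / 2 * cos ((t + s) \<bullet> v + (b + e))"])
      (simp, intro trig_fun.add trig_fun.cos[where c = "c * d / 2", simplified], auto)
next
  case (add f g)
  then show ?case using trig_on_add by (fastforce simp: distrib_left)
qed

lemma trig_on_mult:
  assumes "trig_on N f" "trig_on N g"
  shows "trig_on N (\<lambda>v. f v * g v)"
proof -
  obtain f' g' where f': "trig_fun N f'" "\<And>v. v \<in> carrier_vec N \<Longrightarrow> f v = f' v"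
    and g': "trig_fun N g'" "\<And>v. v \<in> carrier_vec N \<Longrightarrow> g v = g' v"
    using assms unfolding trig_on_def by auto
  have "trig_on N (\<lambda>v. f' v * g' v)"
    using f'(1)
  proof (induction rule: trig_fun.induct)
    case (cos t c b)
    then show ?case by (rule trig_on_cos_mult[OF g'(1)])
  next
    case (add f1 f2)
    then show ?case using trig_on_add by (fastforce simp: distrib_right)
  qed
  then show ?thesis using f'(2) g'(2) unfolding trig_on_def by auto
qed

lemma trig_on_polynomial:
  fixes q :: "real \<Rightarrow> real"
  assumes "real_polynomial_function q" "trig_on N f"
  shows "trig_on N (\<lambda>v. q (f v))"
  using assms(1)
proof (induction rule: real_polynomial_function.induct)
  case (linear q)
  then obtain c where "q = (\<lambda>x. x * c)" using real_bounded_linear by auto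
  then show ?case using trig_on_mult[OF assms(2) trig_on_const[of N c]] by simp
qed (auto intro: trig_on_const trig_on_add trig_on_mult)

lemma trig_on_continuous:
  assumes "trig_on N f"
  shows "continuous_on UNIV (\<lambda>x :: nat \<Rightarrow> real. f (vec N x))"
proof -
  obtain g where "trig_fun N g" "\<And>v. v \<in> carrier_vec N \<Longrightarrow> f v = g v"
    using assms unfolding trig_on_def by auto
  then show ?thesis using trig_fun_continuous by simp
qed

lemma trig_on_bounded: "trig_on N f \<Longrightarrow> \<exists>B. \<forall>v\<in>carrier_vec N. \<bar>f v\<bar> \<le> B"
  unfolding trig_on_def using trig_fun_bounded by metis

lemma trig_on_dense:
  fixes f :: "real vec \<Rightarrow> real"
  assumes "continuous_on UNIV (\<lambda>x :: nat \<Rightarrow> real. f (vec N x))" "0 < L" "0 < e"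
  obtains g where "trig_on N g" "\<And>v. v \<in> carrier_vec N \<Longrightarrow> (\<And>i. i < N \<Longrightarrow> \<bar>v $ i\<bar> \<le> L) \<Longrightarrow> \<bar>f v - g v\<bar> < e"
proof -
  \<comment> \<open>Coordinates from \<open>N\<close> on are pinned to 0, so that distinct points of
    the compact box differ in one of the first \<open>N\<close> coordinates and can be separated by
    functions of \<open>vec N x\<close>.\<close>
  define K :: "(nat \<Rightarrow> real) set" where "K = PiE UNIV (\<lambda>i. if i < N then {-L..L} else {0})"
  define P where "P = (\<lambda>F :: (nat \<Rightarrow> real) \<Rightarrow> real. \<exists>g. trig_on N g \<and> F = (\<lambda>x. g (vec N x)))"
  have "\<exists>F. P F \<and> (\<forall>x\<in>K. \<bar>f (vec N x) - F x\<bar> < e)"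
  proof (rule Stone_Weierstrass_HOL)
    show "compact K" unfolding K_def by (rule compact_PiE_UNIV) auto
    show "P (\<lambda>x. c)" for c unfolding P_def using trig_on_const[of N c] by blast
    show "continuous_on K F" if "P F" for F
      using that trig_on_continuous continuous_on_subset unfolding P_def by blast
    show "P (\<lambda>x. F x + G x)" if "P F \<and> P G" for F G
      using that trig_on_add unfolding P_def by fastforce
    show "P (\<lambda>x. F x * G x)" if "P F \<and> P G" for F G
      using that trig_on_mult unfolding P_def by fastforce
    show "continuous_on K (\<lambda>x. f (vec N x))"
      using assms(1) continuous_on_subset by blast
    show "\<exists>F. P F \<and> F x \<noteq> F y" if xy: "x \<in> K \<and> y \<in> K \<and> x \<noteq> y" for x y
    proof -
      obtain i where i: "x i \<noteq> y i" using xy by auto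
      have range: "z i \<in> (if i < N then {-L..L} else {0})" if "z \<in> K" for z
        using PiE_mem[OF that[unfolded K_def] UNIV_I[of i]] .
      have iN: "i < N" using i range[of x] range[of y] xy by (auto split: if_splits)
      \<comment> \<open>The phase - pi / 2 turns the cosine into a sine, and the frequency 1 / L
        maps the box into [-1, 1], where the sine is injective.\<close>
      define F where "F = (\<lambda>v. 1 * cos (((1 / L) \<cdot>\<^sub>v unit_vec N i) \<bullet> v + (- pi / 2)) :: real)"
      have F: "F (vec N z) = sin (z i / L)" for z
        using iN by (simp add: F_def cos_diff scalar_prod_left_unit)
      have "trig_on N F" unfolding F_def by (rule trig_on_cos) simp
      moreover have "F (vec N x) \<noteq> F (vec N y)"
      proof
        assume "F (vec N x) = F (vec N y)"
        then have "sin (x i / L) = sin (y i / L)" by (simp only: F)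
        moreover have "- (pi / 2) \<le> z i / L \<and> z i / L \<le> pi / 2" if "z \<in> K" for z
        proof -
          have "\<bar>z i / L\<bar> \<le> 1" using range[OF that] iN assms(2) by (auto simp: abs_le_iff field_simps)
          then show ?thesis using pi_gt3 by linarith
        qed
        ultimately have "x i / L = y i / L" using xy by (metis sin_inj_pi)
        then show False using i assms(2) by simp
      qed
      ultimately show ?thesis unfolding P_def by blast
    qed
  qed (rule assms(3))
  then obtain g where g: "trig_on N g" "\<And>x. x \<in> K \<Longrightarrow> \<bar>f (vec N x) - g (vec N x)\<bar> < e"
    unfolding P_def by auto
  have "\<bar>f v - g v\<bar> < e" if v: "v \<in> carrier_vec N" "\<And>i. i < N \<Longrightarrow> \<bar>v $ i\<bar> \<le> L" for v
  proof -
    define x where "x = (\<lambda>i. if i < N then v $ i else 0)"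
    have "x \<in> K" using v(2) by (auto simp: K_def x_def abs_le_iff minus_le_iff)
    moreover have "vec N x = v" using v(1) by (intro eq_vecI) (auto simp: x_def)
    ultimately show ?thesis using g(2)[of x] by simp
  qed
  then show thesis using that g(1) by blast
qed

text \<open>A trigonometric approximation on the box is made globally bounded by composing it with a
  polynomial that approximates the truncation at \<open>\<plusminus>B\<close> on its range.\<close>

lemma trig_on_dense_bounded:
  fixes f :: "real vec \<Rightarrow> real"
  assumes "continuous_on UNIV (\<lambda>x :: nat \<Rightarrow> real. f (vec N x))"
    and B: "\<And>v. v \<in> carrier_vec N \<Longrightarrow> \<bar>f v\<bar> \<le> B" and "0 < L" "0 < e"
  obtains h where "trig_on N h" "\<And>v. v \<in> carrier_vec N \<Longrightarrow> \<bar>h v\<bar> \<le> B + e"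
    "\<And>v. v \<in> carrier_vec N \<Longrightarrow> (\<And>i. i < N \<Longrightarrow> \<bar>v $ i\<bar> \<le> L) \<Longrightarrow> \<bar>f v - h v\<bar> \<le> e"
proof -
  obtain g where g: "trig_on N g"
    "\<And>v. v \<in> carrier_vec N \<Longrightarrow> (\<And>i. i < N \<Longrightarrow> \<bar>v $ i\<bar> \<le> L) \<Longrightarrow> \<bar>f v - g v\<bar> < e / 2"
    using trig_on_dense[OF assms(1,3), of "e / 2"] \<open>0 < e\<close> by (metis half_gt_zero)
  obtain G where G: "\<And>v. v \<in> carrier_vec N \<Longrightarrow> \<bar>g v\<bar> \<le> G"
    using trig_on_bounded[OF g(1)] by auto
  define c where "c = (\<lambda>s :: real. max (- B) (min B s))"
  have "continuous_on {-G..G} c" unfolding c_def by (intro continuous_intros)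
  then obtain q where q: "real_polynomial_function q" "\<And>s. s \<in> {-G..G} \<Longrightarrow> \<bar>c s - q s\<bar> < e / 2"
    using Stone_Weierstrass_real_polynomial_function[of "{-G..G}" c "e / 2"] \<open>0 < e\<close> by auto
  have "B \<ge> 0" using B[of "0\<^sub>v N"] by simp
  \<comment> \<open>The truncation fixes the values of \<open>f\<close> and is 1-Lipschitz, so
    applying it to \<open>g\<close> does not worsen the approximation of \<open>f\<close>.\<close>
  have cB: "\<bar>c s\<bar> \<le> B" "\<bar>r\<bar> \<le> B \<Longrightarrow> c r = r" "\<bar>c r - c s\<bar> \<le> \<bar>r - s\<bar>" for r s
  proof -
    show "\<bar>c s\<bar> \<le> B" using \<open>B \<ge> 0\<close> by (simp add: c_def abs_le_iff)
    show "c r = r" if "\<bar>r\<bar> \<le> B" using that by (simp add: c_def abs_le_iff)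
    show "\<bar>c r - c s\<bar> \<le> \<bar>r - s\<bar>" unfolding c_def max_def min_def by simp
  qed
  have qg: "\<bar>c (g v) - q (g v)\<bar> < e / 2" if "v \<in> carrier_vec N" for v
    using q(2) G[OF that] by (simp add: abs_le_iff minus_le_iff)
  show thesis
  proof (rule that[of "\<lambda>v. q (g v)"])
    show "trig_on N (\<lambda>v. q (g v))" by (rule trig_on_polynomial[OF q(1) g(1)])
    show "\<bar>q (g v)\<bar> \<le> B + e" if "v \<in> carrier_vec N" for v
      using qg[OF that] cB(1)[of "g v"] \<open>0 < e\<close> by linarith
    show "\<bar>f v - q (g v)\<bar> \<le> e" if v: "v \<in> carrier_vec N" "\<And>i. i < N \<Longrightarrow> \<bar>v $ i\<bar> \<le> L" for v
      using qg[OF v(1)] g(2)[OF v] cB(2)[OF B[OF v(1)]] cB(3)[of "f v" "g v"] by linarith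
  qed
qed

lemma lipschitz_imp_continuous_on:
  fixes g :: "real \<Rightarrow> real"
  assumes "\<And>x y. \<bar>g x - g y\<bar> \<le> \<bar>x - y\<bar>"
  shows "continuous_on A g"
  unfolding continuous_on_iff dist_real_def using assms by (meson le_less_trans)

text \<open>The Cramer-Wold device. Bounded Lipschitz test functions of the projections supply two
  things: cosines, hence all trigonometric functions, and cutoffs of single coordinates, hence
  control outside a box. On the box \<open>f\<close> is replaced by a trigonometric
  approximation.\<close>

lemma weak_conv_vec_of_projections:
  assumes \<mu>s: "\<And>n. prob_space (\<mu>s n)" "\<And>n. sets (\<mu>s n) = sets (borel_vec N)"
    and \<mu>: "prob_space \<mu>" "sets \<mu> = sets (borel_vec N)"
    and conv: "\<And>t g. t \<in> carrier_vec N \<Longrightarrow> (\<And>x. \<bar>g x\<bar> \<le> 1) \<Longrightarrow> (\<And>x y. \<bar>g x - g y\<bar> \<le> \<bar>x - y\<bar>) \<Longrightarrow>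
      (\<lambda>n. \<integral>z. g (t \<bullet> z) \<partial>\<mu>s n) \<longlonglongrightarrow> (\<integral>z. g (t \<bullet> z) \<partial>\<mu>)"
  shows "weak_conv_vec N \<mu>s \<mu>"
  unfolding weak_conv_vec_def
proof (intro allI impI, elim conjE)
  fix f :: "real vec \<Rightarrow> real"
  assume bd: "bounded (f ` carrier_vec N)" and cont: "continuous_on UNIV (\<lambda>x :: nat \<Rightarrow> real. f (vec N x))"
  interpret \<mu>: prob_space \<mu> by fact
  obtain B where B: "\<And>v. v \<in> carrier_vec N \<Longrightarrow> \<bar>f v\<bar> \<le> B"
    using bd by (auto simp: bounded_iff)
  have "B \<ge> 0" using B[of "0\<^sub>v N"] by simp
  have meas: "h \<in> borel_measurable m" if "h \<in> borel_measurable (borel_vec N)" "sets m = sets (borel_vec N)"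
    for h :: "real vec \<Rightarrow> real" and m
    using that by (simp add: measurable_cong_sets[OF that(2) refl])
  have space: "space m = carrier_vec N" if "sets m = sets (borel_vec N)" for m
    using sets_eq_imp_space_eq[OF that] by simp
  have integrable: "integrable m h"
    if "prob_space m" "sets m = sets (borel_vec N)" "h \<in> borel_measurable (borel_vec N)"
      and bd: "\<exists>C. \<forall>v\<in>carrier_vec N. \<bar>h v\<bar> \<le> C" for m and h :: "real vec \<Rightarrow> real"
  proof -
    interpret prob_space m by fact
    obtain C where C: "\<And>v. v \<in> carrier_vec N \<Longrightarrow> \<bar>h v\<bar> \<le> C" using bd by auto
    show ?thesis
    proof (rule integrable_const_bound[of _ C])
      show "AE x in m. norm (h x) \<le> C"
        by (rule AE_I2) (use C space[OF that(2)] in simp)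
    qed (rule meas[OF that(3,2)])
  qed
  have tail_meas: "(\<lambda>v. tail_cutoff K (v $ i)) \<in> borel_measurable (borel_vec N)" if "i < N" for K i
    using that by measurable
  have tail_conv: "(\<lambda>n. \<integral>v. tail_cutoff K (v $ i) \<partial>\<mu>s n) \<longlonglongrightarrow> (\<integral>v. tail_cutoff K (v $ i) \<partial>\<mu>)" if "i < N" for K i
  proof -
    \<comment> \<open>Coordinates are the projections along unit vectors.\<close>
    have eq: "(\<integral>v. tail_cutoff K (unit_vec N i \<bullet> v) \<partial>m) = (\<integral>v. tail_cutoff K (v $ i) \<partial>m)"
      if "sets m = sets (borel_vec N)" for m
      using \<open>i < N\<close> by (intro Bochner_Integration.integral_cong refl) (simp add: space[OF that] scalar_prod_left_unit)
    show ?thesis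
      using conv[of "unit_vec N i" "tail_cutoff K"] tail_cutoff_bounds tail_cutoff_lipschitz
      by (simp add: eq \<mu>s \<mu>)
  qed
  have trig_conv: "(\<lambda>n. \<integral>z. h z \<partial>\<mu>s n) \<longlonglongrightarrow> (\<integral>z. h z \<partial>\<mu>)" if "trig_on N h" for h
  proof -
    obtain g where g: "trig_fun N g" "\<And>v. v \<in> carrier_vec N \<Longrightarrow> h v = g v"
      using \<open>trig_on N h\<close> unfolding trig_on_def by blast
    have "(\<lambda>n. \<integral>z. g z \<partial>\<mu>s n) \<longlonglongrightarrow> (\<integral>z. g z \<partial>\<mu>)"
      using g(1)
    proof (induction rule: trig_fun.induct)
      case (cos t c b)
      \<comment> \<open>Shows that a phase-shifted cosine is an admissible test function; the
        amplitude \<open>c\<close> is factored out of the integral afterwards.\<close>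
      have "\<bar>cos (x + b) - cos (y + b)\<bar> \<le> \<bar>x - y\<bar>" for x y :: real
      proof -
        have "\<bar>cos (x + b) - cos (y + b)\<bar> = 2 * \<bar>sin ((x + y + 2 * b) / 2)\<bar> * \<bar>sin ((y - x) / 2)\<bar>"
          by (simp add: cos_diff_cos abs_mult algebra_simps)
        also have "\<dots> \<le> 2 * 1 * \<bar>(y - x) / 2\<bar>"
          by (intro mult_mono abs_sin_x_le_abs_x) auto
        finally show ?thesis by simp
      qed
      then show ?case
        using conv[OF cos, of "\<lambda>x. cos (x + b)"] by (simp add: tendsto_mult_left)
    next
      case (add f g)
      have "integrable m k" if k: "trig_fun N k" and m: "prob_space m" "sets m = sets (borel_vec N)" for m k
      proof -
        show ?thesis
          using integrable[OF m borel_measurable_vecI[of k N, OF trig_fun_continuous[OF k]]]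
            trig_fun_bounded[OF k] by blast
      qed
      then show ?case
        using tendsto_add[OF add.IH] add.hyps \<mu>s \<mu> by simp
    qed
    moreover have "(\<integral>z. h z \<partial>m) = (\<integral>z. g z \<partial>m)" if "sets m = sets (borel_vec N)" for m
      using g(2) space[OF that] by (intro Bochner_Integration.integral_cong) auto
    ultimately show ?thesis using \<mu>s \<mu> by simp
  qed
  show "(\<lambda>n. \<integral>z. f z \<partial>\<mu>s n) \<longlonglongrightarrow> (\<integral>z. f z \<partial>\<mu>)"
    unfolding tendsto_iff dist_real_def
  proof (intro allI impI)
    fix \<epsilon> :: real assume "0 < \<epsilon>"
    \<comment> \<open>\<open>e \<le> 1\<close> makes \<open>2 * B + 1\<close> a bound for \<bar>f -
      h\<bar> everywhere. Each of the two gaps between \<open>f\<close> and \<open>h\<close> then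
      costs less than \<epsilon> / 4, and so does the convergence of the integrals of
      \<open>h\<close>.\<close>
    define e where "e = min 1 (\<epsilon> / 8)"
    have e: "0 < e" "e \<le> 1" "e \<le> \<epsilon> / 8" using \<open>0 < \<epsilon>\<close> by (auto simp: e_def)
    define C where "C = 2 * B + 1"
    have C: "C > 0" using \<open>B \<ge> 0\<close> by (simp add: C_def)
    define tail where "tail = (\<lambda>K v. \<Sum>i<N. tail_cutoff (real K) (v $ i))"
    have "(\<lambda>K. \<Sum>i<N. \<integral>v. tail_cutoff (real K) (v $ i) \<partial>\<mu>) \<longlonglongrightarrow> (\<Sum>i<N. 0)"
      by (intro tendsto_sum \<mu>.integral_tail_cutoff_tendsto_0 meas[OF _ \<mu>(2)] measurable_vec_index) simp
    then have "\<forall>\<^sub>F K in sequentially. (\<Sum>i<N. \<integral>v. tail_cutoff (real K) (v $ i) \<partial>\<mu>) < \<epsilon> / (8 * C)"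
      using \<open>0 < \<epsilon>\<close> C by (intro order_tendstoD) auto
    then obtain K where K: "(\<Sum>i<N. \<integral>v. tail_cutoff (real K) (v $ i) \<partial>\<mu>) < \<epsilon> / (8 * C)"
      by (auto simp: eventually_sequentially)
    have tail_int: "(\<integral>v. tail K v \<partial>m) = (\<Sum>i<N. \<integral>v. tail_cutoff (real K) (v $ i) \<partial>m)"
      "integrable m (tail K)" if "prob_space m" "sets m = sets (borel_vec N)" for m
    proof -
      have "integrable m (\<lambda>v. tail_cutoff (real K) (v $ i))" if "i < N" for i
        using tail_cutoff_bounds tail_meas[OF that]
        by (intro integrable[OF \<open>prob_space m\<close> \<open>sets m = _\<close>] exI[of _ 1]) auto
      then show "(\<integral>v. tail K v \<partial>m) = (\<Sum>i<N. \<integral>v. tail_cutoff (real K) (v $ i) \<partial>m)"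
        "integrable m (tail K)" unfolding tail_def by auto
    qed
    have "(\<lambda>n. \<Sum>i<N. \<integral>v. tail_cutoff (real K) (v $ i) \<partial>\<mu>s n) \<longlonglongrightarrow> (\<Sum>i<N. \<integral>v. tail_cutoff (real K) (v $ i) \<partial>\<mu>)"
      by (intro tendsto_sum tail_conv) auto
    then have ev1: "\<forall>\<^sub>F n in sequentially. (\<Sum>i<N. \<integral>v. tail_cutoff (real K) (v $ i) \<partial>\<mu>s n) < \<epsilon> / (8 * C)"
      using K by (intro order_tendstoD)
    obtain h where h: "trig_on N h" "\<And>v. v \<in> carrier_vec N \<Longrightarrow> \<bar>h v\<bar> \<le> B + e"
      "\<And>v. v \<in> carrier_vec N \<Longrightarrow> (\<And>i. i < N \<Longrightarrow> \<bar>v $ i\<bar> \<le> real K + 1) \<Longrightarrow> \<bar>f v - h v\<bar> \<le> e"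
      using trig_on_dense_bounded[OF cont B _ e(1), of "real K + 1"] by auto
    have ev2: "\<forall>\<^sub>F n in sequentially. \<bar>(\<integral>z. h z \<partial>\<mu>s n) - (\<integral>z. h z \<partial>\<mu>)\<bar> < \<epsilon> / 4"
      using tendstoD[OF trig_conv[OF h(1)], of "\<epsilon> / 4"] \<open>0 < \<epsilon>\<close> by (simp add: dist_real_def)
    have pointwise: "\<bar>f v - h v\<bar> \<le> e + C * tail K v" if v: "v \<in> carrier_vec N" for v
    proof (cases "\<forall>i<N. \<bar>v $ i\<bar> \<le> real K + 1")
      case True
      have "0 \<le> tail K v" unfolding tail_def by (intro sum_nonneg tail_cutoff_bounds)
      then show ?thesis using h(3)[OF v] True C by (smt (verit) mult_nonneg_nonneg)
    next
      case False
      then obtain i where i: "i < N" "\<bar>v $ i\<bar> > real K + 1" by auto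
      have "1 = tail_cutoff (real K) (v $ i)" using i by (subst tail_cutoff_eq_1) auto
      also have "\<dots> \<le> tail K v"
        unfolding tail_def using i by (intro member_le_sum) (auto simp: tail_cutoff_bounds)
      finally have "C * 1 \<le> C * tail K v" using C by (intro mult_left_mono) auto
      moreover have "\<bar>f v - h v\<bar> \<le> C" using B[OF v] h(2)[OF v] e by (auto simp: C_def)
      ultimately show ?thesis using e by linarith
    qed
    have gap: "\<bar>(\<integral>z. f z \<partial>m) - (\<integral>z. h z \<partial>m)\<bar> \<le> e + C * (\<Sum>i<N. \<integral>v. tail_cutoff (real K) (v $ i) \<partial>m)"
      if m: "prob_space m" "sets m = sets (borel_vec N)" for m
    proof -
      interpret prob_space m by fact
      have int: "integrable m f" "integrable m h"
        using integrable[OF m borel_measurable_vecI[of f N, OF cont]] B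
          integrable[OF m borel_measurable_vecI[of h N, OF trig_on_continuous[OF h(1)]]] h(2) by blast+
      have "\<bar>(\<integral>z. f z \<partial>m) - (\<integral>z. h z \<partial>m)\<bar> = \<bar>\<integral>z. f z - h z \<partial>m\<bar>" using int by simp
      also have "\<dots> \<le> (\<integral>z. \<bar>f z - h z\<bar> \<partial>m)" by (rule integral_abs_bound)
      also have "\<dots> \<le> (\<integral>z. e + C * tail K z \<partial>m)"
        using pointwise int tail_int(2)[OF m] space[OF m(2)]
        by (intro integral_mono) auto
      also have "\<dots> = e + C * (\<integral>z. tail K z \<partial>m)"
        using tail_int(2)[OF m] by (simp add: prob_space)
      finally show ?thesis using tail_int(1)[OF m] by simp
    qed
    have C_bd: "C * x < \<epsilon> / 8" if "x < \<epsilon> / (8 * C)" for x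
      using that C by (simp add: field_simps)
    show "\<forall>\<^sub>F n in sequentially. \<bar>(\<integral>z. f z \<partial>\<mu>s n) - (\<integral>z. f z \<partial>\<mu>)\<bar> < \<epsilon>"
      using ev1 ev2
    proof eventually_elim
      case (elim n)
      then show ?case
        using gap[OF \<mu>s, of n] gap[OF \<mu>] C_bd[OF elim(1)] C_bd[OF K] e(3) \<open>0 < \<epsilon>\<close> by linarith
    qed
  qed
qed

section \<open>Gaussian laws and the central limit theorem\<close>

lemma prob_space_normal_law: "real_distribution (normal_law m v)"
proof -
  interpret real_distribution std_normal_distribution by (rule real_dist_normal_dist)
  show ?thesis unfolding normal_law_def by (rule real_distribution_distr) simp
qed

lemma integral_normal_law:
  fixes g :: "real \<Rightarrow> 'a::{banach, second_countable_topology}"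
  assumes "g \<in> borel_measurable borel"
  shows "(\<integral>x. g x \<partial>normal_law m v) = (\<integral>x. g (m + sqrt v * x) \<partial>std_normal_distribution)"
  unfolding normal_law_def using assms by (intro integral_distr) auto

lemma char_normal_law:
  assumes "0 \<le> v"
  shows "char (normal_law 0 v) s = exp (- (s\<^sup>2 * v / 2))"
proof -
  have "char (normal_law 0 v) s = (\<integral>x. iexp (s * (0 + sqrt v * x)) \<partial>std_normal_distribution)"
    unfolding char_def by (rule integral_normal_law) measurable
  also have "\<dots> = char std_normal_distribution (s * sqrt v)"
    unfolding char_def by (simp add: mult.assoc)
  also have "\<dots> = complex_of_real (exp (- ((s * sqrt v)\<^sup>2) / 2))"
    by (simp only: char_std_normal_distribution)
  also have "(s * sqrt v)\<^sup>2 = s\<^sup>2 * v"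
    using assms by (simp add: power_mult_distrib)
  finally show ?thesis by (simp add: exp_of_real[symmetric])
qed

text \<open>The characteristic function of the sum factors over the independent coordinates, and
  Levy uniqueness identifies the law. Vanishing coefficients are allowed, the law being then a point
  mass at 0.\<close>

lemma distr_linear_normal:
  fixes c :: "'i \<Rightarrow> real"
  assumes "finite I"
  shows "distr (\<Pi>\<^sub>M i\<in>I. std_normal_distribution) borel (\<lambda>x. \<Sum>i\<in>I. c i * x i) = normal_law 0 (\<Sum>i\<in>I. (c i)\<^sup>2)"
proof (rule Levy_uniqueness)
  interpret N: prob_space std_normal_distribution
    using real_dist_normal_dist by (simp add: real_distribution_def)
  interpret P: product_prob_space "\<lambda>_. std_normal_distribution" I ..
  have sets: "sets (\<Pi>\<^sub>M i\<in>I. std_normal_distribution) = sets (\<Pi>\<^sub>M i\<in>I. borel)"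
    by (rule sets_PiM_cong) auto
  have meas: "(\<lambda>x. \<Sum>i\<in>I. c i * x i) \<in> borel_measurable (\<Pi>\<^sub>M i\<in>I. std_normal_distribution)"
    unfolding measurable_cong_sets[OF sets refl] by measurable
  show "real_distribution (distr (\<Pi>\<^sub>M i\<in>I. std_normal_distribution) borel (\<lambda>x. \<Sum>i\<in>I. c i * x i))"
    by (rule P.P.real_distribution_distr[OF meas])
  show "real_distribution (normal_law 0 (\<Sum>i\<in>I. (c i)\<^sup>2))" by (rule prob_space_normal_law)
  show "char (distr (\<Pi>\<^sub>M i\<in>I. std_normal_distribution) borel (\<lambda>x. \<Sum>i\<in>I. c i * x i))
      = char (normal_law 0 (\<Sum>i\<in>I. (c i)\<^sup>2))"
  proof
    fix s
    have "char (distr (\<Pi>\<^sub>M i\<in>I. std_normal_distribution) borel (\<lambda>x. \<Sum>i\<in>I. c i * x i)) s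
        = (\<integral>x. iexp (s * (\<Sum>i\<in>I. c i * x i)) \<partial>(\<Pi>\<^sub>M i\<in>I. std_normal_distribution))"
      unfolding char_def by (rule integral_distr[OF meas]) measurable
    also have "\<dots> = (\<integral>x. (\<Prod>i\<in>I. iexp ((s * c i) * x i)) \<partial>(\<Pi>\<^sub>M i\<in>I. std_normal_distribution))"
      using assms by (simp add: exp_sum sum_distrib_left mult.assoc)
    also have "\<dots> = (\<Prod>i\<in>I. \<integral>x. iexp ((s * c i) * x) \<partial>std_normal_distribution)"
      by (rule P.product_integral_prod[OF assms]) (rule N.integrable_iexp, auto)
    also have "\<dots> = (\<Prod>i\<in>I. complex_of_real (exp (- (s * c i)\<^sup>2 / 2)))"
      by (intro prod.cong refl) (rule fun_cong[OF char_std_normal_distribution, unfolded char_def])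
    also have "\<dots> = complex_of_real (exp (\<Sum>i\<in>I. - (s * c i)\<^sup>2 / 2))"
      using assms by (simp add: exp_sum)
    also have "(\<Sum>i\<in>I. - (s * c i)\<^sup>2 / 2) = - (s\<^sup>2 * (\<Sum>i\<in>I. (c i)\<^sup>2) / 2)"
      by (simp add: power_mult_distrib sum_distrib_left sum_negf sum_divide_distrib)
    also have "complex_of_real (exp (- (s\<^sup>2 * (\<Sum>i\<in>I. (c i)\<^sup>2) / 2))) = char (normal_law 0 (\<Sum>i\<in>I. (c i)\<^sup>2)) s"
      by (subst char_normal_law) (auto intro: sum_nonneg simp: exp_of_real)
    finally show "char (distr (\<Pi>\<^sub>M i\<in>I. std_normal_distribution) borel (\<lambda>x. \<Sum>i\<in>I. c i * x i)) s
      = char (normal_law 0 (\<Sum>i\<in>I. (c i)\<^sup>2)) s" .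
  qed
qed

text \<open>For a probability vector \<open>q\<close> the right-hand side is the variance of the
  entries of \<open>t\<close> under \<open>q\<close>.\<close>

lemma multinomial_covariance_form:
  assumes "q \<in> carrier_vec N" "t \<in> carrier_vec N"
  shows "t \<bullet> ((diag q - mat N N (\<lambda>(i, j). q $ i * q $ j)) *\<^sub>v t)
    = (\<Sum>k<N. q $ k * (t $ k)\<^sup>2) - (\<Sum>k<N. q $ k * t $ k)\<^sup>2"
proof -
  define m where "m = (\<Sum>k<N. q $ k * t $ k)"
  have "((diag q - mat N N (\<lambda>(i, j). q $ i * q $ j)) *\<^sub>v t) $ k = q $ k * t $ k - q $ k * m" if k: "k < N" for k
  proof -
    have "((diag q - mat N N (\<lambda>(i, j). q $ i * q $ j)) *\<^sub>v t) $ k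
        = (\<Sum>l<N. ((if k = l then q $ l else 0) - q $ k * q $ l) * t $ l)"
      using k assms by (simp add: diag_def mat_diag_def scalar_prod_def lessThan_atLeast0)
    also have "\<dots> = (\<Sum>l<N. (if k = l then q $ l * t $ l else 0) - q $ k * (q $ l * t $ l))"
      by (intro sum.cong) (auto simp: algebra_simps)
    also have "\<dots> = q $ k * t $ k - q $ k * m"
      using k by (simp add: sum_subtractf m_def sum_distrib_left)
    finally show ?thesis .
  qed
  then have "t \<bullet> ((diag q - mat N N (\<lambda>(i, j). q $ i * q $ j)) *\<^sub>v t)
      = (\<Sum>k<N. t $ k * (q $ k * t $ k - q $ k * m))"
    by (simp add: scalar_prod_def lessThan_atLeast0 del: index_mult_mat_vec)
  also have "\<dots> = (\<Sum>k<N. q $ k * (t $ k)\<^sup>2) - m * m"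
    unfolding m_def by (simp add: algebra_simps power2_eq_square sum_subtractf sum_distrib_left)
  finally show ?thesis by (simp add: m_def power2_eq_square)
qed

text \<open>For independent standard normal \<open>x\<close>, the vector with entries
  \<open>\<surd>q\<^sub>k x\<^sub>k - q\<^sub>k \<Sum>\<^sub>l \<surd>q\<^sub>l x\<^sub>l\<close> has the multinomial covariance.\<close>

lemma multinomial_normal_exists:
  assumes q: "q \<in> carrier_vec N" "\<And>k. k < N \<Longrightarrow> 0 \<le> q $ k" "(\<Sum>k<N. q $ k) = 1"
  shows "\<exists>\<nu>. is_normal_vec N (0\<^sub>v N) (diag q - mat N N (\<lambda>(i, j). q $ i * q $ j)) \<nu>"
proof -
  define G where "G = (\<Pi>\<^sub>M i\<in>{..<N}. std_normal_distribution)"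
  interpret N: prob_space std_normal_distribution
    using real_dist_normal_dist by (simp add: real_distribution_def)
  interpret P: product_prob_space "\<lambda>_. std_normal_distribution" "{..<N}" ..
  have sets: "sets G = sets (\<Pi>\<^sub>M i\<in>{..<N}. borel)"
    unfolding G_def by (rule sets_PiM_cong) auto
  define Z where "Z = (\<lambda>x :: nat \<Rightarrow> real. vec N (\<lambda>k. sqrt (q $ k) * x k - q $ k * (\<Sum>l<N. sqrt (q $ l) * x l)))"
  have Z: "Z \<in> G \<rightarrow>\<^sub>M borel_vec N"
  proof (rule measurable_borel_vecI)
    fix k assume k: "k < N"
    have "(\<lambda>x. sqrt (q $ k) * x k - q $ k * (\<Sum>l<N. sqrt (q $ l) * x l)) \<in> borel_measurable G"
      unfolding measurable_cong_sets[OF sets refl] using k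
      by (intro borel_measurable_diff borel_measurable_times borel_measurable_const borel_measurable_sum
          measurable_component_singleton) auto
    then show "(\<lambda>x. Z x $ k) \<in> borel_measurable G" using k by (simp add: Z_def)
  qed (auto simp: Z_def)
  have law: "distr (distr G (borel_vec N) Z) borel (\<lambda>z. t \<bullet> z)
      = normal_law (t \<bullet> 0\<^sub>v N) (t \<bullet> ((diag q - mat N N (\<lambda>(i, j). q $ i * q $ j)) *\<^sub>v t))"
    if t: "t \<in> carrier_vec N" for t
  proof -
    define m where "m = (\<Sum>k<N. q $ k * t $ k)"
    \<comment> \<open>Coefficients of the linear form \<open>t \<bullet> Z x\<close>: the entries of
      \<open>t\<close> centred at their mean under \<open>q\<close> and weighted by the square root
      of \<open>q\<close>. Their squares sum to the variance of \<open>t\<close> under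
      \<open>q\<close>.\<close>
    define c where "c = (\<lambda>k. sqrt (q $ k) * (t $ k - m))"
    have "t \<bullet> Z x = (\<Sum>k<N. c k * x k)" for x
    proof -
      have "t \<bullet> Z x = (\<Sum>k<N. t $ k * (sqrt (q $ k) * x k - q $ k * (\<Sum>l<N. sqrt (q $ l) * x l)))"
        by (simp add: scalar_prod_def Z_def lessThan_atLeast0)
      also have "\<dots> = (\<Sum>k<N. t $ k * sqrt (q $ k) * x k) - (\<Sum>k<N. (q $ k * t $ k) * (\<Sum>l<N. sqrt (q $ l) * x l))"
        by (simp add: algebra_simps sum_subtractf)
      also have "(\<Sum>k<N. (q $ k * t $ k) * (\<Sum>l<N. sqrt (q $ l) * x l)) = m * (\<Sum>l<N. sqrt (q $ l) * x l)"
        by (simp only: m_def sum_distrib_right)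
      also have "(\<Sum>k<N. t $ k * sqrt (q $ k) * x k) - m * (\<Sum>l<N. sqrt (q $ l) * x l) = (\<Sum>k<N. c k * x k)"
        by (simp add: c_def algebra_simps sum_subtractf sum_distrib_left)
      finally show ?thesis .
    qed
    then have "distr (distr G (borel_vec N) Z) borel (\<lambda>z. t \<bullet> z) = distr G borel (\<lambda>x. \<Sum>k<N. c k * x k)"
      using Z measurable_scalar_prod[OF t] by (simp add: distr_distr comp_def)
    also have "\<dots> = normal_law 0 (\<Sum>k<N. (c k)\<^sup>2)"
      unfolding G_def by (rule distr_linear_normal) simp
    also have "(\<Sum>k<N. (c k)\<^sup>2) = (\<Sum>k<N. q $ k * (t $ k)\<^sup>2 - 2 * m * (q $ k * t $ k) + m\<^sup>2 * q $ k)"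
      using q(2) by (intro sum.cong) (auto simp: c_def power_mult_distrib power2_eq_square algebra_simps)
    also have "\<dots> = (\<Sum>k<N. q $ k * (t $ k)\<^sup>2) - 2 * m * m + m\<^sup>2 * 1"
      unfolding sum.distrib sum_subtractf sum_distrib_left[symmetric] q(3) m_def by simp
    also have "\<dots> = t \<bullet> ((diag q - mat N N (\<lambda>(i, j). q $ i * q $ j)) *\<^sub>v t)"
      unfolding multinomial_covariance_form[OF q(1) t] by (simp add: m_def power2_eq_square)
    finally show ?thesis using t by simp
  qed
  have "prob_space (distr G (borel_vec N) Z)"
    using P.P.prob_space_distr[of Z "borel_vec N"] Z by (simp add: G_def)
  then show ?thesis
    using law by (intro exI[of _ "distr G (borel_vec N) Z"]) (simp add: is_normal_vec_def)
qed

text \<open>Variance 0 must be included, since a projection of the multinomial vector may be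
  degenerate. There the summands vanish almost surely and the limit is a point mass, while the
  classical theorem handles positive variance.\<close>

lemma (in prob_space) clt_bounded_continuous:
  fixes Y :: "nat \<Rightarrow> 'a \<Rightarrow> real" and g :: "real \<Rightarrow> real"
  assumes indep: "indep_vars (\<lambda>_. borel) Y UNIV"
    and D: "\<And>k. distr M borel (Y k) = D"
    and mean: "\<And>k. expectation (Y k) = 0"
    and bounded: "\<And>k \<omega>. \<omega> \<in> space M \<Longrightarrow> \<bar>Y k \<omega>\<bar> \<le> C"
    and var: "\<And>k. expectation (\<lambda>\<omega>. (Y k \<omega>)\<^sup>2) = v"
    and g: "continuous_on UNIV g" "\<And>x. \<bar>g x\<bar> \<le> B"
  shows "(\<lambda>n. expectation (\<lambda>\<omega>. g ((\<Sum>k<n. Y k \<omega>) / sqrt (real n)))) \<longlonglongrightarrow> (\<integral>x. g x \<partial>normal_law 0 v)"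
proof -
  have [measurable]: "g \<in> borel_measurable borel" by (rule borel_measurable_continuous_onI[OF g(1)])
  have Y [measurable]: "Y k \<in> borel_measurable M" for k
    using indep unfolding indep_vars_def2 by simp
  have int2: "integrable M (\<lambda>\<omega>. (Y k \<omega>)\<^sup>2)" for k
  proof (rule integrable_const_bound[of _ "C\<^sup>2"])
    show "AE \<omega> in M. norm ((Y k \<omega>)\<^sup>2) \<le> C\<^sup>2"
      using bounded by (intro AE_I2) (simp add: abs_le_square_iff[symmetric] order_trans[OF bounded abs_ge_self])
  qed measurable
  have "v \<ge> 0" using var[of 0] by (metis integral_nonneg_AE AE_I2 zero_le_power2)
  show ?thesis
  proof (cases "v = 0")
    case True
    have "AE \<omega> in M. Y k \<omega> = 0" for k
      using integral_nonneg_eq_0_iff_AE[OF int2[of k]] var[of k] True by simp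
    then have "AE \<omega> in M. \<forall>k. Y k \<omega> = 0" by (simp add: AE_all_countable)
    then have "expectation (\<lambda>\<omega>. g ((\<Sum>k<n. Y k \<omega>) / sqrt (real n))) = expectation (\<lambda>\<omega>. g 0)" for n
      by (intro integral_cong_AE) (measurable, auto)
    moreover have "(\<integral>x. g x \<partial>normal_law 0 v) = g 0"
    proof -
      interpret N: prob_space std_normal_distribution
        using real_dist_normal_dist by (simp add: real_distribution_def)
      have "N.prob UNIV = 1" using N.prob_space by simp
      then show ?thesis using True by (simp add: integral_normal_law)
    qed
    ultimately show ?thesis by (simp add: prob_space)
  next
    case False
    define \<sigma> where "\<sigma> = sqrt v"
    have \<sigma>: "\<sigma> > 0" "\<sigma>\<^sup>2 = v" using False \<open>v \<ge> 0\<close> by (auto simp: \<sigma>_def)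
    define T where "T = (\<lambda>n \<omega>. (\<Sum>k<n. Y k \<omega>) / sqrt (real n * \<sigma>\<^sup>2))"
    have [measurable]: "T n \<in> borel_measurable M" for n unfolding T_def by measurable
    have "weak_conv_m (\<lambda>n. distr M borel (T n)) std_normal_distribution"
      unfolding T_def
      by (rule central_limit_theorem_zero_mean[OF indep mean \<sigma>(1) int2 _ D]) (simp add: mean var \<sigma>)
    \<comment> \<open>The central limit theorem normalises to unit variance; the scale is moved into
      the test function.\<close>
    moreover have "continuous_on UNIV (\<lambda>x. g (\<sigma> * x))"
      by (intro continuous_on_compose2[OF g(1)] continuous_intros) auto
    then have "isCont (\<lambda>x. g (\<sigma> * x)) x" for x
      by (simp add: continuous_on_eq_continuous_at)
    ultimately have "(\<lambda>n. \<integral>x. g (\<sigma> * x) \<partial>distr M borel (T n)) \<longlonglongrightarrow> (\<integral>x. g (\<sigma> * x) \<partial>std_normal_distribution)"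
      using g(2)
      by (intro weak_conv_imp_integral_bdd_continuous_conv[where B = B] real_distribution_distr real_dist_normal_dist)
        simp_all
    moreover have "\<sigma> * T n \<omega> = (\<Sum>k<n. Y k \<omega>) / sqrt (real n)" for n \<omega>
      using \<sigma>(1) by (simp add: T_def real_sqrt_mult)
    ultimately show ?thesis
      by (simp add: integral_distr integral_normal_law \<sigma>_def)
  qed
qed

section \<open>Consistency\<close>

lemma Yule_kappa_pos: "2 \<le> r1 \<Longrightarrow> 2 \<le> r2 \<Longrightarrow> 0 < Yule_kappa r1 r2"
  unfolding Yule_kappa_def by (auto intro!: divide_pos_pos mult_pos_pos)

text \<open>Yule's coefficient is affine: the additive constant cancels and a linear functional with
  the Kronecker weights remains.\<close>

lemma Yule_diff:
  assumes "a \<in> carrier_mat r1 r2" "b \<in> carrier_mat r1 r2" "supp a \<subseteq> S" "supp b \<subseteq> S"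
    "S \<subseteq> {..<r1} \<times> {..<r2}"
  shows "Yule r1 r2 b - Yule r1 r2 a
    = Yule_kappa r1 r2 * (\<Sum>s\<in>S. Yule_weights r1 r2 $ phi r1 s * (b $$ s - a $$ s))"
proof -
  have k: "12 / sqrt ((real r1 + 1) * (real r1 - 1) * (real r2 + 1) * (real r2 - 1)) = Yule_kappa r1 r2"
    by (simp add: Yule_kappa_def mult_ac)
  have "(\<Sum>i<r1. \<Sum>j<r2. real (i + 1) * real (j + 1) * b $$ (i, j))
      - (\<Sum>i<r1. \<Sum>j<r2. real (i + 1) * real (j + 1) * a $$ (i, j))
    = (\<Sum>i<r1. \<Sum>j<r2. Yule_weights r1 r2 $ phi r1 (i, j) * (b $$ (i, j) - a $$ (i, j)))"
    unfolding sum_subtractf[symmetric]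
    by (intro sum.cong refl) (simp add: Yule_weights_phi right_diff_distrib)
  also have "\<dots> = (\<Sum>s\<in>S. Yule_weights r1 r2 $ phi r1 s * (b $$ s - a $$ s))"
    using supp_subsetD[OF assms(1,3)] supp_subsetD[OF assms(2,4)]
    by (intro sum_array_eq_sum[OF assms(5)]) auto
  finally show ?thesis
    unfolding Yule_def k by (simp add: right_diff_distrib[symmetric])
qed

lemma prob_arraysI:
  assumes "a \<in> carrier_mat r1 r2" "S \<subseteq> {..<r1} \<times> {..<r2}"
    and pos: "\<And>s. s \<in> S \<Longrightarrow> 0 < a $$ s"
    and zero: "\<And>s. s \<in> {..<r1} \<times> {..<r2} \<Longrightarrow> s \<notin> S \<Longrightarrow> a $$ s = 0"
    and sum: "(\<Sum>s\<in>S. a $$ s) = 1"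
    and rows: "\<And>i. i < r1 \<Longrightarrow> \<exists>j. (i, j) \<in> S" and cols: "\<And>j. j < r2 \<Longrightarrow> \<exists>i. (i, j) \<in> S"
  shows "a \<in> prob_arrays r1 r2" "supp a = S"
proof -
  have fin: "finite S" using assms(2) finite_subset by blast
  have nonneg: "0 \<le> a $$ (i, j)" if "i < r1" "j < r2" for i j
    using pos[of "(i, j)"] zero[of "(i, j)"] that by (cases "(i, j) \<in> S") auto
  have le1: "a $$ (i, j) \<le> 1" if "i < r1" "j < r2" for i j
  proof (cases "(i, j) \<in> S")
    case True
    then have "a $$ (i, j) \<le> (\<Sum>s\<in>S. a $$ s)"
      using fin pos by (intro member_le_sum) (auto intro: less_imp_le)
    then show ?thesis using sum by simp
  next
    case False
    then show ?thesis using zero[of "(i, j)"] that by auto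
  qed
  have total: "(\<Sum>i<r1. \<Sum>j<r2. a $$ (i, j)) = 1"
    using sum_array_eq_sum[OF assms(2), of "\<lambda>s. a $$ s"] zero sum by auto
  have "row_margin a i > 0" if i: "i < r1" for i
  proof -
    obtain j where j: "(i, j) \<in> S" using rows[OF i] by auto
    then have "j < r2" using assms(2) by auto
    have "0 < a $$ (i, j)" using pos[OF j] .
    also have "\<dots> \<le> (\<Sum>j<r2. a $$ (i, j))"
      using \<open>j < r2\<close> nonneg[OF i] by (intro member_le_sum) auto
    finally show ?thesis using assms(1) by (simp add: row_margin_def)
  qed
  moreover have "col_margin a j > 0" if j: "j < r2" for j
  proof -
    obtain i where i: "(i, j) \<in> S" using cols[OF j] by auto
    then have "i < r1" using assms(2) by auto
    have "0 < a $$ (i, j)" using pos[OF i] .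
    also have "\<dots> \<le> (\<Sum>i<r1. a $$ (i, j))"
      using \<open>i < r1\<close> nonneg[OF _ j] by (intro member_le_sum) auto
    finally show ?thesis using assms(1) by (simp add: col_margin_def)
  qed
  ultimately show "a \<in> prob_arrays r1 r2"
    using assms(1) nonneg le1 total by (auto simp: prob_arrays_def)
  have "(i, j) \<in> supp a \<longleftrightarrow> (i, j) \<in> S" for i j
    using assms(1,2) pos[of "(i, j)"] zero[of "(i, j)"] by (auto simp: supp_def)
  then show "supp a = S" by auto
qed

lemma supp_meets_margins:
  assumes "p \<in> prob_arrays r1 r2"
  shows "i < r1 \<Longrightarrow> \<exists>j. (i, j) \<in> supp p" "j < r2 \<Longrightarrow> \<exists>i. (i, j) \<in> supp p"
proof -
  have c: "dim_row p = r1" "dim_col p = r2" using assms by (auto simp: prob_arrays_def)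
  show "\<exists>j. (i, j) \<in> supp p" if "i < r1"
  proof (rule ccontr)
    assume "\<not> ?thesis"
    then have "row_margin p i = 0" using c that by (auto simp: row_margin_def supp_def)
    then show False using assms that by (auto simp: prob_arrays_def)
  qed
  show "\<exists>i. (i, j) \<in> supp p" if "j < r2"
  proof (rule ccontr)
    assume "\<not> ?thesis"
    then have "col_margin p j = 0" using c that by (auto simp: col_margin_def supp_def)
    then show False using assms that by (auto simp: prob_arrays_def)
  qed
qed

section \<open>The sample and the smoothed empirical array\<close>

locale grid_sample =
  fixes r1 r2 :: nat
    and x1 x2 :: "nat \<Rightarrow> real"
    and P :: "(real \<times> real) measure"
    and M :: "'w measure"
    and X :: "nat \<Rightarrow> 'w \<Rightarrow> real \<times> real"
    and p :: "real mat"
  assumes r1: "2 \<le> r1" and r2: "2 \<le> r2"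
    and x1: "strict_mono_on {..<r1} x1" and x2: "strict_mono_on {..<r2} x2"
    and P_prob: "prob_space P" and P_sets: "sets P = sets borel"
    and p: "p = prob_array r1 r2 x1 x2 P" and p_in: "p \<in> prob_arrays r1 r2"
    and Gamma_ne: "Gamma_supp r1 r2 (supp p) \<noteq> {}"
    and M: "prob_space M"
    and X_meas: "\<And>k. 1 \<le> k \<Longrightarrow> X k \<in> borel_measurable M"
    and X_distr: "\<And>k. 1 \<le> k \<Longrightarrow> distr M borel (X k) = P"
begin

sublocale M: prob_space M by (rule M)

abbreviation grid :: "(nat \<times> nat) set" where "grid \<equiv> {..<r1} \<times> {..<r2}"
abbreviation S :: "(nat \<times> nat) set" where "S \<equiv> supp p"
abbreviation phat :: "nat \<Rightarrow> 'w \<Rightarrow> real mat" where "phat \<equiv> smooth_emp_array r1 r2 x1 x2 S X"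
abbreviation Yhat :: "nat \<Rightarrow> 'w \<Rightarrow> real" where "Yhat n \<omega> \<equiv> Yule r1 r2 (I_proj (phat n \<omega>))"

definition pt :: "nat \<times> nat \<Rightarrow> real \<times> real" where "pt s = (x1 (fst s), x2 (snd s))"

definition emp_count :: "nat \<Rightarrow> 'w \<Rightarrow> nat \<times> nat \<Rightarrow> real" where
  "emp_count n \<omega> s = (\<Sum>k=1..n. indicator {pt s} (X k \<omega>))"

text \<open>All pathwise arguments are made on this one event, which does not depend on the sample
  size.\<close>

definition good :: "'w \<Rightarrow> bool" where "good \<omega> \<longleftrightarrow> (\<forall>k\<ge>1. X k \<omega> \<in> pt ` S)"

lemma r_pos: "0 < r1" "0 < r2" using r1 r2 by auto

lemma p_carrier: "p \<in> carrier_mat r1 r2" using p_in by (simp add: prob_arrays_def)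

lemma S_grid: "S \<subseteq> grid" by (rule supp_subset[OF p_carrier])

lemma p_eq: "s \<in> grid \<Longrightarrow> p $$ s = measure P {pt s}"
  by (cases s) (auto simp: p prob_array_def pt_def)

lemma p_outside: "s \<in> grid \<Longrightarrow> s \<notin> S \<Longrightarrow> p $$ s = 0"
  using supp_subsetD[OF p_carrier order_refl] .

lemma p_pos: "s \<in> S \<Longrightarrow> 0 < p $$ s"
  by (rule prob_arrays_pos[OF p_in])

lemma sum_p: "(\<Sum>s\<in>S. p $$ s) = 1"
  using sum_array_eq_sum[OF S_grid, of "\<lambda>s. p $$ s"] p_outside p_in by (auto simp: prob_arrays_def)

lemma inj_pt: "inj_on pt grid"
  using strict_mono_on_imp_inj_on[OF x1] strict_mono_on_imp_inj_on[OF x2]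
  by (auto simp: inj_on_def pt_def)

lemma card_S: "0 < card S"
  using sum_p by (cases "S = {}") (auto simp: card_gt_0_iff)

text \<open>The entries of \<open>p\<close> on its support sum to 1, so \<open>P\<close> is
  concentrated on the corresponding points. The exceptional sets of the countably many observations
  are discarded together.\<close>

lemma AE_good: "AE \<omega> in M. good \<omega>"
proof -
  interpret P: prob_space P by (rule P_prob)
  have "measure P (pt ` S) = (\<Sum>x\<in>pt ` S. measure P {x})"
    by (rule P.finite_measure_eq_sum_singleton) (auto simp: P_sets)
  also have "\<dots> = (\<Sum>s\<in>S. measure P {pt s})"
    using inj_on_subset[OF inj_pt S_grid] by (simp add: sum.reindex)
  also have "\<dots> = (\<Sum>s\<in>S. p $$ s)" using p_eq S_grid by (intro sum.cong) auto
  finally have "AE x in P. x \<in> pt ` S" using sum_p by (intro P.AE_prob_1) simp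
  then have "AE \<omega> in M. X k \<omega> \<in> pt ` S" if "1 \<le> k" for k
    unfolding X_distr[OF that, symmetric] using AE_distrD[OF X_meas[OF that]] by blast
  then have "AE \<omega> in M. 1 \<le> k \<longrightarrow> X k \<omega> \<in> pt ` S" for k by (cases "1 \<le> k") auto
  then show ?thesis unfolding good_def by (simp add: AE_all_countable)
qed

lemma phat_carrier [simp]: "phat n \<omega> \<in> carrier_mat r1 r2"
  by (simp add: smooth_emp_array_def emp_array_def unif_array_def)

lemma phat_index:
  assumes "s \<in> grid"
  shows "phat n \<omega> $$ s = (emp_count n \<omega> s + indicator S s / real (card S)) / (real n + 1)"
  using assms
  \<comment> \<open>For \<open>n > 0\<close> the weight n / (n + 1) cancels the factor 1 / n; for
    \<open>n = 0\<close> only the uniform array is left.\<close>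
  by (cases "n = 0"; cases s)
    (auto simp: smooth_emp_array_def emp_array_def unif_array_def emp_count_def pt_def add_divide_distrib)

lemma emp_count_zero:
  assumes "good \<omega>" "s \<in> grid" "s \<notin> S"
  shows "emp_count n \<omega> s = 0"
proof -
  have "X k \<omega> \<noteq> pt s" if k: "1 \<le> k" for k
  proof
    assume eq: "X k \<omega> = pt s"
    have "pt s \<in> pt ` S" using assms(1) k unfolding good_def eq[symmetric] by blast
    then obtain s' where "s' \<in> S" "pt s = pt s'" by blast
    then have "s = s'" using inj_onD[OF inj_pt, of s s'] assms(2) S_grid by auto
    then show False using \<open>s' \<in> S\<close> assms(3) by simp
  qed
  then show ?thesis by (auto simp: emp_count_def intro!: sum.neutral)
qed

lemma sum_indicator_pt:
  assumes "x \<in> pt ` S"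
  shows "(\<Sum>s\<in>S. indicator {pt s} x) = (1 :: real)"
proof -
  obtain s' where s': "s' \<in> S" "x = pt s'" using assms by auto
  have "(\<Sum>s\<in>S. indicator {pt s} x) = (\<Sum>s\<in>S. if s' = s then 1 else 0 :: real)"
    using inj_on_subset[OF inj_pt S_grid] s' by (intro sum.cong) (auto simp: indicator_def inj_on_def)
  then show ?thesis using s' by simp
qed

text \<open>The uniform term makes even unobserved cells of \<open>S\<close> positive, and on
  \<open>good\<close> nothing is observed elsewhere. The support is therefore \<open>S\<close> for
  every \<open>n\<close>, which the stability estimates for the projection require.\<close>

lemma phat_good:
  assumes "good \<omega>"
  shows "phat n \<omega> \<in> prob_arrays r1 r2" "supp (phat n \<omega>) = S"
proof -
  have pos: "0 < phat n \<omega> $$ s" if "s \<in> S" for s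
  proof -
    have "0 \<le> emp_count n \<omega> s" by (auto simp: emp_count_def intro!: sum_nonneg)
    moreover have "s \<in> grid" using that S_grid by auto
    ultimately show ?thesis using that card_S
      by (simp only: phat_index) (auto intro!: divide_pos_pos add_nonneg_pos)
  qed
  have zero: "phat n \<omega> $$ s = 0" if "s \<in> grid" "s \<notin> S" for s
    using phat_index[OF that(1)] emp_count_zero[OF assms that] that by simp
  have "(\<Sum>s\<in>S. emp_count n \<omega> s) = (\<Sum>k=1..n. \<Sum>s\<in>S. indicator {pt s} (X k \<omega>))"
    unfolding emp_count_def by (rule sum.swap)
  also have "\<dots> = (\<Sum>k=1..n. 1)"
    using assms by (intro sum.cong refl sum_indicator_pt) (auto simp: good_def)
  finally have count: "(\<Sum>s\<in>S. emp_count n \<omega> s) = real n" by simp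
  have "(\<Sum>s\<in>S. phat n \<omega> $$ s) = (\<Sum>s\<in>S. (emp_count n \<omega> s + 1 / real (card S)) / (real n + 1))"
    using S_grid by (intro sum.cong refl) (subst phat_index, auto)
  also have "\<dots> = ((\<Sum>s\<in>S. emp_count n \<omega> s) + (\<Sum>s\<in>S. 1 / real (card S))) / (real n + 1)"
    by (simp only: sum_divide_distrib[symmetric] sum.distrib)
  also have "\<dots> = 1" using count card_S by (simp add: card_gt_0_iff)
  finally have sum: "(\<Sum>s\<in>S. phat n \<omega> $$ s) = 1" .
  show "phat n \<omega> \<in> prob_arrays r1 r2" "supp (phat n \<omega>) = S"
    using prob_arraysI[OF phat_carrier S_grid pos zero sum] supp_meets_margins[OF p_in] by auto
qed

text \<open>\<open>phat n\<close> is a function of finitely many events, so no measurability of the projection is needed.\<close>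

lemma measurable_phat:
  assumes "\<And>\<omega>. \<omega> \<in> space M \<Longrightarrow> F (phat n \<omega>) \<in> space K"
  shows "(\<lambda>\<omega>. F (phat n \<omega>)) \<in> M \<rightarrow>\<^sub>M K"
proof (rule measurable_of_finitely_many_events[where I = "{1..n} \<times> grid" and Q = "\<lambda>(k, s) \<omega>. X k \<omega> = pt s"])
  show "finite ({1..n} \<times> grid)" by simp
  show "{\<omega> \<in> space M. (case i of (k, s) \<Rightarrow> \<lambda>\<omega>. X k \<omega> = pt s) \<omega>} \<in> sets M" if "i \<in> {1..n} \<times> grid" for i
  proof -
    obtain k s where i: "i = (k, s)" "1 \<le> k" using \<open>i \<in> {1..n} \<times> grid\<close> by (cases i) auto
    have "X k -` {pt s} \<inter> space M \<in> sets M"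
      using X_meas[OF i(2)] by (intro measurable_sets) auto
    moreover have "X k -` {pt s} \<inter> space M = {\<omega> \<in> space M. X k \<omega> = pt s}" by auto
    ultimately show ?thesis using i by simp
  qed
  show "(\<lambda>\<omega>. F (phat n \<omega>)) \<in> space M \<rightarrow> space K" using assms by auto
  fix \<omega> \<omega>'
  assume eq: "\<And>i. i \<in> {1..n} \<times> grid \<Longrightarrow>
    (case i of (k, s) \<Rightarrow> \<lambda>\<omega>. X k \<omega> = pt s) \<omega> = (case i of (k, s) \<Rightarrow> \<lambda>\<omega>. X k \<omega> = pt s) \<omega>'"
  have "emp_count n \<omega> s = emp_count n \<omega>' s" if "s \<in> grid" for s
    unfolding emp_count_def using eq that by (intro sum.cong refl) (fastforce simp: indicator_def)
  then have "phat n \<omega> = phat n \<omega>'"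
    using phat_index carrier_matD[OF phat_carrier[of n \<omega>]] carrier_matD[OF phat_carrier[of n \<omega>']]
    by (intro eq_matI) (simp_all del: phat_carrier)
  then show "F (phat n \<omega>) = F (phat n \<omega>')" by simp
qed

lemma I_proj_q:
  assumes "q \<in> prob_arrays r1 r2" "supp q = S"
  shows "I_proj q \<in> Gamma_unif r1 r2" "supp (I_proj q) = S"
proof -
  obtain \<gamma>1 where g: "\<gamma>1 \<in> Gamma_supp r1 r2 S" using Gamma_ne by auto
  then have g': "\<gamma>1 \<in> Gamma_unif r1 r2" "supp \<gamma>1 \<subseteq> supp q" using assms by (auto simp: Gamma_supp_def)
  show "I_proj q \<in> Gamma_unif r1 r2" by (rule I_proj_minimises(1)[OF r_pos assms(1) g'])
  show "supp (I_proj q) = S" using supp_I_proj[OF r_pos assms(1)] g assms(2) by simp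
qed

lemma Yule_diff_q:
  assumes "q \<in> prob_arrays r1 r2" "supp q = S"
  shows "Yule r1 r2 (I_proj q) - Yule r1 r2 (I_proj p)
    = Yule_kappa r1 r2 * (\<Sum>s\<in>S. Yule_weights r1 r2 $ phi r1 s * (I_proj q $$ s - I_proj p $$ s))"
  using I_proj_q[OF assms] I_proj_q[OF p_in refl] S_grid
  by (intro Yule_diff) (auto dest: Gamma_unifD(1))

lemma l1_dist_le_mat_dist: "l1_dist S q p \<le> real (card S) * mat_dist q p"
proof -
  have "\<bar>q $$ s - p $$ s\<bar> \<le> mat_dist q p" if "s \<in> S" for s
  proof -
    have s: "s \<in> grid" using that S_grid by auto
    have "\<bar>q $$ s - p $$ s\<bar> = sqrt ((q $$ s - p $$ s)\<^sup>2)" by simp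
    also have "\<dots> \<le> sqrt (\<Sum>s\<in>grid. (q $$ s - p $$ s)\<^sup>2)"
      using s by (intro real_sqrt_le_mono member_le_sum) auto
    also have "\<dots> = mat_dist q p"
      using p_carrier by (simp add: mat_dist_def sum.cartesian_product)
    finally show ?thesis .
  qed
  then show ?thesis unfolding l1_dist_def by (intro sum_bounded_above) auto
qed

section \<open>Continuity along arrays of fixed support, and consistency\<close>

lemma Yule_continuous:
  assumes "0 < \<epsilon>"
  obtains \<delta> where "0 < \<delta>"
    "\<And>q. q \<in> prob_arrays r1 r2 \<Longrightarrow> supp q = S \<Longrightarrow> mat_dist q p < \<delta> \<Longrightarrow>
      \<bar>Yule r1 r2 (I_proj q) - Yule r1 r2 (I_proj p)\<bar> < \<epsilon>"
proof -
  obtain \<gamma>1 where g: "\<gamma>1 \<in> Gamma_supp r1 r2 S" using Gamma_ne by auto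
  obtain C \<eta> where C: "0 \<le> C" "0 < \<eta>"
    "\<And>q s. q \<in> prob_arrays r1 r2 \<Longrightarrow> supp q = S \<Longrightarrow> l1_dist S q p < \<eta> \<Longrightarrow> s \<in> S
      \<Longrightarrow> \<bar>I_proj q $$ s - I_proj p $$ s\<bar> \<le> C * l1_dist S q p"
    using I_proj_locally_lipschitz[OF r_pos p_in g] by blast
  define W where "W = (\<Sum>s\<in>S. \<bar>Yule_weights r1 r2 $ phi r1 s\<bar>)"
  define \<kappa> where "\<kappa> = Yule_kappa r1 r2"
  have \<kappa>: "0 < \<kappa>" using Yule_kappa_pos r1 r2 by (simp add: \<kappa>_def)
  have W: "0 \<le> W" by (simp add: W_def sum_nonneg)
  define D where "D = \<kappa> * W * C * card S + 1"
  have D: "0 < D" using \<kappa> W C(1) by (simp add: D_def add_nonneg_pos)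
  \<comment> \<open>The first bound brings \<open>q\<close> into the radius of the local Lipschitz
    estimate, the second makes that estimate smaller than \<epsilon>. The 1 added in
    \<open>D\<close> allows the division when the Lipschitz constant is 0.\<close>
  define \<delta> where "\<delta> = min (\<eta> / card S) (\<epsilon> / D)"
  have "0 < \<delta>" using C(2) card_S assms D by (simp add: \<delta>_def)
  moreover have "\<bar>Yule r1 r2 (I_proj q) - Yule r1 r2 (I_proj p)\<bar> < \<epsilon>"
    if q: "q \<in> prob_arrays r1 r2" "supp q = S" "mat_dist q p < \<delta>" for q
  proof -
    have md: "0 \<le> mat_dist q p" by (simp add: mat_dist_def sum_nonneg)
    have "card S * mat_dist q p < \<eta>" using q(3) card_S by (simp add: \<delta>_def field_simps)
    then have l: "l1_dist S q p < \<eta>" using l1_dist_le_mat_dist[of q] by simp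
    have "\<bar>\<Sum>s\<in>S. Yule_weights r1 r2 $ phi r1 s * (I_proj q $$ s - I_proj p $$ s)\<bar>
      \<le> (\<Sum>s\<in>S. \<bar>Yule_weights r1 r2 $ phi r1 s * (I_proj q $$ s - I_proj p $$ s)\<bar>)"
      by (rule sum_abs)
    also have "\<dots> \<le> (\<Sum>s\<in>S. \<bar>Yule_weights r1 r2 $ phi r1 s\<bar> * (C * (card S * mat_dist q p)))"
    proof (rule sum_mono)
      fix s assume "s \<in> S"
      then have "\<bar>I_proj q $$ s - I_proj p $$ s\<bar> \<le> C * l1_dist S q p" using C(3) q l by blast
      also have "\<dots> \<le> C * (card S * mat_dist q p)"
        using l1_dist_le_mat_dist C(1) by (intro mult_left_mono)
      finally show "\<bar>Yule_weights r1 r2 $ phi r1 s * (I_proj q $$ s - I_proj p $$ s)\<bar>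
        \<le> \<bar>Yule_weights r1 r2 $ phi r1 s\<bar> * (C * (card S * mat_dist q p))"
        unfolding abs_mult by (intro mult_left_mono) auto
    qed
    also have "\<dots> = W * (C * (card S * mat_dist q p))" by (simp only: W_def sum_distrib_right)
    finally have "\<bar>Yule r1 r2 (I_proj q) - Yule r1 r2 (I_proj p)\<bar> \<le> \<kappa> * (W * (C * (card S * mat_dist q p)))"
      using \<kappa> by (simp add: Yule_diff_q[OF q(1,2)] abs_mult \<kappa>_def)
    also have "\<dots> \<le> D * mat_dist q p" using md by (simp add: D_def algebra_simps)
    also have "\<dots> < \<epsilon>" using q(3) D by (simp add: \<delta>_def field_simps)
    finally show ?thesis .
  qed
  ultimately show thesis using that by blast
qed

lemma Yhat_conv_in_prob:
  assumes "conv_in_prob M mat_dist phat p"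
  shows "conv_in_prob M dist Yhat (Yule r1 r2 (I_proj p))"
  unfolding conv_in_prob_def
proof (intro allI impI)
  fix \<epsilon> :: real assume "0 < \<epsilon>"
  then obtain \<delta> where \<delta>: "0 < \<delta>"
    "\<And>q. q \<in> prob_arrays r1 r2 \<Longrightarrow> supp q = S \<Longrightarrow> mat_dist q p < \<delta> \<Longrightarrow>
      \<bar>Yule r1 r2 (I_proj q) - Yule r1 r2 (I_proj p)\<bar> < \<epsilon>"
    using Yule_continuous by blast
  have [measurable]: "(\<lambda>\<omega>. mat_dist (phat n \<omega>) p) \<in> borel_measurable M" for n
    by (rule measurable_phat) simp
  \<comment> \<open>\<open>conv_in_prob\<close> speaks of strict exceedance, whereas failure of
    \<open>mat_dist < \<delta>\<close> includes equality; halving \<delta> covers it.\<close>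
  have lim: "(\<lambda>n. measure M {\<omega> \<in> space M. mat_dist (phat n \<omega>) p > \<delta> / 2}) \<longlonglongrightarrow> 0"
    using assms \<delta>(1) unfolding conv_in_prob_def by (meson half_gt_zero)
  have le: "measure M {\<omega> \<in> space M. dist (Yhat n \<omega>) (Yule r1 r2 (I_proj p)) > \<epsilon>}
      \<le> measure M {\<omega> \<in> space M. mat_dist (phat n \<omega>) p > \<delta> / 2}" for n
  proof (rule M.finite_measure_mono_AE)
    show "AE \<omega> in M. \<omega> \<in> {\<omega> \<in> space M. dist (Yhat n \<omega>) (Yule r1 r2 (I_proj p)) > \<epsilon>}
        \<longrightarrow> \<omega> \<in> {\<omega> \<in> space M. mat_dist (phat n \<omega>) p > \<delta> / 2}"
      using AE_good
    proof eventually_elim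
      case (elim \<omega>)
      show ?case
        using \<delta>(2)[OF phat_good[OF elim, of n]] \<delta>(1) by (force simp: dist_real_def)
    qed
  qed measurable
  show "(\<lambda>n. measure M {\<omega> \<in> space M. dist (Yhat n \<omega>) (Yule r1 r2 (I_proj p)) > \<epsilon>}) \<longlonglongrightarrow> 0"
    by (rule tendsto_sandwich[OF _ _ tendsto_const lim]) (use le in auto)
qed

lemma Yhat_conv_as:
  assumes "conv_as M mat_dist phat p"
  shows "conv_as M dist Yhat (Yule r1 r2 (I_proj p))"
  using AE_good assms unfolding conv_as_def
proof eventually_elim
  case (elim \<omega>)
  show ?case
    unfolding tendsto_iff
  proof (intro allI impI)
    fix \<epsilon> :: real assume "0 < \<epsilon>"
    then obtain \<delta> where \<delta>: "0 < \<delta>"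
      "\<And>q. q \<in> prob_arrays r1 r2 \<Longrightarrow> supp q = S \<Longrightarrow> mat_dist q p < \<delta> \<Longrightarrow>
        \<bar>Yule r1 r2 (I_proj q) - Yule r1 r2 (I_proj p)\<bar> < \<epsilon>"
      using Yule_continuous by blast
    have "\<forall>\<^sub>F n in sequentially. mat_dist (phat n \<omega>) p < \<delta>"
      using elim(2) \<delta>(1) by (rule order_tendstoD(2))
    then show "\<forall>\<^sub>F n in sequentially. dist (dist (Yhat n \<omega>) (Yule r1 r2 (I_proj p))) 0 < \<epsilon>"
    proof eventually_elim
      case (elim n)
      then show ?case using \<delta>(2)[OF phat_good[OF \<open>good \<omega>\<close>, of n]] by (simp add: dist_real_def)
    qed
  qed
qed

end

section \<open>Asymptotic normality\<close>

context grid_sample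
begin

section \<open>Scaled error and delta method\<close>

abbreviation pv :: "real vec" where "pv \<equiv> vectorise p"

definition scaled_error :: "real \<Rightarrow> nat \<Rightarrow> 'w \<Rightarrow> real vec" where
  "scaled_error c n \<omega> = c \<cdot>\<^sub>v (vectorise (phat n \<omega>) - pv)"

text \<open>When \<open>u\<close> is the representer of Yule's weights, this is the transposed row
  vector \<kappa> w^T J: the derivative of the coefficient with respect to the array, extended by 0
  off the support.\<close>

definition tangent_vec :: "real mat \<Rightarrow> real vec" where
  "tangent_vec u = vectorise (mat r1 r2 (\<lambda>s. if s \<in> S then Yule_kappa r1 r2 * u $$ s / p $$ s else 0))"

lemma scaled_error_carrier: "scaled_error c n \<omega> \<in> carrier_vec (r1 * r2)"
  using p_carrier by (simp add: scaled_error_def)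

lemma measurable_scaled_error: "scaled_error c n \<in> M \<rightarrow>\<^sub>M borel_vec (r1 * r2)"
proof -
  have "(\<lambda>\<omega>. (\<lambda>a. c \<cdot>\<^sub>v (vectorise a - pv)) (phat n \<omega>)) \<in> M \<rightarrow>\<^sub>M borel_vec (r1 * r2)"
    by (rule measurable_phat) (use p_carrier in simp)
  then show ?thesis by (simp add: scaled_error_def[abs_def])
qed

lemma scaled_error_phi:
  assumes "s \<in> grid"
  shows "scaled_error c n \<omega> $ phi r1 s = c * (phat n \<omega> $$ s - p $$ s)"
proof -
  have "pv \<in> carrier_vec (r1 * r2)" "vectorise (phat n \<omega>) \<in> carrier_vec (r1 * r2)"
    using p_carrier by auto
  then have "scaled_error c n \<omega> $ phi r1 s = c * (vectorise (phat n \<omega>) $ phi r1 s - pv $ phi r1 s)"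
    using phi_less[OF assms] unfolding scaled_error_def by auto
  then show ?thesis
    by (simp only: vectorise_phi[OF phat_carrier assms] vectorise_phi[OF p_carrier assms])
qed

lemma scalar_prod_grid:
  assumes "z \<in> carrier_vec (r1 * r2)"
  shows "t \<bullet> z = (\<Sum>s\<in>grid. t $ phi r1 s * z $ phi r1 s)"
proof -
  have "t \<bullet> z = (\<Sum>k<r1 * r2. t $ k * z $ k)"
    using assms by (simp add: scalar_prod_def lessThan_atLeast0)
  then show ?thesis using sum_phi[of "\<lambda>k. t $ k * z $ k" r1 r2] by simp
qed

lemma tangent_vec_carrier: "tangent_vec u \<in> carrier_vec (r1 * r2)"
  by (simp add: tangent_vec_def)

lemma tangent_vec_phi:
  "s \<in> grid \<Longrightarrow> tangent_vec u $ phi r1 s = (if s \<in> S then Yule_kappa r1 r2 * u $$ s / p $$ s else 0)"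
  unfolding tangent_vec_def by (subst vectorise_phi[of _ r1 r2]) auto

lemma sum_tangent_vec:
  "(\<Sum>s\<in>grid. tangent_vec u $ phi r1 s * f s) = Yule_kappa r1 r2 * (\<Sum>s\<in>S. u $$ s * f s / p $$ s)"
proof -
  have "(\<Sum>s\<in>grid. tangent_vec u $ phi r1 s * f s) = (\<Sum>s\<in>S. tangent_vec u $ phi r1 s * f s)"
    using S_grid by (intro sum.mono_neutral_right) (auto simp: tangent_vec_phi)
  also have "\<dots> = (\<Sum>s\<in>S. Yule_kappa r1 r2 * (u $$ s * f s / p $$ s))"
    using S_grid by (intro sum.cong refl) (subst tangent_vec_phi, auto)
  finally show ?thesis by (simp add: sum_distrib_left)
qed

lemma tangent_vec_prod:
  "z \<in> carrier_vec (r1 * r2) \<Longrightarrow>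
    tangent_vec u \<bullet> z = Yule_kappa r1 r2 * (\<Sum>s\<in>S. u $$ s * z $ phi r1 s / p $$ s)"
  by (simp only: scalar_prod_grid sum_tangent_vec)

text \<open>If the scaled error is at most \<open>K\<close> in l1 norm, the sample array is within
  \<open>K / \<rho> n\<close> of \<open>p\<close>. The remainder of the derivative is small relative
  to that distance, so it stays small after multiplication by the rate. This is exactly the
  closeness asked for by \<open>weak_conv_linearised\<close>.\<close>

lemma delta_method:
  assumes u: "u \<in> Delta0 r1 r2 S"
    and rep: "\<And>d. d \<in> Delta0 r1 r2 S \<Longrightarrow>
      (\<Sum>s\<in>S. Yule_weights r1 r2 $ phi r1 s * d $$ s) = (\<Sum>s\<in>S. u $$ s * d $$ s / I_proj p $$ s)"
    and \<rho>: "filterlim \<rho> at_top sequentially"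
    and \<mu>: "prob_space \<mu>" "sets \<mu> = sets (borel_vec (r1 * r2))"
    and conv: "weak_conv_vec (r1 * r2) (\<lambda>n. distr M (borel_vec (r1 * r2)) (scaled_error (\<rho> n) n)) \<mu>"
  shows "weak_conv_m (\<lambda>n. distr M borel (\<lambda>\<omega>. \<rho> n * (Yhat n \<omega> - Yule r1 r2 (I_proj p))))
    (distr \<mu> borel (\<lambda>z. tangent_vec u \<bullet> z))"
proof (rule weak_conv_linearised[OF M measurable_scaled_error \<mu> conv _ tangent_vec_carrier])
  show "(\<lambda>\<omega>. \<rho> n * (Yhat n \<omega> - Yule r1 r2 (I_proj p))) \<in> borel_measurable M" for n
    by (rule measurable_phat[where F = "\<lambda>a. \<rho> n * (Yule r1 r2 (I_proj a) - Yule r1 r2 (I_proj p))"]) simp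
  fix K e :: real assume "0 < e"
  obtain \<gamma>1 where g: "\<gamma>1 \<in> Gamma_supp r1 r2 S" using Gamma_ne by auto
  define \<kappa> where "\<kappa> = Yule_kappa r1 r2"
  have \<kappa>: "0 < \<kappa>" using Yule_kappa_pos r1 r2 by (simp add: \<kappa>_def)
  \<comment> \<open>Makes \<open>\<kappa> * e' * (\<bar>K\<bar> + 1)\<close> equal to
    \<open>e\<close>; the strict inequality at the end comes from
    \<open>K < \<bar>K\<bar> + 1\<close>.\<close>
  define e' where "e' = e / (\<kappa> * (\<bar>K\<bar> + 1))"
  have e': "0 < e'" using \<open>0 < e\<close> \<kappa> by (simp add: e'_def)
  obtain \<eta> where \<eta>: "0 < \<eta>"
    "\<And>q. q \<in> prob_arrays r1 r2 \<Longrightarrow> supp q = S \<Longrightarrow> l1_dist S q p < \<eta> \<Longrightarrow>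
      \<bar>(\<Sum>s\<in>S. Yule_weights r1 r2 $ phi r1 s * (I_proj q $$ s - I_proj p $$ s))
        - (\<Sum>s\<in>S. u $$ s * (q $$ s - p $$ s) / p $$ s)\<bar> \<le> e' * l1_dist S q p"
    using I_proj_functional_derivative[OF r_pos p_in g u rep e'] by blast
  \<comment> \<open>With a rate above \<open>(\<bar>K\<bar> + 1) / \<eta>\<close>, a scaled distance
    of at most \<open>K\<close> forces the distance below \<eta>.\<close>
  have "\<forall>\<^sub>F n in sequentially. \<rho> n > max 1 ((\<bar>K\<bar> + 1) / \<eta>)"
    using \<rho> unfolding filterlim_at_top_dense by blast
  then show "\<forall>\<^sub>F n in sequentially. AE \<omega> in M. (\<Sum>i<r1 * r2. \<bar>scaled_error (\<rho> n) n \<omega> $ i\<bar>) \<le> K \<longrightarrow>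
      \<bar>\<rho> n * (Yhat n \<omega> - Yule r1 r2 (I_proj p)) - tangent_vec u \<bullet> scaled_error (\<rho> n) n \<omega>\<bar> < e"
  proof eventually_elim
    case (elim n)
    then have \<rho>n: "\<rho> n > 1" "\<rho> n > (\<bar>K\<bar> + 1) / \<eta>" by auto
    show ?case
      using AE_good
    proof eventually_elim
      case (elim \<omega>)
      define q where "q = phat n \<omega>"
      have q: "q \<in> prob_arrays r1 r2" "supp q = S" using phat_good[OF elim] by (auto simp: q_def)
      define l where "l = l1_dist S q p"
      show ?case
      proof
        assume K: "(\<Sum>i<r1 * r2. \<bar>scaled_error (\<rho> n) n \<omega> $ i\<bar>) \<le> K"
        have "(\<Sum>i<r1 * r2. \<bar>scaled_error (\<rho> n) n \<omega> $ i\<bar>) = (\<Sum>s\<in>grid. \<bar>scaled_error (\<rho> n) n \<omega> $ phi r1 s\<bar>)"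
          by (rule sum_phi)
        also have "\<dots> \<ge> (\<Sum>s\<in>S. \<bar>scaled_error (\<rho> n) n \<omega> $ phi r1 s\<bar>)"
          using S_grid by (intro sum_mono2) auto
        finally have "(\<Sum>s\<in>S. \<bar>scaled_error (\<rho> n) n \<omega> $ phi r1 s\<bar>) \<le> K" using K by simp
        moreover have "(\<Sum>s\<in>S. \<bar>scaled_error (\<rho> n) n \<omega> $ phi r1 s\<bar>) = \<rho> n * l"
          unfolding l_def l1_dist_def sum_distrib_left q_def
        proof (intro sum.cong refl)
          fix s assume "s \<in> S"
          then have "s \<in> grid" using S_grid by auto
          then show "\<bar>scaled_error (\<rho> n) n \<omega> $ phi r1 s\<bar> = \<rho> n * \<bar>phat n \<omega> $$ s - p $$ s\<bar>"
            using \<rho>n(1) by (simp add: scaled_error_phi abs_mult)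
        qed
        ultimately have \<rho>l: "\<rho> n * l \<le> K" by simp
        have l0: "0 \<le> l" by (simp add: l_def l1_dist_nonneg)
        have "l < \<eta>"
        proof (rule ccontr)
          assume "\<not> l < \<eta>"
          then have "\<bar>K\<bar> + 1 < \<rho> n * l"
            using \<rho>n \<eta>(1) by (smt (verit) mult_left_mono pos_divide_less_eq)
          then show False using \<rho>l by linarith
        qed
        define B where "B = (\<Sum>s\<in>S. u $$ s * (q $$ s - p $$ s) / p $$ s)"
        define W where "W = (\<Sum>s\<in>S. Yule_weights r1 r2 $ phi r1 s * (I_proj q $$ s - I_proj p $$ s))"
        define R where "R = W - B"
        have R: "\<bar>R\<bar> \<le> e' * l" using \<eta>(2)[OF q] \<open>l < \<eta>\<close> by (simp only: R_def W_def B_def l_def)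
        have "tangent_vec u \<bullet> scaled_error (\<rho> n) n \<omega>
            = \<kappa> * (\<Sum>s\<in>S. u $$ s * scaled_error (\<rho> n) n \<omega> $ phi r1 s / p $$ s)"
          unfolding \<kappa>_def by (rule tangent_vec_prod[OF scaled_error_carrier])
        also have "(\<Sum>s\<in>S. u $$ s * scaled_error (\<rho> n) n \<omega> $ phi r1 s / p $$ s)
            = (\<Sum>s\<in>S. \<rho> n * (u $$ s * (q $$ s - p $$ s) / p $$ s))"
          using S_grid by (intro sum.cong refl) (subst scaled_error_phi, auto simp: q_def)
        also have "\<dots> = \<rho> n * B" by (simp only: B_def sum_distrib_left)
        finally have "tangent_vec u \<bullet> scaled_error (\<rho> n) n \<omega> = \<kappa> * (\<rho> n * B)" .
        moreover have "Yhat n \<omega> - Yule r1 r2 (I_proj p) = \<kappa> * W"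
          using Yule_diff_q[OF q] by (simp only: W_def q_def \<kappa>_def)
        ultimately have "\<rho> n * (Yhat n \<omega> - Yule r1 r2 (I_proj p)) - tangent_vec u \<bullet> scaled_error (\<rho> n) n \<omega>
            = \<rho> n * \<kappa> * R"
          by (simp add: R_def algebra_simps)
        then have "\<bar>\<rho> n * (Yhat n \<omega> - Yule r1 r2 (I_proj p)) - tangent_vec u \<bullet> scaled_error (\<rho> n) n \<omega>\<bar>
            = \<rho> n * \<kappa> * \<bar>R\<bar>"
          using \<rho>n(1) \<kappa> by (simp add: abs_mult)
        also have "\<dots> \<le> \<rho> n * \<kappa> * (e' * l)"
          using R \<rho>n(1) \<kappa> by (intro mult_left_mono) auto
        also have "\<dots> = \<kappa> * e' * (\<rho> n * l)" by (simp add: mult_ac)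
        also have "\<dots> \<le> \<kappa> * e' * K" using \<rho>l \<kappa> e' by (intro mult_left_mono) auto
        also have "\<dots> < \<kappa> * e' * (\<bar>K\<bar> + 1)" using \<kappa> e' by (intro mult_strict_left_mono) auto
        also have "\<dots> = e" using \<kappa> by (simp add: e'_def)
        finally show "\<bar>\<rho> n * (Yhat n \<omega> - Yule r1 r2 (I_proj p)) - tangent_vec u \<bullet> scaled_error (\<rho> n) n \<omega>\<bar> < e" .
      qed
    qed
  qed
qed

section \<open>Central limit theorem for the smoothed empirical array\<close>

lemma pv_props:
  "pv \<in> carrier_vec (r1 * r2)" "k < r1 * r2 \<Longrightarrow> 0 \<le> pv $ k" "(\<Sum>k<r1 * r2. pv $ k) = 1"
proof -
  show "pv \<in> carrier_vec (r1 * r2)" using p_carrier by simp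
  show "0 \<le> pv $ k" if "k < r1 * r2"
  proof -
    have "k \<in> phi r1 ` grid" using bij_betw_phi[of r1 r2] that by (simp add: bij_betw_def)
    then obtain s where s: "s \<in> grid" "k = phi r1 s" by blast
    then show ?thesis
      using vectorise_phi[OF p_carrier s(1)] p_pos[of s] p_outside[OF s(1)] by (cases "s \<in> S") auto
  qed
  have "(\<Sum>k<r1 * r2. pv $ k) = (\<Sum>s\<in>grid. p $$ s)"
    unfolding sum_phi using vectorise_phi[OF p_carrier] by (intro sum.cong) auto
  also have "\<dots> = (\<Sum>s\<in>S. p $$ s)" using S_grid p_outside by (intro sum.mono_neutral_right) auto
  finally show "(\<Sum>k<r1 * r2. pv $ k) = 1" using sum_p by simp
qed

lemma covariance_grid:
  assumes "t \<in> carrier_vec (r1 * r2)"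
  shows "t \<bullet> ((diag pv - mat (r1 * r2) (r1 * r2) (\<lambda>(i, j). pv $ i * pv $ j)) *\<^sub>v t)
    = (\<Sum>s\<in>grid. p $$ s * (t $ phi r1 s)\<^sup>2) - (\<Sum>s\<in>grid. p $$ s * t $ phi r1 s)\<^sup>2"
  unfolding multinomial_covariance_form[OF pv_props(1) assms] sum_phi
  using vectorise_phi[OF p_carrier] by simp

text \<open>Splits a projection of the error into centred contributions \<open>h\<close> of the
  observations and a deterministic bias \<open>d\<close> from the uniform term. The bias is of order
  1 / sqrt n after scaling.\<close>

lemma scaled_error_sum:
  assumes "1 \<le> n" "t \<in> carrier_vec (r1 * r2)"
  defines "h \<equiv> \<lambda>x. (\<Sum>s\<in>grid. t $ phi r1 s * indicator {pt s} x) - (\<Sum>s\<in>grid. t $ phi r1 s * p $$ s)"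
    and "d \<equiv> (\<Sum>s\<in>grid. t $ phi r1 s * (indicator S s / real (card S))) - (\<Sum>s\<in>grid. t $ phi r1 s * p $$ s)"
  shows "t \<bullet> scaled_error (sqrt n) n \<omega> = sqrt n / (real n + 1) * ((\<Sum>k<n. h (X (Suc k) \<omega>)) + d)"
proof -
  define m where "m = (\<Sum>s\<in>grid. t $ phi r1 s * p $$ s)"
  define b where "b = (\<Sum>s\<in>grid. t $ phi r1 s * (indicator S s / real (card S)))"
  have "t \<bullet> scaled_error (sqrt n) n \<omega> = (\<Sum>s\<in>grid. t $ phi r1 s * (sqrt n * (phat n \<omega> $$ s - p $$ s)))"
    unfolding scalar_prod_grid[OF scaled_error_carrier]
    by (intro sum.cong refl) (simp only: scaled_error_phi)
  also have "\<dots> = sqrt n * ((\<Sum>s\<in>grid. t $ phi r1 s * phat n \<omega> $$ s) - m)"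
    by (simp add: m_def sum_distrib_left right_diff_distrib sum_subtractf mult_ac)
  also have "(\<Sum>s\<in>grid. t $ phi r1 s * phat n \<omega> $$ s)
      = (\<Sum>s\<in>grid. (t $ phi r1 s * emp_count n \<omega> s + t $ phi r1 s * (indicator S s / real (card S))) / (real n + 1))"
    by (intro sum.cong refl) (simp add: phat_index distrib_left)
  also have "\<dots> = ((\<Sum>s\<in>grid. t $ phi r1 s * emp_count n \<omega> s) + b) / (real n + 1)"
    by (simp only: sum_divide_distrib[symmetric] sum.distrib b_def)
  also have "(\<Sum>s\<in>grid. t $ phi r1 s * emp_count n \<omega> s)
      = (\<Sum>k=1..n. \<Sum>s\<in>grid. t $ phi r1 s * indicator {pt s} (X k \<omega>))"
    unfolding emp_count_def sum_distrib_left by (rule sum.swap)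
  also have "\<dots> = (\<Sum>k=1..n. h (X k \<omega>) + m)" by (simp add: h_def m_def)
  also have "\<dots> = (\<Sum>k=1..n. h (X k \<omega>)) + n * m" by (simp add: sum.distrib)
  also have "(\<Sum>k=1..n. h (X k \<omega>)) = (\<Sum>k<n. h (X (Suc k) \<omega>))"
    by (rule sum.reindex_bij_witness[of _ Suc "\<lambda>k. k - 1"]) auto
  finally have "t \<bullet> scaled_error (sqrt n) n \<omega>
      = sqrt n * (((\<Sum>k<n. h (X (Suc k) \<omega>)) + n * m + b) / (real n + 1) - m)" .
  also have "\<dots> = sqrt n * (((\<Sum>k<n. h (X (Suc k) \<omega>)) + (b - m)) / (real n + 1))"
    by (simp add: field_simps)
  finally show ?thesis by (simp add: d_def b_def m_def)
qed

text \<open>Each projection differs from a normalised sum of i.i.d. bounded variables by a multiple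
  of 1 / sqrt n, uniformly in the outcome. The scalar central limit theorem and a Lipschitz test
  function then give the limit, whose variance is the multinomial covariance form at
  \<open>t\<close>.\<close>

lemma scaled_error_clt:
  assumes indep: "M.indep_vars (\<lambda>_. borel) X {1..}"
    and \<nu>: "is_normal_vec (r1 * r2) (0\<^sub>v (r1 * r2)) (diag pv - mat (r1 * r2) (r1 * r2) (\<lambda>(i, j). pv $ i * pv $ j)) \<nu>"
  shows "weak_conv_vec (r1 * r2) (\<lambda>n. distr M (borel_vec (r1 * r2)) (scaled_error (sqrt n) n)) \<nu>"
proof (rule weak_conv_vec_of_projections)
  show \<nu>_prob: "prob_space \<nu>" and \<nu>_sets: "sets \<nu> = sets (borel_vec (r1 * r2))"
    using \<nu> by (auto simp: is_normal_vec_def)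
  show "prob_space (distr M (borel_vec (r1 * r2)) (scaled_error (sqrt n) n))" for n :: nat
    by (rule M.prob_space_distr[OF measurable_scaled_error])
  fix t :: "real vec" and g :: "real \<Rightarrow> real"
  assume t: "t \<in> carrier_vec (r1 * r2)" and g1: "\<And>x. \<bar>g x\<bar> \<le> 1" and g_lip: "\<And>x y. \<bar>g x - g y\<bar> \<le> \<bar>x - y\<bar>"
  have g_cont: "continuous_on UNIV g" by (rule lipschitz_imp_continuous_on[OF g_lip])
  have [measurable]: "g \<in> borel_measurable borel" by (rule borel_measurable_continuous_onI[OF g_cont])
  interpret P: prob_space P by (rule P_prob)
  define T where "T = (\<lambda>s. t $ phi r1 s)"
  define m where "m = (\<Sum>s\<in>grid. T s * p $$ s)"
  define h where "h = (\<lambda>x. (\<Sum>s\<in>grid. T s * indicator {pt s} x) - m)"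
  define d where "d = (\<Sum>s\<in>grid. T s * (indicator S s / real (card S))) - m"
  define C where "C = (\<Sum>s\<in>grid. \<bar>T s\<bar>) + \<bar>m\<bar>"
  define Y where "Y = (\<lambda>k \<omega>. h (X (Suc k) \<omega>))"
  define v where "v = (\<Sum>s\<in>grid. p $$ s * (T s)\<^sup>2) - m\<^sup>2"
  have h_meas [measurable]: "h \<in> borel_measurable borel" unfolding h_def by measurable
  have hC: "\<bar>h x\<bar> \<le> C" for x
  proof -
    have "\<bar>\<Sum>s\<in>grid. T s * indicator {pt s} x\<bar> \<le> (\<Sum>s\<in>grid. \<bar>T s * indicator {pt s} x\<bar>)"
      by (rule sum_abs)
    also have "\<dots> \<le> (\<Sum>s\<in>grid. \<bar>T s\<bar>)"
      by (intro sum_mono) (auto simp: indicator_def)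
    finally show ?thesis unfolding h_def C_def by linarith
  qed
  have XS [measurable]: "X (Suc k) \<in> borel_measurable M" for k by (rule X_meas) simp
  have int_P: "integrable P (\<lambda>x. a * indicator {pt s} x :: real)" for a s
    using P_sets by (intro integrable_mult_right) (auto simp: integrable_indicator_iff P.emeasure_eq_measure)
  have int_ind: "(\<integral>x. a * indicator {pt s} x \<partial>P) = a * p $$ s" if "s \<in> grid" for a s
    using that P_sets sets_eq_imp_space_eq[OF P_sets] by (simp add: p_eq)
  have E_sum: "(\<integral>x. (\<Sum>s\<in>grid. a s * indicator {pt s} x) \<partial>P) = (\<Sum>s\<in>grid. a s * p $$ s)" for a
  proof -
    have "(\<integral>x. (\<Sum>s\<in>grid. a s * indicator {pt s} x) \<partial>P) = (\<Sum>s\<in>grid. \<integral>x. a s * indicator {pt s} x \<partial>P)"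
      by (rule Bochner_Integration.integral_sum) (rule int_P)
    also have "\<dots> = (\<Sum>s\<in>grid. a s * p $$ s)" by (intro sum.cong refl int_ind)
    finally show ?thesis .
  qed
  have E_affine: "(\<integral>x. (\<Sum>s\<in>grid. a s * indicator {pt s} x) + c \<partial>P) = (\<Sum>s\<in>grid. a s * p $$ s) + c" for a c
  proof -
    have "integrable P (\<lambda>x. \<Sum>s\<in>grid. a s * indicator {pt s} x)"
      by (rule Bochner_Integration.integrable_sum) (rule int_P)
    then have "(\<integral>x. (\<Sum>s\<in>grid. a s * indicator {pt s} x) + c \<partial>P)
        = (\<integral>x. (\<Sum>s\<in>grid. a s * indicator {pt s} x) \<partial>P) + (\<integral>x. c \<partial>P)"
      by (rule Bochner_Integration.integral_add) simp
    then show ?thesis unfolding E_sum by (simp add: P.prob_space)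
  qed
  have to_P: "M.expectation (\<lambda>\<omega>. f (X (Suc k) \<omega>)) = (\<integral>x. f x \<partial>P)" if "f \<in> borel_measurable borel"
    for f :: "real \<times> real \<Rightarrow> real" and k
    using integral_distr[OF XS that, of k] X_distr[of "Suc k"] by simp
  have mean: "M.expectation (Y k) = 0" for k
  proof -
    have "M.expectation (Y k) = (\<integral>x. h x \<partial>P)" unfolding Y_def by (rule to_P) measurable
    also have "\<dots> = (\<Sum>s\<in>grid. T s * p $$ s) + - m"
      unfolding h_def diff_conv_add_uminus by (rule E_affine)
    finally show ?thesis by (simp add: m_def)
  qed
  have var: "M.expectation (\<lambda>\<omega>. (Y k \<omega>)\<^sup>2) = v" for k
  proof -
    \<comment> \<open>The grid points are distinct, so at most one indicator is nonzero and the
      square is again affine in the indicators.\<close>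
    have sq: "(h x)\<^sup>2 = (\<Sum>s\<in>grid. ((T s)\<^sup>2 - 2 * m * T s) * indicator {pt s} x) + m\<^sup>2" for x
    proof (cases "x \<in> pt ` grid")
      case True
      then obtain s0 where s0: "s0 \<in> grid" "x = pt s0" by auto
      have sel: "(\<Sum>s\<in>grid. a s * indicator {pt s} x) = a s0" for a :: "nat \<times> nat \<Rightarrow> real"
      proof -
        have "(\<Sum>s\<in>grid. a s * indicator {pt s} x) = (\<Sum>s\<in>grid. if s0 = s then a s else 0)"
          using inj_pt s0 by (intro sum.cong refl) (auto simp: indicator_def inj_on_def)
        then show ?thesis using s0 by simp
      qed
      show ?thesis unfolding h_def sel by (simp add: power2_eq_square algebra_simps)
    next
      case False
      then have sel: "(\<Sum>s\<in>grid. a s * indicator {pt s} x) = 0" for a :: "nat \<times> nat \<Rightarrow> real"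
        by (intro sum.neutral) (auto simp: indicator_def)
      show ?thesis unfolding h_def sel by simp
    qed
    have "M.expectation (\<lambda>\<omega>. (Y k \<omega>)\<^sup>2) = (\<integral>x. (h x)\<^sup>2 \<partial>P)"
      unfolding Y_def by (rule to_P) measurable
    also have "\<dots> = (\<Sum>s\<in>grid. ((T s)\<^sup>2 - 2 * m * T s) * p $$ s) + m\<^sup>2"
      unfolding sq by (rule E_affine)
    also have "(\<Sum>s\<in>grid. ((T s)\<^sup>2 - 2 * m * T s) * p $$ s) = (\<Sum>s\<in>grid. p $$ s * (T s)\<^sup>2 - 2 * m * (T s * p $$ s))"
      by (intro sum.cong) (auto simp: algebra_simps)
    also have "\<dots> = (\<Sum>s\<in>grid. p $$ s * (T s)\<^sup>2) - 2 * m * m"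
      unfolding sum_subtractf sum_distrib_left[symmetric] m_def ..
    finally show ?thesis by (simp add: v_def power2_eq_square)
  qed
  have Y_indep: "M.indep_vars (\<lambda>_. borel) Y UNIV"
  proof -
    \<comment> \<open>The sample is indexed from 1 and the scalar theorem from 0; the shift is made
      by grouping into singleton blocks.\<close>
    have "M.indep_vars (\<lambda>j. PiM {Suc j} (\<lambda>_. borel)) (\<lambda>j \<omega>. restrict (\<lambda>i. X i \<omega>) {Suc j}) UNIV"
      by (rule M.indep_vars_restrict[OF indep]) (auto simp: disjoint_family_on_def)
    then have "M.indep_vars (\<lambda>_. borel) (\<lambda>j \<omega>. h ((restrict (\<lambda>i. X i \<omega>) {Suc j}) (Suc j))) UNIV"
      by (rule M.indep_vars_compose2[where Y = "\<lambda>j f. h (f (Suc j))"]) measurable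
    then show ?thesis by (simp add: Y_def[abs_def])
  qed
  have Y_distr: "distr M borel (Y k) = distr P borel h" for k
  proof -
    have "distr P borel h = distr (distr M borel (X (Suc k))) borel h" using X_distr[of "Suc k"] by simp
    also have "\<dots> = distr M borel (Y k)" by (subst distr_distr) (auto simp: Y_def comp_def)
    finally show ?thesis ..
  qed
  define A where "A = (\<lambda>n \<omega>. (\<Sum>k<n. Y k \<omega>) / sqrt (real n))"
  have clt: "(\<lambda>n. M.expectation (\<lambda>\<omega>. g (A n \<omega>))) \<longlonglongrightarrow> (\<integral>x. g x \<partial>normal_law 0 v)"
    unfolding A_def
    by (rule M.clt_bounded_continuous[where C = C, OF Y_indep Y_distr mean _ var g_cont g1]) (simp add: Y_def hC)
  have A_meas [measurable]: "A n \<in> borel_measurable M" for n unfolding A_def Y_def by measurable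
  have V_meas [measurable]: "(\<lambda>\<omega>. t \<bullet> scaled_error c n \<omega>) \<in> borel_measurable M" for c n
    using measurable_compose[OF measurable_scaled_error measurable_scalar_prod[OF t]] .
  \<comment> \<open>Smoothing replaces the factor 1 / sqrt n by sqrt n / (n + 1) and adds
    \<open>d\<close>. The difference is exactly
    \<open>(d * n - s) / (sqrt n * (real n + 1))\<close>, and \<bar>s\<bar> is at most
    \<open>n * C\<close>.\<close>
  have close: "\<bar>t \<bullet> scaled_error (sqrt n) n \<omega> - A n \<omega>\<bar> \<le> (C + \<bar>d\<bar>) / sqrt n" if n: "1 \<le> n" for n \<omega>
  proof -
    define s where "s = (\<Sum>k<n. Y k \<omega>)"
    have s: "\<bar>s\<bar> \<le> n * C"
    proof -
      have "\<bar>s\<bar> \<le> (\<Sum>k<n. \<bar>Y k \<omega>\<bar>)" unfolding s_def by (rule sum_abs)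
      also have "\<dots> \<le> (\<Sum>k<n. C)" by (intro sum_mono) (simp add: Y_def hC)
      finally show ?thesis by simp
    qed
    have sq: "sqrt n > 0" "sqrt n * sqrt n = real n" using n by auto
    have "t \<bullet> scaled_error (sqrt n) n \<omega> = sqrt n / (real n + 1) * (s + d)"
      unfolding s_def Y_def h_def d_def m_def T_def by (rule scaled_error_sum[OF n t])
    moreover have "a / b * (s + d) - s / a = (a * a * (s + d) - s * b) / (a * b)" if "0 < a" "0 < b" for a b :: real
      using that by (simp add: field_simps)
    from this[OF sq(1), of "real n + 1"]
    have "sqrt n / (real n + 1) * (s + d) - s / sqrt n = (d * n - s) / (sqrt n * (real n + 1))"
      unfolding sq(2) by (simp add: algebra_simps)
    ultimately have "t \<bullet> scaled_error (sqrt n) n \<omega> - A n \<omega> = (d * n - s) / (sqrt n * (real n + 1))"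
      by (simp only: A_def s_def[symmetric])
    also have "\<bar>\<dots>\<bar> = \<bar>d * n - s\<bar> / (sqrt n * (real n + 1))" using sq by simp
    also have "\<dots> \<le> ((C + \<bar>d\<bar>) * (real n + 1)) / (sqrt n * (real n + 1))"
    proof (rule divide_right_mono)
      have "0 \<le> C" using hC abs_ge_zero order_trans by blast
      have "\<bar>d * n - s\<bar> \<le> \<bar>d\<bar> * n + n * C" using s abs_mult[of d "real n"] by linarith
      also have "\<dots> \<le> (C + \<bar>d\<bar>) * (real n + 1)" using \<open>0 \<le> C\<close> by (simp add: algebra_simps)
      finally show "\<bar>d * n - s\<bar> \<le> (C + \<bar>d\<bar>) * (real n + 1)" .
    qed (use sq in auto)
    also have "\<dots> = (C + \<bar>d\<bar>) / sqrt n" by simp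
    finally show ?thesis .
  qed
  have "(\<lambda>n. M.expectation (\<lambda>\<omega>. g (t \<bullet> scaled_error (sqrt (real n)) n \<omega>)) - M.expectation (\<lambda>\<omega>. g (A n \<omega>))) \<longlonglongrightarrow> 0"
  proof (rule Lim_null_comparison)
    show "\<forall>\<^sub>F n in sequentially. norm (M.expectation (\<lambda>\<omega>. g (t \<bullet> scaled_error (sqrt (real n)) n \<omega>))
        - M.expectation (\<lambda>\<omega>. g (A n \<omega>))) \<le> (C + \<bar>d\<bar>) / sqrt (real n)"
    proof (rule eventually_sequentiallyI[of 1])
      fix n :: nat assume n: "1 \<le> n"
      have int: "integrable M (\<lambda>\<omega>. g (t \<bullet> scaled_error (sqrt (real n)) n \<omega>))" "integrable M (\<lambda>\<omega>. g (A n \<omega>))"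
        using g1 by (auto intro!: M.integrable_const_bound[where B = 1])
      have "\<bar>M.expectation (\<lambda>\<omega>. g (t \<bullet> scaled_error (sqrt (real n)) n \<omega>)) - M.expectation (\<lambda>\<omega>. g (A n \<omega>))\<bar>
          = \<bar>M.expectation (\<lambda>\<omega>. g (t \<bullet> scaled_error (sqrt (real n)) n \<omega>) - g (A n \<omega>))\<bar>"
        using int by simp
      also have "\<dots> \<le> M.expectation (\<lambda>\<omega>. \<bar>g (t \<bullet> scaled_error (sqrt (real n)) n \<omega>) - g (A n \<omega>)\<bar>)"
        by (rule integral_abs_bound)
      also have "\<dots> \<le> M.expectation (\<lambda>\<omega>. (C + \<bar>d\<bar>) / sqrt (real n))"
        using int close[OF n] g_lip by (intro integral_mono) (auto intro: order_trans)
      finally show "norm (M.expectation (\<lambda>\<omega>. g (t \<bullet> scaled_error (sqrt (real n)) n \<omega>))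
        - M.expectation (\<lambda>\<omega>. g (A n \<omega>))) \<le> (C + \<bar>d\<bar>) / sqrt (real n)"
        by (simp add: M.prob_space)
    qed
    show "(\<lambda>n. (C + \<bar>d\<bar>) / sqrt (real n)) \<longlonglongrightarrow> 0" by real_asymp
  qed
  from tendsto_add[OF this clt]
  have "(\<lambda>n. M.expectation (\<lambda>\<omega>. g (t \<bullet> scaled_error (sqrt (real n)) n \<omega>))) \<longlonglongrightarrow> (\<integral>x. g x \<partial>normal_law 0 v)"
    by simp
  moreover have "(\<integral>z. g (t \<bullet> z) \<partial>\<nu>) = (\<integral>x. g x \<partial>normal_law 0 v)"
  proof -
    have "(\<lambda>z. t \<bullet> z) \<in> borel_measurable \<nu>"
      using measurable_scalar_prod[OF t] by (simp add: measurable_cong_sets[OF \<nu>_sets refl])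
    then have "(\<integral>z. g (t \<bullet> z) \<partial>\<nu>) = (\<integral>x. g x \<partial>distr \<nu> borel (\<lambda>z. t \<bullet> z))"
      by (subst integral_distr) auto
    also have "distr \<nu> borel (\<lambda>z. t \<bullet> z) = normal_law 0 v"
      using \<nu> t covariance_grid[OF t] by (simp add: is_normal_vec_def v_def m_def T_def mult.commute)
    finally show ?thesis .
  qed
  moreover have "(\<integral>z. g (t \<bullet> z) \<partial>distr M (borel_vec (r1 * r2)) (scaled_error (sqrt (real n)) n))
      = M.expectation (\<lambda>\<omega>. g (t \<bullet> scaled_error (sqrt (real n)) n \<omega>))" for n
    using measurable_scalar_prod[OF t] by (subst integral_distr[OF measurable_scaled_error]) auto
  ultimately show "(\<lambda>n. \<integral>z. g (t \<bullet> z) \<partial>distr M (borel_vec (r1 * r2)) (scaled_error (sqrt (real n)) n))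
      \<longlonglongrightarrow> (\<integral>z. g (t \<bullet> z) \<partial>\<nu>)" by simp
qed simp

text \<open>The mean of \<open>tangent_vec u\<close> under \<open>p\<close> is a multiple of \<Sum>
  u, which is 0 by the zero margins. The rank-one part of the covariance therefore drops out, and
  the diagonal part gives the sandwich form.\<close>

lemma tangent_variance:
  assumes "u \<in> Delta0 r1 r2 S"
  shows "tangent_vec u \<bullet> ((diag pv - mat (r1 * r2) (r1 * r2) (\<lambda>(i, j). pv $ i * pv $ j)) *\<^sub>v tangent_vec u)
    = (Yule_kappa r1 r2)\<^sup>2 * (\<Sum>s\<in>S. (u $$ s)\<^sup>2 / p $$ s)"
proof -
  have "(\<Sum>s\<in>grid. p $$ s * tangent_vec u $ phi r1 s) = (\<Sum>s\<in>grid. tangent_vec u $ phi r1 s * p $$ s)"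
    by (simp add: mult.commute)
  also have "\<dots> = Yule_kappa r1 r2 * (\<Sum>s\<in>S. u $$ s * p $$ s / p $$ s)" by (rule sum_tangent_vec)
  also have "(\<Sum>s\<in>S. u $$ s * p $$ s / p $$ s) = (\<Sum>s\<in>S. u $$ s)"
    using p_pos by (intro sum.cong refl) fastforce
  also have "\<dots> = 0" by (rule sum_Delta0[OF assms S_grid])
  finally have 1: "(\<Sum>s\<in>grid. p $$ s * tangent_vec u $ phi r1 s) = 0" by simp
  have "(\<Sum>s\<in>grid. p $$ s * (tangent_vec u $ phi r1 s)\<^sup>2)
      = (\<Sum>s\<in>grid. tangent_vec u $ phi r1 s * (p $$ s * tangent_vec u $ phi r1 s))"
    by (simp add: power2_eq_square mult_ac)
  also have "\<dots> = Yule_kappa r1 r2 * (\<Sum>s\<in>S. u $$ s * (p $$ s * tangent_vec u $ phi r1 s) / p $$ s)"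
    by (rule sum_tangent_vec)
  also have "(\<Sum>s\<in>S. u $$ s * (p $$ s * tangent_vec u $ phi r1 s) / p $$ s)
      = (\<Sum>s\<in>S. Yule_kappa r1 r2 * ((u $$ s)\<^sup>2 / p $$ s))"
  proof (intro sum.cong refl)
    fix s assume s: "s \<in> S"
    then have "s \<in> grid" using S_grid by auto
    then show "u $$ s * (p $$ s * tangent_vec u $ phi r1 s) / p $$ s = Yule_kappa r1 r2 * ((u $$ s)\<^sup>2 / p $$ s)"
      using s p_pos[OF s] by (simp add: tangent_vec_phi power2_eq_square)
  qed
  also have "\<dots> = Yule_kappa r1 r2 * (\<Sum>s\<in>S. (u $$ s)\<^sup>2 / p $$ s)"
    by (simp only: sum_distrib_left)
  finally show ?thesis
    unfolding covariance_grid[OF tangent_vec_carrier] 1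
    by (simp add: power2_eq_square)
qed

end

theorem theorem5p1:
  fixes r1 r2 :: nat
    and x1 x2 :: "nat \<Rightarrow> real"
    and P :: "(real \<times> real) measure"
    and M :: "'w measure"
    and X :: "nat \<Rightarrow> 'w \<Rightarrow> real \<times> real"
    and p \<gamma> :: "real mat"
    and phat \<gamma>hat :: "nat \<Rightarrow> 'w \<Rightarrow> real mat"
    and \<Upsilon> :: real
    and \<Upsilon>hat :: "nat \<Rightarrow> 'w \<Rightarrow> real"
  assumes r1: "2 \<le> r1" and r2: "2 \<le> r2"
    and x1: "strict_mono_on {..<r1} x1" and x2: "strict_mono_on {..<r2} x2"
    and P_prob: "prob_space P" and P_sets: "sets P = sets borel"
    and P_grid: "measure P (x1 ` {..<r1} \<times> x2 ` {..<r2}) = 1"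
    and p: "p = prob_array r1 r2 x1 x2 P" and p_in: "p \<in> prob_arrays r1 r2"
    and Gamma_ne: "Gamma_supp r1 r2 (supp p) \<noteq> {}"
    and M: "prob_space M"
    and X_meas: "\<And>k. 1 \<le> k \<Longrightarrow> X k \<in> borel_measurable M"
    and X_distr: "\<And>k. 1 \<le> k \<Longrightarrow> distr M borel (X k) = P"
    and phat: "phat = smooth_emp_array r1 r2 x1 x2 (supp p) X"
    and \<gamma>: "\<gamma> = I_proj p"
    and \<gamma>hat: "\<gamma>hat = (\<lambda>n \<omega>. I_proj (phat n \<omega>))"
    and \<Upsilon>: "\<Upsilon> = Yule r1 r2 \<gamma>"
    and \<Upsilon>hat: "\<Upsilon>hat = (\<lambda>n \<omega>. Yule r1 r2 (\<gamma>hat n \<omega>))"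
  shows
    "(conv_in_prob M mat_dist phat p \<longrightarrow> conv_in_prob M dist \<Upsilon>hat \<Upsilon>) \<and>
     (conv_as M mat_dist phat p \<longrightarrow> conv_as M dist \<Upsilon>hat \<Upsilon>) \<and>
     (\<forall>\<Delta>s :: real mat list.
        1 \<le> vectorspace.dim class_ring (Delta0_space r1 r2 (supp p)) \<and>
        distinct \<Delta>s \<and>
        vectorspace.basis class_ring (Delta0_space r1 r2 (supp p)) (set \<Delta>s) \<longrightarrow>
        (let N = r1 * r2;
             pv = vectorise p;
             \<gamma>v = vectorise \<gamma>;
             phatv = (\<lambda>n \<omega>. vectorise (phat n \<omega>));
             A = mat_of_cols N (map vectorise \<Delta>s);
             R = sel_mat r1 r2 (supp p);
             At = R * A;
             \<kappa> = Yule_kappa r1 r2;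
             w = Yule_weights r1 r2;
             H = minv (transpose_mat At * minv (diag (R *\<^sub>v \<gamma>v)) * At);
             J = A * H * transpose_mat At * minv (diag (R *\<^sub>v pv)) * R;
             \<Sigma> = A * H * (transpose_mat At * minv (diag (R *\<^sub>v pv)) * At) * H * transpose_mat A
         in
           (\<forall>(\<rho> :: nat \<Rightarrow> real) (M' :: 'z measure) Z.
              filterlim \<rho> at_top sequentially \<and> prob_space M' \<and> Z \<in> M' \<rightarrow>\<^sub>M borel_vec N \<and>
              weak_conv_vec N (\<lambda>n. distr M (borel_vec N) (\<lambda>\<omega>. \<rho> n \<cdot>\<^sub>v (phatv n \<omega> - pv)))
                (distr M' (borel_vec N) Z) \<longrightarrow>
              weak_conv_m (\<lambda>n. distr M borel (\<lambda>\<omega>. \<rho> n * (\<Upsilon>hat n \<omega> - \<Upsilon>)))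
                (distr M' borel (\<lambda>z. \<kappa> * (w \<bullet> (J *\<^sub>v Z z))))) \<and>
           (prob_space.indep_vars M (\<lambda>_. borel) X {1..} \<longrightarrow>
              (\<exists>\<nu>. is_normal_vec N (0\<^sub>v N) (diag pv - mat N N (\<lambda>(i, j). pv $ i * pv $ j)) \<nu> \<and>
                 weak_conv_vec N
                   (\<lambda>n. distr M (borel_vec N) (\<lambda>\<omega>. sqrt (real n) \<cdot>\<^sub>v (phatv n \<omega> - pv))) \<nu>) \<and>
              weak_conv_m (\<lambda>n. distr M borel (\<lambda>\<omega>. sqrt (real n) * (\<Upsilon>hat n \<omega> - \<Upsilon>)))
                (normal_law 0 (\<kappa>\<^sup>2 * (w \<bullet> (\<Sigma> *\<^sub>v w)))))))"
proof -
  interpret grid_sample r1 r2 x1 x2 P M X p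
    by (rule grid_sample.intro[OF r1 r2 x1 x2 P_prob P_sets p p_in Gamma_ne M X_meas X_distr])
  have Ueq: "\<Upsilon>hat = Yhat" and U: "\<Upsilon> = Yule r1 r2 (I_proj p)"
    by (simp_all add: \<Upsilon>hat \<gamma>hat phat \<Upsilon> \<gamma>)
  have \<gamma>_props: "\<gamma> \<in> carrier_mat r1 r2" "\<And>s. s \<in> S \<Longrightarrow> 0 < \<gamma> $$ s"
    using I_proj_q[OF p_in refl] Gamma_unif_pos[of "I_proj p"] by (auto simp: \<gamma> dest: Gamma_unifD(1))
  have scaled: "(\<lambda>\<omega>. c \<cdot>\<^sub>v (vectorise (phat n \<omega>) - vectorise p)) = scaled_error c n" for c n
    by (simp add: scaled_error_def[abs_def] phat)
  show ?thesis
  proof (intro conjI impI allI, goal_cases)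
    case 1
    then show ?case using Yhat_conv_in_prob unfolding Ueq U phat by blast
  next
    case 2
    then show ?case using Yhat_conv_as unfolding Ueq U phat by blast
  next
    case (3 \<Delta>s)
    define A where "A = mat_of_cols (r1 * r2) (map vectorise \<Delta>s)"
    define R where "R = sel_mat r1 r2 (supp p)"
    define At where "At = R * A"
    define H where "H = minv (transpose_mat At * minv (diag (R *\<^sub>v vectorise \<gamma>)) * At)"
    define J where "J = A * H * transpose_mat At * minv (diag (R *\<^sub>v vectorise p)) * R"
    define \<Sigma> where "\<Sigma> = A * H * (transpose_mat At * minv (diag (R *\<^sub>v vectorise p)) * At) * H * transpose_mat A"
    define \<kappa> where "\<kappa> = Yule_kappa r1 r2"
    define w where "w = Yule_weights r1 r2"
    have ds: "distinct \<Delta>s" "vectorspace.basis class_ring (Delta0_space r1 r2 S) (set \<Delta>s)"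
      using 3 by auto
    \<comment> \<open>The matrices are folded from the inside out, so that the representer speaks
      about the very J and \<Sigma> of the claim.\<close>
    note representer = Delta0_representer[OF S_grid p_carrier p_pos \<gamma>_props Yule_weights_carrier ds,
        folded R_def A_def, folded At_def, folded H_def, folded w_def J_def \<Sigma>_def]
    obtain u where u: "u \<in> Delta0 r1 r2 S"
      "\<And>d. d \<in> Delta0 r1 r2 S \<Longrightarrow> (\<Sum>s\<in>S. w $ phi r1 s * d $$ s) = (\<Sum>s\<in>S. u $$ s * d $$ s / \<gamma> $$ s)"
      "\<And>z. z \<in> carrier_vec (r1 * r2) \<Longrightarrow> w \<bullet> (J *\<^sub>v z) = (\<Sum>s\<in>S. u $$ s * z $ phi r1 s / p $$ s)"
      "w \<bullet> (\<Sigma> *\<^sub>v w) = (\<Sum>s\<in>S. (u $$ s)\<^sup>2 / p $$ s)"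
      by (rule representer; (assumption | (rule that; blast)))
    \<comment> \<open>Stated for an arbitrary limit law, because it serves twice: with the law of
      \<open>Z\<close> and with the Gaussian law.\<close>
    have b: "weak_conv_m (\<lambda>n. distr M borel (\<lambda>\<omega>. \<rho> n * (\<Upsilon>hat n \<omega> - \<Upsilon>))) (distr \<mu> borel (\<lambda>z. tangent_vec u \<bullet> z))"
      if "filterlim \<rho> at_top sequentially" "prob_space \<mu>" "sets \<mu> = sets (borel_vec (r1 * r2))"
        "weak_conv_vec (r1 * r2) (\<lambda>n. distr M (borel_vec (r1 * r2)) (scaled_error (\<rho> n) n)) \<mu>"
      for \<rho> and \<mu> :: "real vec measure"
      unfolding Ueq U using delta_method[OF u(1) _ that] u(2) by (simp add: w_def \<gamma>)
    have tz: "tangent_vec u \<bullet> z = \<kappa> * (w \<bullet> (J *\<^sub>v z))" if "z \<in> carrier_vec (r1 * r2)" for z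
      using tangent_vec_prod[OF that] u(3)[OF that] by (simp add: \<kappa>_def)
    have part_b: "weak_conv_m (\<lambda>n. distr M borel (\<lambda>\<omega>. \<rho> n * (\<Upsilon>hat n \<omega> - \<Upsilon>)))
        (distr M' borel (\<lambda>z. \<kappa> * (w \<bullet> (J *\<^sub>v Z z))))"
      if "filterlim \<rho> at_top sequentially" "prob_space M'" and Z: "Z \<in> M' \<rightarrow>\<^sub>M borel_vec (r1 * r2)"
        and "weak_conv_vec (r1 * r2) (\<lambda>n. distr M (borel_vec (r1 * r2)) (scaled_error (\<rho> n) n))
          (distr M' (borel_vec (r1 * r2)) Z)"
      for \<rho> :: "nat \<Rightarrow> real" and M' :: "'z measure" and Z
    proof -
      have "distr (distr M' (borel_vec (r1 * r2)) Z) borel (\<lambda>z. tangent_vec u \<bullet> z)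
          = distr M' borel (\<lambda>z. tangent_vec u \<bullet> Z z)"
        using distr_distr[OF measurable_scalar_prod[OF tangent_vec_carrier] Z] by (simp add: comp_def)
      also have "\<dots> = distr M' borel (\<lambda>z. \<kappa> * (w \<bullet> (J *\<^sub>v Z z)))"
        using measurable_space[OF Z] by (intro distr_cong refl tz) simp
      finally show ?thesis
        using b[OF that(1) prob_space.prob_space_distr[OF that(2) Z] _ that(4)] by simp
    qed
    \<comment> \<open>The Gaussian law is fixed before the sample is assumed independent: it depends
      on \<open>p\<close> alone, and independence concerns only the convergence to it.\<close>
    obtain \<nu> where \<nu>: "is_normal_vec (r1 * r2) (0\<^sub>v (r1 * r2)) (diag pv - mat (r1 * r2) (r1 * r2) (\<lambda>(i, j). pv $ i * pv $ j)) \<nu>"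
      using multinomial_normal_exists[OF pv_props] by blast
    have part_c: "weak_conv_vec (r1 * r2) (\<lambda>n. distr M (borel_vec (r1 * r2)) (scaled_error (sqrt n) n)) \<nu>"
      "weak_conv_m (\<lambda>n. distr M borel (\<lambda>\<omega>. sqrt (real n) * (\<Upsilon>hat n \<omega> - \<Upsilon>)))
        (normal_law 0 (\<kappa>\<^sup>2 * (w \<bullet> (\<Sigma> *\<^sub>v w))))"
      if "prob_space.indep_vars M (\<lambda>_. borel) X {1..}"
    proof -
      show clt: "weak_conv_vec (r1 * r2) (\<lambda>n. distr M (borel_vec (r1 * r2)) (scaled_error (sqrt n) n)) \<nu>"
        by (rule scaled_error_clt[OF that \<nu>])
      have lim: "filterlim (\<lambda>n. sqrt (real n)) at_top sequentially" by real_asymp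
      have "distr \<nu> borel (\<lambda>z. tangent_vec u \<bullet> z) = normal_law 0 (\<kappa>\<^sup>2 * (w \<bullet> (\<Sigma> *\<^sub>v w)))"
        using \<nu> tangent_vec_carrier[of u] tangent_variance[OF u(1)] u(4)
        by (simp add: is_normal_vec_def \<kappa>_def)
      then show "weak_conv_m (\<lambda>n. distr M borel (\<lambda>\<omega>. sqrt (real n) * (\<Upsilon>hat n \<omega> - \<Upsilon>)))
        (normal_law 0 (\<kappa>\<^sup>2 * (w \<bullet> (\<Sigma> *\<^sub>v w))))"
        using b[OF lim _ _ clt] \<nu> by (simp add: is_normal_vec_def)
    qed
    show ?case
      unfolding Let_def scaled
        A_def[symmetric] R_def[symmetric] At_def[symmetric] H_def[symmetric] J_def[symmetric]
        \<Sigma>_def[symmetric] \<kappa>_def[symmetric] w_def[symmetric]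
      using part_b part_c \<nu> by blast
  qed
qed

end
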